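(* Let $d\ge 2$, let $M\in GL_d(\mathbb{Z})$, let $m>0$ be a real number, and let $D\subset(\mathbb{C}^* )^d$ be a Stein Reinhardt domain that is invariant under the $\mathbb{Z}$-action on $(\mathbb{C}^* )^d$ generated by $\varphi_M$. Then the complex manifold $E_m(D,M)$ is Stein if and only if $m\log\rho(M)\le 2\pi^2$.
   Context: All manifolds are complex and all maps are holomorphic. For $M\in GL_d(\mathbb{Z})$, $\varphi_M$ is the automorphism of $(\mathbb{C}^* )^d$ given by $\varphi_M(z_1,\dots,z_d)=(w_1,\dots,w_d)$ with $w_i=z_1^{M_{i1}}\cdots z_d^{M_{id}}$. It induces a $\mathbb{Z}$-action on $(\mathbb{C}^* )^d$, written $j.z=\varphi_M^{\,j}(z)$ for $j\in\mathbb{Z}$. A domain is a nonempty connected open set; a domain $D\subset(\mathbb{C}^* )^d$ is Reinhardt if it is invariant under all maps $(z_1,\dots,z_d)\mapsto(e^{i\theta_1}z_1,\dots,e^{i\theta_d}z_d)$, $\theta_k\in\mathbb{R}$. It is not assumed to be bounded. For real $m>0$ let $S_m=\{w\in\mathbb{C} : |\mathrm{Im}\, w|<\frac{m}{4\pi}\}$, with the $\mathbb{Z}$-action generated by $w\mapsto w+1$; the quotient $S_m/\mathbb{Z}$ is isomorphic to the annulus $A_m=\{w\in\mathbb{C} : 1<|w|<e^m\}$. For $D$ a $\mathbb{Z}$-invariant Reinhardt domain, $E_m(D,M)$ is the quotient manifold $(S_m\times D)/\mathbb{Z}$ for the free, properly discontinuous diagonal action $j.(w,z)=(w+j,\,j.z)$.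 It is a locally trivial bundle over $A_m$ with fiber $D$. $\rho(M)$ denotes the maximum of the spectral radii of $M$ and $M^{-1}$. *)

theory Defs
  imports "HOL-Analysis.Analysis"
begin

section \<open>Holomorphic functions of several complex variables\<close>

text \<open>Complex differentiability in the Frechet sense. It is only used on open sets.\<close>

definition cholomorphic_on :: "(complex^'n \<Rightarrow> complex) \<Rightarrow> (complex^'n) set \<Rightarrow> bool"
  where "cholomorphic_on f U \<longleftrightarrow>
    (\<forall>z\<in>U. \<exists>a :: complex^'n. (f has_derivative (\<lambda>h. \<Sum>i\<in>UNIV. a $ i * h $ i)) (at z))"

definition cholomorphic_map_on :: "(complex^'n \<Rightarrow> complex^'k) \<Rightarrow> (complex^'n) set \<Rightarrow> bool"
  where "cholomorphic_map_on F U \<longleftrightarrow> (\<forall>i. cholomorphic_on (\<lambda>z. F z $ i) U)"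

section \<open>Complex manifolds and Stein manifolds\<close>

text \<open>A topology together with an atlas; a chart is a pair of its domain and its coordinate map.\<close>

type_synonym ('a, 'n) chart = "'a set \<times> ('a \<Rightarrow> complex^'n)"
type_synonym ('a, 'n) charted = "'a topology \<times> ('a, 'n) chart set"

definition is_chart :: "'a topology \<Rightarrow> ('a, 'n::finite) chart \<Rightarrow> bool"
  where "is_chart X = (\<lambda>(U, \<phi>). openin X U \<and> open (\<phi> ` U) \<and>
    homeomorphic_map (subtopology X U) (top_of_set (\<phi> ` U)) \<phi>)"

definition complex_manifold :: "('a, 'n::finite) charted \<Rightarrow> bool"
  where "complex_manifold = (\<lambda>(X, A).
    Hausdorff_space X \<and> second_countable X \<and>
    (\<forall>c\<in>A. is_chart X c) \<and> (\<Union>(U, \<phi>)\<in>A. U) = topspace X \<and>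
    (\<forall>(U, \<phi>)\<in>A. \<forall>(V, \<psi>)\<in>A. cholomorphic_map_on (\<psi> \<circ> inv_into U \<phi>) (\<phi> ` (U \<inter> V))))"

definition holomorphic_functions :: "('a, 'n::finite) charted \<Rightarrow> ('a \<Rightarrow> complex) set"
  where "holomorphic_functions = (\<lambda>(X, A).
    {f. \<forall>(U, \<phi>)\<in>A. cholomorphic_on (f \<circ> inv_into U \<phi>) (\<phi> ` U)})"

definition holomorphic_hull :: "('a, 'n::finite) charted \<Rightarrow> 'a set \<Rightarrow> 'a set"
  where "holomorphic_hull \<X> K =
    {x \<in> topspace (fst \<X>). \<forall>f\<in>holomorphic_functions \<X>. cmod (f x) \<le> (SUP y\<in>K. cmod (f y))}"

definition holomorphically_convex :: "('a, 'n::finite) charted \<Rightarrow> bool"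
  where "holomorphically_convex \<X> \<longleftrightarrow>
    (\<forall>K. compactin (fst \<X>) K \<and> K \<noteq> {} \<longrightarrow> compactin (fst \<X>) (holomorphic_hull \<X> K))"

definition holomorphically_separable :: "('a, 'n::finite) charted \<Rightarrow> bool"
  where "holomorphically_separable \<X> \<longleftrightarrow>
    (\<forall>x\<in>topspace (fst \<X>). \<forall>y\<in>topspace (fst \<X>). x \<noteq> y \<longrightarrow>
      (\<exists>f\<in>holomorphic_functions \<X>. f x \<noteq> f y))"

text \<open>At every point, some n global holomorphic functions (n the dimension) have invertible
  Jacobian in a chart, i.e. they form a local coordinate system there.\<close>

definition has_global_local_coordinates :: "('a, 'n::finite) charted \<Rightarrow> bool"
  where "has_global_local_coordinates \<X> \<longleftrightarrow>
    (\<forall>x\<in>topspace (fst \<X>). \<exists>g :: 'n \<Rightarrow> 'a \<Rightarrow> complex.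
      (\<forall>i. g i \<in> holomorphic_functions \<X>) \<and>
      (\<exists>(U, \<phi>)\<in>snd \<X>. x \<in> U \<and>
        (\<exists>L. ((\<lambda>z. \<chi> i. g i (inv_into U \<phi> z)) has_derivative L) (at (\<phi> x)) \<and> bij L)))"

definition Stein_manifold :: "('a, 'n::finite) charted \<Rightarrow> bool"
  where "Stein_manifold \<X> \<longleftrightarrow> complex_manifold \<X> \<and> holomorphically_convex \<X> \<and>
    holomorphically_separable \<X> \<and> has_global_local_coordinates \<X>"

definition open_submanifold :: "(complex^'n) set \<Rightarrow> (complex^'n, 'n::finite) charted"
  where "open_submanifold D = (top_of_set D, {(D, \<lambda>z. z)})"

section \<open>Quotients by integer actions\<close>

definition int_orbit :: "(int \<Rightarrow> 'a \<Rightarrow> 'a) \<Rightarrow> 'a \<Rightarrow> 'a set"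
  where "int_orbit act x = range (\<lambda>j. act j x)"

definition quotient_topology :: "'a topology \<Rightarrow> ('a \<Rightarrow> 'b) \<Rightarrow> 'b topology"
  where "quotient_topology X q =
    topology (\<lambda>V. V \<subseteq> q ` topspace X \<and> openin X {x \<in> topspace X. q x \<in> V})"

lemma openin_quotient_topology:
  "openin (quotient_topology X q) V \<longleftrightarrow>
    V \<subseteq> q ` topspace X \<and> openin X {x \<in> topspace X. q x \<in> V}"
proof -
  have "istopology (\<lambda>V. V \<subseteq> q ` topspace X \<and> openin X {x \<in> topspace X. q x \<in> V})"
    unfolding istopology_def
  proof (intro conjI allI impI)
    fix S T
    assume "S \<subseteq> q ` topspace X \<and> openin X {x \<in> topspace X. q x \<in> S}"
      and "T \<subseteq> q ` topspace X \<and> openin X {x \<in> topspace X. q x \<in> T}"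
    then have "openin X ({x \<in> topspace X. q x \<in> S} \<inter> {x \<in> topspace X. q x \<in> T})"
      by blast
    moreover have "{x \<in> topspace X. q x \<in> S} \<inter> {x \<in> topspace X. q x \<in> T}
        = {x \<in> topspace X. q x \<in> S \<inter> T}"
      by blast
    ultimately show "openin X {x \<in> topspace X. q x \<in> S \<inter> T}"
      by simp
  next
    fix \<K>
    assume "\<forall>K\<in>\<K>. K \<subseteq> q ` topspace X \<and> openin X {x \<in> topspace X. q x \<in> K}"
    then have "openin X (\<Union>K\<in>\<K>. {x \<in> topspace X. q x \<in> K})"
      by blast
    moreover have "(\<Union>K\<in>\<K>. {x \<in> topspace X. q x \<in> K}) = {x \<in> topspace X. q x \<in> \<Union>\<K>}"
      by blast
    ultimately show "openin X {x \<in> topspace X. q x \<in> \<Union>\<K>}"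
      by simp
  qed blast+
  then show ?thesis
    by (simp add: quotient_topology_def)
qed

text \<open>The quotient of an open set by a free and properly discontinuous action; the charts are the
  inverses of the restrictions of the projection to open sets on which it is injective.\<close>

definition quotient_manifold ::
    "(complex^'n) set \<Rightarrow> (int \<Rightarrow> complex^'n \<Rightarrow> complex^'n) \<Rightarrow> ((complex^'n) set, 'n::finite) charted"
  where "quotient_manifold \<Omega> act =
    (quotient_topology (top_of_set \<Omega>) (int_orbit act),
     {(int_orbit act ` V, inv_into V (int_orbit act)) |V.
        open V \<and> V \<subseteq> \<Omega> \<and> inj_on (int_orbit act) V})"

section \<open>Reinhardt domains and monomial automorphisms\<close>

definition ctorus :: "(complex^'d) set"
  where "ctorus = {z. \<forall>k. z $ k \<noteq> 0}"

definition Reinhardt_domain :: "(complex^'d) set \<Rightarrow> bool"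
  where "Reinhardt_domain D \<longleftrightarrow> D \<noteq> {} \<and> open D \<and> connected D \<and> D \<subseteq> ctorus \<and>
    (\<forall>\<theta> :: real^'d. \<forall>z\<in>D. (\<chi> k. exp (\<i> * complex_of_real (\<theta> $ k)) * z $ k) \<in> D)"

definition monomial_map :: "int^'d^'d \<Rightarrow> complex^'d \<Rightarrow> complex^'d"
  where "monomial_map M z = (\<chi> i. \<Prod>k\<in>UNIV. (z $ k) powi (M $ i $ k))"

definition monomial_action :: "int^'d^'d \<Rightarrow> int \<Rightarrow> complex^'d \<Rightarrow> complex^'d"
  where "monomial_action M j =
    (if 0 \<le> j then monomial_map M ^^ nat j
     else inv_into ctorus (monomial_map M) ^^ nat (- j))"

definition invariant_under :: "(int \<Rightarrow> 'a \<Rightarrow> 'a) \<Rightarrow> 'a set \<Rightarrow> bool"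
  where "invariant_under act D \<longleftrightarrow> (\<forall>j. \<forall>z\<in>D. act j z \<in> D)"

definition int_spectrum :: "int^'d^'d \<Rightarrow> complex set"
  where "int_spectrum M =
    {c. \<exists>v :: complex^'d. v \<noteq> 0 \<and> (\<chi> i k. complex_of_int (M $ i $ k)) *v v = c *s v}"

definition int_spectral_radius :: "int^'d^'d \<Rightarrow> real"
  where "int_spectral_radius M = Max (cmod ` int_spectrum M)"

definition rho :: "int^'d^'d \<Rightarrow> real"
  where "rho M = max (int_spectral_radius M) (int_spectral_radius (matrix_inv M))"

section \<open>The bundles over annuli\<close>

text \<open>The product of the complex line with d-dimensional space is modelled on the index type
  \<^typ>\<open>'d option\<close>: the coordinate \<^const>\<open>None\<close> is the first factor w.\<close>

definition pair_vec :: "complex \<Rightarrow> complex^'d \<Rightarrow> complex^('d::finite option)"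
  where "pair_vec w z = (\<chi> k. case k of None \<Rightarrow> w | Some i \<Rightarrow> z $ i)"

definition fst_vec :: "complex^('d::finite option) \<Rightarrow> complex"
  where "fst_vec x = x $ None"

definition snd_vec :: "complex^('d::finite option) \<Rightarrow> complex^'d"
  where "snd_vec x = (\<chi> i. x $ Some i)"

definition strip :: "real \<Rightarrow> complex set"
  where "strip m = {w. \<bar>Im w\<bar> < m / (4 * pi)}"

definition diagonal_action :: "int^'d^'d \<Rightarrow> int \<Rightarrow> complex^('d::finite option) \<Rightarrow> complex^('d option)"
  where "diagonal_action M j x =
    pair_vec (fst_vec x + of_int j) (monomial_action M j (snd_vec x))"

definition E_bundle ::
    "real \<Rightarrow> (complex^'d) set \<Rightarrow> int^'d^'d \<Rightarrow> ((complex^('d option)) set, 'd::finite option) charted"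
  where "E_bundle m D M =
    quotient_manifold {pair_vec w z |w z. w \<in> strip m \<and> z \<in> D} (diagonal_action M)"

end

theory Submission
  imports Defs "HOL-Complex_Analysis.Complex_Analysis"
    "HOL-Computational_Algebra.Fundamental_Theorem_Algebra"
begin

text \<open>Write \<open>D = Rein B\<close> with \<open>B\<close> the logarithmic image; holomorphic convexity and Laurent expansion
  show that \<open>B\<close> is convex. A holomorphic function on the bundle is a function on \<open>strip m \<times> D\<close> whose
  Laurent coefficients \<open>f\<^sub>\<alpha> w\<close> satisfy \<open>\<bar>f\<^sub>\<alpha> (w + j)\<bar> \<le> C exp (- \<alpha> \<bullet> M\<^sup>j x)\<close> for \<open>x\<close> in compact subsets of \<open>B\<close>.

  If \<open>m ln \<rho> > 2 \<pi>\<^sup>2\<close>, a coefficient decaying like \<open>exp (- c \<rho>\<^sup>j)\<close> along integer translates vanishes by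
  Phragmen-Lindelof. If \<open>\<rho>\<close> itself is an eigenvalue of \<open>M\<close> or of its inverse, then normalised orbits in
  \<open>B\<close> converge to some \<open>v \<noteq> 0\<close>, \<open>B\<close> contains rays in direction \<open>v\<close>, and all \<open>f\<^sub>\<alpha>\<close> with \<open>\<alpha> \<bullet> v > 0\<close>
  vanish, so the holomorphic hull of a compact set contains a ray. Otherwise \<open>B\<close> contains points whose
  orbits grow slower than \<open>\<rho>\<^sup>j\<close>; perturbing them along an eigenvector of modulus \<open>\<rho>\<close> with real part \<open>r\<close>
  shows that all \<open>f\<^sub>\<alpha>\<close> with \<open>\<alpha> \<bullet> r \<noteq> 0\<close> vanish. Functions on the bundle are then invariant under
  rotations in direction \<open>r\<close> and do not separate points.

  If \<open>m ln \<rho> \<le> 2 \<pi>\<^sup>2\<close>, the function \<open>G w = exp (- w ^ (2 p + 2) cosh (2 \<pi>\<^sup>2 w / m))\<close> decays so fast on the strip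
  that \<open>\<Sum>j. S (w + j - w0) G (w + j) (M\<^sup>j z)\<^sup>\<alpha>\<close> converges for every \<open>\<alpha>\<close>, where \<open>S\<close> vanishes at all integers
  except 0. Its restriction to \<open>w = w0\<close> is a nonzero multiple of \<open>z\<^sup>\<alpha>\<close>. These sums separate points, give
  local coordinates, and for \<open>\<alpha>\<close> close to large multiples of supporting functionals of \<open>B\<close> they bound hulls
  away from the boundary.\<close>

text \<open>The two directions meet at the same number because \<open>strip m\<close> has half-width
  m / (4 pi). For k > 0, Re (exp (k w)) is positive on it exactly when k m / (4 pi) \<le> pi / 2,
  that is k \<le> 2 pi^2 / m; this leaves room for a factor decaying like exp (- exp (k \<bar>Re
  w\<bar>)), whereas for a larger rate Phragmen-Lindelof forbids such decay. Using cosh covers both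
  ends of the strip, hence M and its inverse at once. In the equality case cosh alone does not beat
  C j ^ p \<rho> ^ j, with p coming from Jordan blocks and C arbitrary; the power of w does, and its
  even degree keeps the sign at both ends.

  The obstacle in the other direction is that the pairing of \<alpha> with M^j x may oscillate when
  \<rho> is attained by negative or non-real eigenvalues. Since B is convex and invariant, suitable
  averages of an orbit stay in B and remove those eigenvalues. If no eigenvalue of modulus \<rho>
  survives, a small disc of perturbations lets the phase be chosen anew for each j.\<close>

no_notation fps_nth (infixl \<open>$\<close> 75)
hide_const (open) Polynomial.content

section \<open>Fourier analysis on the torus\<close>

text \<open>The exponent is an integer vector, while the other argument ranges over any commutative
  ring: logarithmic radii are real, eigenvectors complex.\<close>

definition ip :: "int^'d \<Rightarrow> ('a::comm_ring_1)^'d \<Rightarrow> 'a"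
  where "ip \<alpha> u = (\<Sum>k\<in>UNIV. of_int (\<alpha> $ k) * u $ k)"

definition lmono :: "int^'d \<Rightarrow> complex^'d \<Rightarrow> complex"
  where "lmono \<alpha> z = (\<Prod>k\<in>UNIV. (z $ k) powi (\<alpha> $ k))"

definition torus :: "(complex^'d) set"
  where "torus = {u. \<forall>k. cmod (u $ k) = 1}"

definition cisv :: "real^'d \<Rightarrow> complex^'d"
  where "cisv \<theta> = (\<chi> k. cis (\<theta> $ k))"

definition tbox :: "(real^'d) set"
  where "tbox = cbox 0 (\<chi> k. 2 * pi)"

text \<open>The mean for the normalised Haar measure of the torus, pulled back to one period box of
  angles.\<close>

definition tmean :: "(complex^'d \<Rightarrow> complex) \<Rightarrow> complex"
  where "tmean g = integral tbox (\<lambda>\<theta>. g (cisv \<theta>)) / of_real ((2 * pi) ^ CARD('d))"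

lemma ip_add: "ip \<alpha> (u + v) = ip \<alpha> u + ip \<alpha> v"
  by (simp add: ip_def sum.distrib distrib_left)

lemma ip_diff: "ip \<alpha> (u - v) = ip \<alpha> u - ip \<alpha> v"
  by (simp add: ip_def sum_subtractf right_diff_distrib)

lemma ip_uminus_left: "ip (- \<alpha>) u = - ip \<alpha> u"
  by (simp add: ip_def sum_negf)

lemma ip_smult: "ip \<alpha> (c *s u) = c * ip \<alpha> u"
  by (simp add: ip_def sum_distrib_left mult_ac)

lemma ip_scaleR: "ip \<alpha> (c *\<^sub>R u) = c * ip \<alpha> u"
  for u :: "real^'d"
  by (simp add: ip_def sum_distrib_left mult_ac)

lemma ip_axis: "ip \<alpha> (axis k c) = of_int (\<alpha> $ k) * c"
proof -
  have "ip \<alpha> (axis k c) = (\<Sum>i\<in>UNIV. if i = k then of_int (\<alpha> $ k) * c else 0)"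
    unfolding ip_def by (intro sum.cong) (auto simp: axis_def)
  then show ?thesis by simp
qed

lemma continuous_on_ip [continuous_intros]:
  fixes f :: "'a::topological_space \<Rightarrow> ('b::real_normed_field)^'d"
  assumes "continuous_on S f"
  shows "continuous_on S (\<lambda>x. ip \<alpha> (f x))"
  unfolding ip_def by (intro continuous_intros assms)

lemma lmono_mult: "lmono \<alpha> (u * v) = lmono \<alpha> u * lmono \<alpha> v"
  by (simp add: lmono_def power_int_mult_distrib prod.distrib)

lemma lmono_add:
  assumes "\<And>k. u $ k \<noteq> 0"
  shows "lmono (\<alpha> + \<beta>) u = lmono \<alpha> u * lmono \<beta> u"
  using assms by (simp add: lmono_def power_int_add prod.distrib)

lemma lmono_0 [simp]: "lmono 0 u = 1"
  by (simp add: lmono_def)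

lemma lmono_axis: "lmono (axis k n) u = (u $ k) powi n"
proof -
  have "lmono (axis k n) u = (\<Prod>i\<in>UNIV. if i = k then (u $ k) powi n else 1)"
    unfolding lmono_def by (intro prod.cong) (auto simp: axis_def)
  then show ?thesis by simp
qed

lemma torus_nz: "u \<in> torus \<Longrightarrow> u $ k \<noteq> 0"
  by (auto simp: torus_def) (metis norm_zero zero_neq_one)

lemma norm_lmono_torus: "u \<in> torus \<Longrightarrow> cmod (lmono \<alpha> u) = 1"
  by (simp add: lmono_def torus_def prod_norm [symmetric] norm_power_int)

lemma cisv_in [simp]: "cisv \<theta> \<in> torus"
  by (simp add: cisv_def torus_def)

lemma torus_mult: "u \<in> torus \<Longrightarrow> v \<in> torus \<Longrightarrow> u * v \<in> torus"
  by (simp add: torus_def norm_mult)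

lemma cisv_add: "cisv (a + b) = cisv a * cisv b"
  by (simp add: cisv_def vec_eq_iff cis_mult)

lemma torus_imp_cisv:
  fixes u :: "complex^'d"
  assumes "u \<in> torus"
  shows "\<exists>\<theta>\<in>tbox. cisv \<theta> = u"
proof
  let ?t = "\<chi> k. Arg2pi (u $ k)"
  show "?t \<in> tbox"
    by (auto simp: tbox_def mem_box_cart intro: less_imp_le Arg2pi_lt_2pi Arg2pi_ge_0)
  have "cis (Arg2pi (u $ k)) = u $ k" for k
    using Arg2pi[of "u $ k"] assms by (simp add: torus_def cis_conv_exp is_Arg_def)
  then show "cisv ?t = u"
    by (simp add: cisv_def vec_eq_iff)
qed

lemma lmono_cisv:
  fixes \<alpha> :: "int^'d"
  shows "lmono \<alpha> (cisv \<theta>) = cis (ip \<alpha> \<theta>)"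
proof -
  have "cis (a :: real) powi n = cis (of_int n * a)" for a n
  proof (cases "n \<ge> 0")
    case True
    then obtain m where "n = int m" by (metis nonneg_int_cases)
    then show ?thesis using Complex.DeMoivre[of a m] by (simp add: mult.commute)
  next
    case False
    define m where "m = nat (- n)"
    with False have "n = - int m" by simp
    then show ?thesis
      using Complex.DeMoivre[of a m] by (simp add: power_int_minus mult.commute cis_inverse flip: power_inverse)
  qed
  moreover have "cis (\<Sum>k\<in>A. f k) = (\<Prod>k\<in>A. cis (f k))" if "finite A" for A and f :: "'d \<Rightarrow> real"
    using that by induction (auto simp flip: cis_mult)
  ultimately show ?thesis
    by (simp add: lmono_def cisv_def ip_def)
qed

lemma compact_torus: "compact (torus :: (complex^'d) set)"
proof -
  have "continuous_on (tbox :: (real^'d) set) cisv"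
    unfolding cisv_def by (intro continuous_intros continuous_on_cis continuous_on_vec_lambda)
  then have "compact (cisv ` (tbox :: (real^'d) set))"
    by (rule compact_continuous_image) (simp add: tbox_def)
  moreover have "cisv ` (tbox :: (real^'d) set) = torus"
    using torus_imp_cisv by (force simp: image_iff)
  ultimately show ?thesis by simp
qed

lemma continuous_on_cisv: "continuous_on S cisv"
  unfolding cisv_def by (intro continuous_intros continuous_on_cis continuous_on_vec_lambda)

lemma continuous_on_mult_vec [continuous_intros]:
  fixes f g :: "'a::topological_space \<Rightarrow> complex^'d"
  assumes "continuous_on S f" "continuous_on S g"
  shows "continuous_on S (\<lambda>x. f x * g x)"
proof -
  have eq: "(\<lambda>x. f x * g x) = (\<lambda>x. \<chi> k. f x $ k * g x $ k)"
    by (simp add: fun_eq_iff vec_eq_iff)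
  show ?thesis
    unfolding eq by (intro continuous_intros continuous_on_vec_lambda assms)
qed

lemma continuous_on_lmono:
  assumes "\<And>z k. z \<in> S \<Longrightarrow> z $ k \<noteq> 0"
  shows "continuous_on S (lmono \<alpha>)"
  unfolding lmono_def using assms by (intro continuous_intros) auto

lemma continuous_on_lmono_torus: "continuous_on torus (lmono \<alpha>)"
  by (rule continuous_on_lmono) (rule torus_nz)

section \<open>The normalised mean over the torus and its invariance\<close>

lemma tmean_integrable:
  fixes g :: "complex^'d \<Rightarrow> complex"
  assumes "continuous_on torus g"
  shows "continuous_on UNIV (\<lambda>\<theta>. g (cisv \<theta>))" "(\<lambda>\<theta>. g (cisv \<theta>)) integrable_on cbox a b"
proof -
  show 1: "continuous_on UNIV (\<lambda>\<theta>. g (cisv \<theta>))"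
    by (rule continuous_on_compose2[OF assms continuous_on_cisv]) auto
  show "(\<lambda>\<theta>. g (cisv \<theta>)) integrable_on cbox a b" for a b
    by (rule integrable_continuous) (rule continuous_on_subset[OF 1], simp)
qed

lemma tmean_add:
  assumes "continuous_on torus f" "continuous_on torus g"
  shows "tmean (\<lambda>u. f u + g u) = tmean f + tmean g"
  unfolding tmean_def tbox_def
  by (simp add: integral_add tmean_integrable assms add_divide_distrib)

lemma tmean_cmul: "tmean (\<lambda>u. c * g u) = c * tmean g"
  by (simp add: tmean_def)

lemma tmean_diff:
  assumes "continuous_on torus f" "continuous_on torus g"
  shows "tmean (\<lambda>u. f u - g u) = tmean f - tmean g"
  using tmean_add[of f "\<lambda>u. (-1) * g u"] tmean_cmul[of "-1" g] assms
  by (simp add: continuous_intros)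

lemma tmean_sum:
  assumes "finite A" "\<And>i. i \<in> A \<Longrightarrow> continuous_on torus (f i)"
  shows "tmean (\<lambda>u. \<Sum>i\<in>A. f i u) = (\<Sum>i\<in>A. tmean (f i))"
  using assms
proof (induction A)
  case empty
  then show ?case by (simp add: tmean_def)
next
  case (insert a A)
  then show ?case by (simp add: tmean_add continuous_intros)
qed

lemma tmean_cong: "(\<And>u. u \<in> torus \<Longrightarrow> f u = g u) \<Longrightarrow> tmean f = tmean g"
  by (simp add: tmean_def)

lemma content_tbox: "content (tbox :: (real^'d) set) = (2 * pi) ^ CARD('d)"
proof -
  have "cbox 0 (\<chi> k. 2 * pi) \<noteq> ({} :: (real^'d) set)"
    by (simp add: interval_ne_empty_cart)
  then show ?thesis
    unfolding tbox_def by (subst content_cbox_cart) auto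
qed

lemma tmean_norm_le:
  fixes g :: "complex^'d \<Rightarrow> complex"
  assumes "continuous_on torus g" "\<And>u. u \<in> torus \<Longrightarrow> cmod (g u) \<le> B" "0 \<le> B"
  shows "cmod (tmean g) \<le> B"
proof -
  have "((\<lambda>\<theta>. g (cisv \<theta>)) has_integral integral tbox (\<lambda>\<theta>. g (cisv \<theta>))) (cbox 0 (\<chi> k. 2 * pi))"
    using tmean_integrable(2)[OF assms(1)] unfolding tbox_def by (rule integrable_integral)
  from has_integral_bound[OF assms(3) this] assms(2)
  have "cmod (integral tbox (\<lambda>\<theta>. g (cisv \<theta>))) \<le> B * (2 * pi) ^ CARD('d)"
    by (simp add: content_tbox flip: tbox_def)
  then show ?thesis
    by (simp add: tmean_def norm_divide norm_mult norm_power divide_le_eq)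
qed

lemma tmean_const: "tmean (\<lambda>u :: complex^'d. c) = c"
proof -
  have "integral (tbox :: (real^'d) set) (\<lambda>\<theta>. c) = of_real ((2 * pi) ^ CARD('d)) * c"
    using integral_const[of 0 "\<chi> k. 2 * pi" c] by (simp add: content_tbox scaleR_conv_of_real flip: tbox_def)
  then show ?thesis by (simp add: tmean_def)
qed

text \<open>Rotating by \<open>t\<close> slides the period box; by periodicity the part that leaves
  past 2 pi replaces the part missing at 0.\<close>

lemma tmean_rotate_axis:
  fixes g :: "complex^'d \<Rightarrow> complex"
  assumes g: "continuous_on torus g" and t: "0 \<le> t" "t \<le> 2 * pi"
  shows "tmean (\<lambda>u. g (u * cisv (axis k t))) = tmean g"
proof -
  define bx :: "real \<Rightarrow> real \<Rightarrow> (real^'d) set" where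
    "bx lo hi = cbox (\<chi> i. if i = k then lo else 0) (\<chi> i. if i = k then hi else 2 * pi)" for lo hi
  define h where "h = (\<lambda>\<theta>. g (cisv \<theta>))"
  have all_split: "(\<forall>i. P i) \<longleftrightarrow> P k \<and> (\<forall>i. i \<noteq> k \<longrightarrow> P i)" for P
    by metis
  have mem: "x \<in> bx lo hi \<longleftrightarrow> lo \<le> x $ k \<and> x $ k \<le> hi \<and> (\<forall>i. i \<noteq> k \<longrightarrow> 0 \<le> x $ i \<and> x $ i \<le> 2 * pi)" for x lo hi
    unfolding bx_def mem_box_cart by (subst all_split) simp
  have int: "h integrable_on cbox a b" for a b
    unfolding h_def by (rule tmean_integrable(2)[OF g])
  have split: "integral (bx lo hi) h = integral (bx lo c) h + integral (bx c hi) h"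
    if "lo \<le> c" "c \<le> hi" for lo c hi
  proof -
    have "axis k (1::real) \<in> Basis" by (simp add: Basis_vec_def) auto
    from integral_split[OF int this, of _ _ c]
    have "integral (bx lo hi) h = integral (bx lo hi \<inter> {x. x $ k \<le> c}) h
        + integral (bx lo hi \<inter> {x. x $ k \<ge> c}) h"
      by (simp add: bx_def inner_axis)
    moreover have "bx lo hi \<inter> {x. x $ k \<le> c} = bx lo c" "bx lo hi \<inter> {x. x $ k \<ge> c} = bx c hi"
      using that by (auto simp: mem)
    ultimately show ?thesis by simp
  qed
  have shift: "integral (bx lo hi) (\<lambda>\<theta>. h (\<theta> + axis k s)) = integral (bx (lo + s) (hi + s)) h" for lo hi s
  proof -
    have "bx lo hi = cbox ((\<chi> i. if i = k then lo + s else 0) - axis k s) ((\<chi> i. if i = k then hi + s else 2 * pi) - axis k s)"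
      unfolding bx_def by (rule arg_cong2[where f = cbox]) (auto simp: vec_eq_iff axis_def)
    then show ?thesis
      using integral_shift_cbox[of "\<chi> i. if i = k then lo + s else 0" "axis k s" "\<chi> i. if i = k then hi + s else 2 * pi" h]
      by (simp add: bx_def)
  qed
  have per: "h (\<theta> + axis k (2 * pi)) = h \<theta>" for \<theta>
  proof -
    have "cisv (\<theta> + axis k (2 * pi)) = cisv \<theta>"
      by (auto simp: cisv_def vec_eq_iff axis_def simp flip: cis_mult)
    then show ?thesis by (simp add: h_def)
  qed
  have tb: "tbox = bx 0 (2 * pi)"
    by (simp add: tbox_def bx_def if_distrib zero_vec_def cong: if_cong)
  have "integral tbox (\<lambda>\<theta>. h (\<theta> + axis k t)) = integral (bx t (2 * pi + t)) h"
    by (simp add: tb shift)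
  also have "\<dots> = integral (bx t (2 * pi)) h + integral (bx (2 * pi) (2 * pi + t)) h"
    using t by (intro split) auto
  also have "integral (bx (2 * pi) (2 * pi + t)) h = integral (bx 0 t) h"
    using shift[of 0 t "2 * pi"] per by (simp add: add.commute)
  also have "integral (bx t (2 * pi)) h + integral (bx 0 t) h = integral tbox h"
    using split[of 0 t "2 * pi"] t by (simp add: tb)
  finally show ?thesis
    by (simp add: tmean_def h_def cisv_add)
qed

lemma continuous_on_torus_mult:
  assumes "continuous_on torus g" "v \<in> torus"
  shows "continuous_on torus (\<lambda>u. g (u * v))"
  by (rule continuous_on_compose2[OF assms(1)]) (auto intro!: continuous_intros torus_mult assms)

text \<open>The coordinates are rotated one at a time. Shifts by at most one period suffice, since
  every later use can choose its angle small.\<close>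

lemma tmean_rotate:
  fixes g :: "complex^'d \<Rightarrow> complex"
  assumes g: "continuous_on torus g" and \<tau>: "\<And>k. \<bar>\<tau> $ k\<bar> \<le> 2 * pi"
  shows "tmean (\<lambda>u. g (u * cisv \<tau>)) = tmean g"
proof -
  have ax: "tmean (\<lambda>u. g (u * cisv (axis k t))) = tmean g"
    if "continuous_on torus g" "\<bar>t\<bar> \<le> 2 * pi" for g :: "complex^'d \<Rightarrow> complex" and k t
  proof (cases "t \<ge> 0")
    case True
    then show ?thesis using that by (intro tmean_rotate_axis) auto
  next
    case False
    have "axis k (- t) + axis k t = (0 :: real^'d)" "cisv (0 :: real^'d) = 1"
      by (auto simp: vec_eq_iff axis_def cisv_def)
    then have "cisv (axis k (- t)) * cisv (axis k t) = 1"
      by (simp flip: cisv_add)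
    then have "g (u * cisv (axis k (- t)) * cisv (axis k t)) = g u" for u
      by (simp add: mult.assoc)
    then show ?thesis
      using tmean_rotate_axis[OF continuous_on_torus_mult[OF that(1), of "cisv (axis k t)"], of "- t" k] that False
      by simp
  qed
  have "tmean (\<lambda>u. g (u * cisv (\<chi> k. if k \<in> A then \<tau> $ k else 0))) = tmean g" if "finite A" for A
    using that
  proof induction
    case empty
    have "cisv (\<chi> k. 0) = (1 :: complex^'d)" by (simp add: cisv_def vec_eq_iff)
    then show ?case by simp
  next
    case (insert a A)
    let ?s = "\<lambda>A. (\<chi> k. if k \<in> A then \<tau> $ k else 0) :: real^'d"
    have "?s (insert a A) = axis a (\<tau> $ a) + ?s A"
      using insert by (auto simp: vec_eq_iff axis_def)
    then have "tmean (\<lambda>u. g (u * cisv (?s (insert a A)))) = tmean (\<lambda>u. g (u * cisv (axis a (\<tau> $ a)) * cisv (?s A)))"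
      by (simp add: cisv_add mult.assoc)
    also have "\<dots> = tmean (\<lambda>u. g (u * cisv (?s A)))"
      by (rule ax[OF continuous_on_torus_mult[OF g]]) (use \<tau> in auto)
    finally show ?case using insert by simp
  qed
  from this[of UNIV] show ?thesis by simp
qed

text \<open>Rotating one coordinate by pi divided by its exponent changes the sign of the monomial
  but not its mean.\<close>

lemma tmean_lmono:
  fixes \<alpha> :: "int^'d"
  shows "tmean (lmono \<alpha>) = (if \<alpha> = 0 then 1 else 0)"
proof (cases "\<alpha> = 0")
  case True
  have "tmean (lmono (0 :: int^'d)) = tmean (\<lambda>u :: complex^'d. 1)"
    by (rule tmean_cong) simp
  with True show ?thesis using tmean_const[of 1, where 'd = 'd] by simp
next
  case False
  then obtain k where k: "\<alpha> $ k \<noteq> 0" by (auto simp: vec_eq_iff)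
  define t where "t = pi / of_int (\<alpha> $ k)"
  have "1 \<le> \<bar>real_of_int (\<alpha> $ k)\<bar>"
    using k by linarith
  then have "\<bar>t\<bar> \<le> pi"
    by (simp add: t_def divide_le_eq abs_divide)
  then have "tmean (\<lambda>u. lmono \<alpha> (u * cisv (axis k t))) = tmean (lmono \<alpha>)"
    by (intro tmean_rotate continuous_on_lmono_torus) (auto simp: axis_def)
  moreover have "lmono \<alpha> (u * cisv (axis k t)) = - 1 * lmono \<alpha> u" for u
    using k by (simp add: lmono_mult lmono_cisv ip_axis t_def cis_pi)
  ultimately show ?thesis
    using False tmean_cmul[of "-1" "lmono \<alpha>"] by simp
qed

text \<open>On the torus the conjugate of a coordinate is its inverse, so multiplying by a
  real-linear function of \<open>u\<close> only shifts the exponent \<alpha> by unit vectors. The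
  induction runs over all \<open>g\<close>, because the product case absorbs one factor into
  \<open>g\<close>.\<close>

lemma tmean_unique_real_poly:
  fixes g :: "complex^'d \<Rightarrow> complex"
  assumes "real_polynomial_function r" "continuous_on torus g" "\<And>\<alpha>. tmean (\<lambda>u. g u * lmono \<alpha> u) = 0"
  shows "tmean (\<lambda>u. g u * of_real (r u) * lmono \<alpha> u) = 0"
  using assms
proof (induction arbitrary: g \<alpha>)
  case (linear f)
  note cont = continuous_on_lmono_torus linear.prems(1)
  define p where "p k = complex_of_real (f (axis k 1))" for k
  define q where "q k = complex_of_real (f (axis k \<i>))" for k
  have eq: "g u * of_real (f u) * lmono \<alpha> u =
      (\<Sum>k\<in>UNIV. (p k / 2 - \<i> * q k / 2) * (g u * lmono (\<alpha> + axis k 1) u)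
        + (p k / 2 + \<i> * q k / 2) * (g u * lmono (\<alpha> + axis k (- 1)) u))" if u: "u \<in> torus" for u
  proof -
    have "u = (\<Sum>k\<in>UNIV. Re (u $ k) *\<^sub>R axis k 1 + Im (u $ k) *\<^sub>R axis k \<i>)"
    proof (unfold vec_eq_iff, intro allI)
      fix i
      have "(\<Sum>k\<in>UNIV. Re (u $ k) *\<^sub>R axis k 1 + Im (u $ k) *\<^sub>R axis k \<i>) $ i = (\<Sum>k\<in>UNIV. if k = i then u $ i else 0)"
        unfolding sum_component by (intro sum.cong refl) (auto simp: axis_def complex_eq_iff)
      then show "u $ i = (\<Sum>k\<in>UNIV. Re (u $ k) *\<^sub>R axis k 1 + Im (u $ k) *\<^sub>R axis k \<i>) $ i" by simp
    qed
    then have "f u = f (\<Sum>k\<in>UNIV. Re (u $ k) *\<^sub>R axis k 1 + Im (u $ k) *\<^sub>R axis k \<i>)" by simp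
    also have "\<dots> = (\<Sum>k\<in>UNIV. Re (u $ k) * f (axis k 1) + Im (u $ k) * f (axis k \<i>))"
      using linear.hyps by (simp add: linear_sum linear_add linear_cmul bounded_linear.linear)
    finally have fu: "complex_of_real (f u) = (\<Sum>k\<in>UNIV. of_real (Re (u $ k)) * p k + of_real (Im (u $ k)) * q k)"
      by (simp add: p_def q_def)
    have Re: "complex_of_real (Re (u $ k)) = (u $ k + inverse (u $ k)) / 2"
      and Im: "complex_of_real (Im (u $ k)) = - \<i> * (u $ k - inverse (u $ k)) / 2" for k
    proof -
      have "inverse (u $ k) = cnj (u $ k)"
        using u by (simp add: torus_def inverse_complex_def complex_eq_iff cmod_def)
      then show "complex_of_real (Re (u $ k)) = (u $ k + inverse (u $ k)) / 2"
        "complex_of_real (Im (u $ k)) = - \<i> * (u $ k - inverse (u $ k)) / 2"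
        by (auto simp: complex_eq_iff)
    qed
    have m: "lmono (\<alpha> + axis k 1) u = lmono \<alpha> u * u $ k" "lmono (\<alpha> + axis k (- 1)) u = lmono \<alpha> u * inverse (u $ k)" for k
      using torus_nz[OF u] by (simp_all add: lmono_add lmono_axis power_int_minus)
    show ?thesis
      unfolding fu m Re Im sum_distrib_left sum_distrib_right
    proof (intro sum.cong refl)
      fix k
      have "g * ((x + y) / 2 * p + - \<i> * (x - y) / 2 * q) * m
          = (p / 2 - \<i> * q / 2) * (g * (m * x)) + (p / 2 + \<i> * q / 2) * (g * (m * y))"
        for g m x y p q :: complex
        by (simp add: algebra_simps add_divide_distrib diff_divide_distrib)
      then show "g u * ((u $ k + inverse (u $ k)) / 2 * p k + - \<i> * (u $ k - inverse (u $ k)) / 2 * q k) * lmono \<alpha> u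
          = (p k / 2 - \<i> * q k / 2) * (g u * (lmono \<alpha> u * u $ k)) + (p k / 2 + \<i> * q k / 2) * (g u * (lmono \<alpha> u * inverse (u $ k)))" .
    qed
  qed
  have "tmean (\<lambda>u. g u * of_real (f u) * lmono \<alpha> u) =
      tmean (\<lambda>u. \<Sum>k\<in>UNIV. (p k / 2 - \<i> * q k / 2) * (g u * lmono (\<alpha> + axis k 1) u)
        + (p k / 2 + \<i> * q k / 2) * (g u * lmono (\<alpha> + axis k (- 1)) u))"
    by (rule tmean_cong) (rule eq)
  also have "\<dots> = (\<Sum>k\<in>UNIV. (p k / 2 - \<i> * q k / 2) * tmean (\<lambda>u. g u * lmono (\<alpha> + axis k 1) u)
        + (p k / 2 + \<i> * q k / 2) * tmean (\<lambda>u. g u * lmono (\<alpha> + axis k (- 1)) u))"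
    using cont by (subst tmean_sum) (auto intro!: sum.cong continuous_intros simp: tmean_add tmean_cmul continuous_on_mult)
  also have "\<dots> = 0" by (simp add: linear.prems)
  finally show ?case .
next
  case (const c)
  then show ?case
    using tmean_cmul[of "of_real c" "\<lambda>u. g u * lmono \<alpha> u"] by (simp add: mult_ac)
next
  case (add f h)
  have c: "continuous_on torus (\<lambda>u. g u * of_real (f u) * lmono \<alpha> u)" if "real_polynomial_function f" for f
    using continuous_on_polymonial_function[of f torus] that add.prems(1)
    by (auto simp: real_polynomial_function_eq intro!: continuous_intros continuous_on_lmono_torus)
  show ?case
    using tmean_add[OF c[OF add.hyps(1)] c[OF add.hyps(2)]] add.IH[OF add.prems]
    by (simp add: algebra_simps)
next
  case (mult f h)
  have c: "continuous_on torus (\<lambda>u. g u * of_real (f u))"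
    using continuous_on_polymonial_function[of f torus] mult.hyps(1) mult.prems(1)
    by (auto simp: real_polynomial_function_eq intro!: continuous_intros)
  have "tmean (\<lambda>u. (g u * of_real (f u)) * of_real (h u) * lmono \<alpha> u) = 0"
    by (rule mult.IH(2)[OF c mult.IH(1)[OF mult.prems]])
  then show ?case by (simp add: mult_ac)
qed

text \<open>Stone-Weierstrass approximates the conjugate of \<open>g\<close> by polynomial
  functions, whose means against \<open>g\<close> vanish. Hence the mean of the squared modulus of
  \<open>g\<close> is zero, and \<open>g\<close> vanishes by continuity.\<close>

theorem tmean_unique:
  fixes g :: "complex^'d \<Rightarrow> complex"
  assumes g: "continuous_on torus g" and 0: "\<And>\<alpha>. tmean (\<lambda>u. g u * lmono \<alpha> u) = 0" and u: "u \<in> torus"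
  shows "g u = 0"
proof -
  obtain S where S: "\<And>u. u \<in> torus \<Longrightarrow> cmod (g u) \<le> S"
    using compact_imp_bounded[OF compact_continuous_image[OF g compact_torus]] by (auto simp: bounded_iff)
  have S0: "S \<ge> 0" using S[OF u] norm_ge_zero order_trans by blast
  have cg: "continuous_on torus (\<lambda>u. cnj (g u))" using g by (intro continuous_intros)
  have "cmod (tmean (\<lambda>u. g u * cnj (g u))) \<le> S * e" if e: "e > 0" for e
  proof -
    obtain p where p: "polynomial_function p" "\<And>u. u \<in> torus \<Longrightarrow> cmod (cnj (g u) - p u) < e"
      using Stone_Weierstrass_polynomial_function[OF compact_torus cg e] by blast
    have cp: "continuous_on torus p" using p(1) continuous_on_polymonial_function by blast
    have "real_polynomial_function (\<lambda>u. Re (p u))" "real_polynomial_function (\<lambda>u. Im (p u))"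
      using p(1) bounded_linear_Re bounded_linear_Im unfolding polynomial_function_def o_def by blast+
    from this[THEN tmean_unique_real_poly, OF g 0, of 0]
    have "tmean (\<lambda>u. g u * of_real (Re (p u))) = 0" "tmean (\<lambda>u. g u * of_real (Im (p u))) = 0"
      by simp_all
    moreover have "g u * p u = g u * of_real (Re (p u)) + \<i> * (g u * of_real (Im (p u)))" for u
      by (subst (1) complex_eq[of "p u"]) (simp add: algebra_simps)
    ultimately have "tmean (\<lambda>u. g u * p u) = 0"
      using g cp by (simp add: tmean_add tmean_cmul continuous_intros)
    then have "tmean (\<lambda>u. g u * cnj (g u)) = tmean (\<lambda>u. g u * (cnj (g u) - p u))"
      using g cg cp by (simp add: right_diff_distrib tmean_diff continuous_intros)
    also have "cmod \<dots> \<le> S * e"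
      using S p(2) S0 e by (intro tmean_norm_le continuous_intros g cp) (auto simp: norm_mult intro!: mult_mono intro: less_imp_le)
    finally show ?thesis .
  qed
  then have le: "cmod (tmean (\<lambda>u. g u * cnj (g u))) \<le> e" if "e > 0" for e
  proof -
    \<comment> \<open>Dividing by S + 1 rather than S covers S = 0.\<close>
    have "cmod (tmean (\<lambda>u. g u * cnj (g u))) \<le> S * (e / (S + 1))"
      using \<open>\<And>e. 0 < e \<Longrightarrow> _\<close>[of "e / (S + 1)"] that S0 by simp
    also have "\<dots> \<le> e" using that S0 by (simp add: field_simps)
    finally show ?thesis .
  qed
  have "cmod (tmean (\<lambda>u. g u * cnj (g u))) \<le> 0"
    by (rule field_le_epsilon) (simp add: le)
  then have "tmean (\<lambda>u. g u * cnj (g u)) = 0" by simp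
  then have "integral tbox (\<lambda>\<theta>. of_real ((cmod (g (cisv \<theta>)))\<^sup>2) :: complex) = 0"
    by (simp add: tmean_def complex_norm_square del: of_real_power)
  moreover have int: "(\<lambda>\<theta>. (cmod (g (cisv \<theta>)))\<^sup>2) integrable_on tbox"
    unfolding tbox_def by (intro integrable_continuous continuous_intros continuous_on_compose2[OF g continuous_on_cisv]) auto
  moreover note integral_linear[OF int bounded_linear_of_real[where 'a = complex]]
  ultimately have "integral tbox (\<lambda>\<theta>. (cmod (g (cisv \<theta>)))\<^sup>2) = 0"
    by (simp only: o_def) (metis of_real_eq_0_iff)
  then have "\<forall>\<theta>\<in>cbox 0 (\<chi> k. 2 * pi). (cmod (g (cisv \<theta>)))\<^sup>2 = 0"
    unfolding tbox_def
  proof (subst (asm) integral_cbox_eq_0_iff)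
    show "continuous_on (cbox 0 (\<chi> k. 2 * pi)) (\<lambda>\<theta>. (cmod (g (cisv \<theta>)))\<^sup>2)"
      by (intro continuous_intros continuous_on_compose2[OF g continuous_on_cisv]) auto
    show "box (0 :: real^'d) (\<chi> k. 2 * pi) \<noteq> {}"
      by (simp add: interval_ne_empty_cart)
  qed auto
  then show ?thesis
    using torus_imp_cisv[OF u] by (auto simp: tbox_def)
qed

text \<open>Morera's theorem: the contour integral around a triangle is exchanged with the parameter
  integral and vanishes for each parameter.\<close>

lemma holomorphic_on_integral_param:
  fixes \<Phi> :: "complex \<Rightarrow> 'b::euclidean_space \<Rightarrow> complex"
  assumes U: "open U" and c: "continuous_on (U \<times> cbox a b) (\<lambda>(z, t). \<Phi> z t)"
    and h: "\<And>t. t \<in> cbox a b \<Longrightarrow> (\<lambda>z. \<Phi> z t) holomorphic_on U"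
  shows "(\<lambda>z. integral (cbox a b) (\<Phi> z)) holomorphic_on U"
proof -
  let ?I = "\<lambda>z. integral (cbox a b) (\<Phi> z)"
  have cI: "continuous_on U ?I"
    by (rule integral_continuous_on_param[OF c])
  have seg: "contour_integral (linepath p q) ?I = integral (cbox a b) (\<lambda>t. contour_integral (linepath p q) (\<lambda>z. \<Phi> z t))"
    and segi: "(\<lambda>t. contour_integral (linepath p q) (\<lambda>z. \<Phi> z t)) integrable_on cbox a b"
    if "closed_segment p q \<subseteq> U" for p q
  proof -
    have lin: "linepath p q s \<in> U" if "s \<in> {0..1}" for s
      using that \<open>closed_segment p q \<subseteq> U\<close> linepath_in_path by blast
    have c2: "continuous_on (cbox (0, a) (1, b)) (\<lambda>(s, t). \<Phi> (linepath p q s) t * (q - p))"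
    proof -
      have "continuous_on ({0..1} \<times> cbox a b) (\<lambda>x. (\<lambda>(z, t). \<Phi> z t) (linepath p q (fst x), snd x) * (q - p))"
        by (intro continuous_intros continuous_on_compose2[OF c] continuous_on_linepath[THEN continuous_on_compose2[of UNIV]])
          (auto intro: lin)
      then show ?thesis by (simp add: cbox_Pair_eq case_prod_unfold)
    qed
    have "contour_integral (linepath p q) ?I = integral (cbox 0 1) (\<lambda>s. integral (cbox a b) (\<lambda>t. \<Phi> (linepath p q s) t * (q - p)))"
      by (simp add: contour_integral_integral)
    also have "\<dots> = integral (cbox a b) (\<lambda>t. integral (cbox 0 1) (\<lambda>s. \<Phi> (linepath p q s) t * (q - p)))"
      by (rule integral_swap_continuous[OF c2])
    finally show "contour_integral (linepath p q) ?I = integral (cbox a b) (\<lambda>t. contour_integral (linepath p q) (\<lambda>z. \<Phi> z t))"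
      by (simp add: contour_integral_integral)
    have "continuous_on (cbox a b \<times> cbox 0 1) (\<lambda>(t, s). \<Phi> (linepath p q s) t * (q - p))"
      using continuous_on_swap_args[of "cbox 0 1" "cbox a b" "\<lambda>s t. \<Phi> (linepath p q s) t * (q - p)"] c2
      by (simp add: cbox_Pair_eq)
    from integral_continuous_on_param[OF this]
    show "(\<lambda>t. contour_integral (linepath p q) (\<lambda>z. \<Phi> z t)) integrable_on cbox a b"
      by (intro integrable_continuous) (simp add: contour_integral_integral)
  qed
  have "?I analytic_on U"
  proof (rule Morera_triangle[OF cI U], intro impI)
    fix p q r assume tri: "convex hull {p, q, r} \<subseteq> U"
    have s: "closed_segment p q \<subseteq> U" "closed_segment q r \<subseteq> U" "closed_segment r p \<subseteq> U"
      using tri by (auto simp: segment_convex_hull intro: order_trans[OF hull_mono])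
        (meson hull_mono subsetD subset_insertI insert_subset insertCI empty_subsetI)+
    have "contour_integral (linepath p q) ?I + contour_integral (linepath q r) ?I + contour_integral (linepath r p) ?I
       = integral (cbox a b) (\<lambda>t. contour_integral (linepath p q) (\<lambda>z. \<Phi> z t)
          + contour_integral (linepath q r) (\<lambda>z. \<Phi> z t) + contour_integral (linepath r p) (\<lambda>z. \<Phi> z t))"
      using s by (simp add: seg segi integral_add integrable_add)
    also have "\<dots> = integral (cbox a b) (\<lambda>t. 0)"
    proof (rule integral_cong)
      fix t assume t: "t \<in> cbox a b"
      have hol: "(\<lambda>z. \<Phi> z t) holomorphic_on convex hull {p, q, r}"
        using h[OF t] tri holomorphic_on_subset by blast
      have ci: "(\<lambda>z. \<Phi> z t) contour_integrable_on linepath x y" if "closed_segment x y \<subseteq> U" for x y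
        using h[OF t] that by (intro contour_integrable_continuous_linepath) (meson continuous_on_subset holomorphic_on_imp_continuous_on)
      from contour_integral_unique[OF Cauchy_theorem_triangle[OF hol]]
      show "contour_integral (linepath p q) (\<lambda>z. \<Phi> z t)
          + contour_integral (linepath q r) (\<lambda>z. \<Phi> z t) + contour_integral (linepath r p) (\<lambda>z. \<Phi> z t) = 0"
        using s ci by (simp add: contour_integrable_joinI valid_path_join add.assoc)
    qed
    finally show "contour_integral (linepath p q) ?I + contour_integral (linepath q r) ?I + contour_integral (linepath r p) ?I = 0"
      by simp
  qed
  then show ?thesis by (simp add: analytic_imp_holomorphic)
qed

lemma holomorphic_on_tmean:
  fixes \<Phi> :: "complex \<Rightarrow> complex^'d \<Rightarrow> complex"
  assumes U: "open U" and c: "continuous_on (U \<times> torus) (\<lambda>(z, t). \<Phi> z t)"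
    and h: "\<And>t. t \<in> torus \<Longrightarrow> (\<lambda>z. \<Phi> z t) holomorphic_on U"
  shows "(\<lambda>z. tmean (\<Phi> z)) holomorphic_on U"
  unfolding tmean_def tbox_def
proof (intro holomorphic_intros holomorphic_on_integral_param U h cisv_in)
  have "continuous_on (U \<times> cbox 0 (\<chi> k. 2 * pi)) (\<lambda>x. (\<lambda>(z, t). \<Phi> z t) (fst x, cisv (snd x)))"
    by (intro continuous_on_compose2[OF c] continuous_intros continuous_on_cisv[THEN continuous_on_compose2[of UNIV]]) auto
  then show "continuous_on (U \<times> cbox 0 (\<chi> k. 2 * pi)) (\<lambda>(z, t). \<Phi> z (cisv t))"
    by (simp add: case_prod_unfold)
qed auto

section \<open>Summability over the exponent lattice and recovery of coefficients\<close>

lemma summable_on_exp_int: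
  fixes e :: real
  assumes e: "e > 0"
  shows "(\<lambda>n :: int. exp (- e * \<bar>of_int n\<bar>)) summable_on UNIV"
proof -
  define a where "a n = exp (- e * \<bar>of_int n\<bar>)" for n :: int
  have sn: "(\<lambda>n :: nat. exp (- e) ^ n) summable_on UNIV"
    using e by (intro summable_nonneg_imp_summable_on summable_geometric) auto
  have a1: "a summable_on {0..}"
  proof -
    have "(a \<circ> int) summable_on UNIV"
      using sn by (rule summable_on_cong[THEN iffD1, rotated]) (simp add: a_def exp_of_nat_mult [symmetric] mult.commute)
    moreover have "range int = {0..}"
      by (auto simp: image_iff elim: nonneg_int_cases)
    ultimately show ?thesis
      using summable_on_reindex[of int UNIV a] by simp
  qed
  have "a summable_on uminus ` {0..}"
  proof (subst summable_on_reindex)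
    have "a \<circ> uminus = a" by (simp add: a_def fun_eq_iff)
    then show "(a \<circ> uminus) summable_on {0..}" using a1 by simp
  qed auto
  with a1 have "a summable_on ({0..} \<union> uminus ` {0..})" by (rule summable_on_union)
  moreover have "{0..} \<union> uminus ` {0..} = (UNIV :: int set)"
    by (auto simp: image_iff)
  ultimately show ?thesis by (simp add: a_def[abs_def])
qed

text \<open>A finite set of exponents lies in the product of its coordinate projections, and over a
  product set the sum factors into one-dimensional sums.\<close>

lemma summable_on_exp_l1:
  fixes e :: real
  assumes e: "e > 0"
  shows "(\<lambda>\<alpha> :: int^'d. exp (- e * (\<Sum>k\<in>UNIV. \<bar>of_int (\<alpha> $ k)\<bar>))) summable_on UNIV"
proof -
  define a where "a n = exp (- e * \<bar>of_int n\<bar>)" for n :: int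
  have a: "a summable_on UNIV" unfolding a_def[abs_def] by (rule summable_on_exp_int[OF e])
  define C where "C = infsum a UNIV"
  have C: "sum a F \<le> C" if "finite F" for F
    unfolding C_def by (rule finite_sum_le_infsum[OF a that]) (auto simp: a_def)
  have C0: "C \<ge> 0" using C[of "{}"] by simp
  show ?thesis
  proof (rule nonneg_bdd_above_summable_on)
    show "bdd_above (sum (\<lambda>\<alpha> :: int^'d. exp (- e * (\<Sum>k\<in>UNIV. \<bar>of_int (\<alpha> $ k)\<bar>))) ` {F. F \<subseteq> UNIV \<and> finite F})"
    proof (rule bdd_aboveI2)
      fix F :: "(int^'d) set" assume "F \<in> {F. F \<subseteq> UNIV \<and> finite F}"
      then have F: "finite F" by simp
      have "(\<Sum>\<alpha>\<in>F. exp (- e * (\<Sum>k\<in>UNIV. \<bar>of_int (\<alpha> $ k)\<bar>))) = (\<Sum>\<alpha>\<in>F. \<Prod>k\<in>UNIV. a (\<alpha> $ k))"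
        by (simp add: a_def exp_sum sum_distrib_left flip: sum_negf)
      also have "\<dots> = (\<Sum>g\<in>(\<lambda>\<alpha> k. \<alpha> $ k) ` F. \<Prod>k\<in>UNIV. a (g k))"
        by (subst sum.reindex) (auto simp: inj_on_def vec_eq_iff fun_eq_iff)
      also have "\<dots> \<le> (\<Sum>g\<in>PiE UNIV (\<lambda>k. (\<lambda>\<alpha>. \<alpha> $ k) ` F). \<Prod>k\<in>UNIV. a (g k))"
        using F by (intro sum_mono2 finite_PiE) (auto simp: a_def intro!: prod_nonneg)
      also have "\<dots> = (\<Prod>k\<in>UNIV. \<Sum>n\<in>(\<lambda>\<alpha>. \<alpha> $ k) ` F. a n)"
        using F by (subst prod_sum_PiE) auto
      also have "\<dots> \<le> (\<Prod>k\<in>(UNIV::'d set). C)"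
        using F by (intro prod_mono conjI C sum_nonneg) (auto simp: a_def)
      finally show "sum (\<lambda>\<alpha> :: int^'d. exp (- e * (\<Sum>k\<in>UNIV. \<bar>of_int (\<alpha> $ k)\<bar>))) F \<le> (\<Prod>k\<in>(UNIV::'d set). C)" .
    qed
  qed auto
qed

text \<open>Absolute summability makes the series converge uniformly on the torus, so integration
  against a monomial picks out one term. This uniqueness later identifies coefficients without a
  change of variables.\<close>

lemma tmean_has_sum:
  fixes a :: "int^'d \<Rightarrow> complex"
  assumes a: "(\<lambda>\<alpha>. cmod (a \<alpha>)) summable_on UNIV"
    and g: "\<And>u. u \<in> torus \<Longrightarrow> ((\<lambda>\<alpha>. a \<alpha> * lmono \<alpha> u) has_sum g u) UNIV"
  shows "continuous_on torus g" "tmean (\<lambda>u. g u * lmono (- \<beta>) u) = a \<beta>"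
proof -
  let ?S = "\<lambda>F u. \<Sum>\<alpha>\<in>F. a \<alpha> * lmono \<alpha> u"
  have "uniform_limit torus ?S (\<lambda>u. \<Sum>\<^sub>\<infinity>\<alpha>\<in>UNIV. a \<alpha> * lmono \<alpha> u) (finite_subsets_at_top UNIV)"
    by (rule Weierstrass_m_test_general[OF _ a]) (simp add: norm_mult norm_lmono_torus)
  then have ul: "uniform_limit torus ?S g (finite_subsets_at_top UNIV)"
    by (rule uniform_limit_cong'[THEN iffD1, rotated -1]) (auto simp: infsumI[OF g])
  show cg: "continuous_on torus g"
    by (rule uniform_limit_theorem[OF _ ul])
      (auto intro!: eventuallyI continuous_intros continuous_on_lmono_torus)
  have le: "cmod (tmean (\<lambda>u. g u * lmono (- \<beta>) u) - a \<beta>) \<le> e" if e: "e > 0" for e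
  proof -
    have "\<forall>\<^sub>F F in finite_subsets_at_top UNIV. \<forall>u\<in>torus. dist (?S F u) (g u) < e"
      using ul e by (simp add: uniform_limit_iff)
    then obtain F0 where F0: "finite F0" "\<And>F u. finite F \<Longrightarrow> F0 \<subseteq> F \<Longrightarrow> u \<in> torus \<Longrightarrow> dist (?S F u) (g u) < e"
      by (auto simp: eventually_finite_subsets_at_top)
    \<comment> \<open>Including \<beta> guarantees that the partial sum contains the term whose
      coefficient is extracted.\<close>
    let ?F = "insert \<beta> F0"
    have cS: "continuous_on torus (?S ?F)"
      by (intro continuous_intros continuous_on_lmono_torus)
    have "tmean (\<lambda>u. ?S ?F u * lmono (- \<beta>) u) = tmean (\<lambda>u. \<Sum>\<alpha>\<in>?F. a \<alpha> * lmono (\<alpha> - \<beta>) u)"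
    proof (rule tmean_cong)
      fix u :: "complex^'d" assume u: "u \<in> torus"
      show "?S ?F u * lmono (- \<beta>) u = (\<Sum>\<alpha>\<in>?F. a \<alpha> * lmono (\<alpha> - \<beta>) u)"
        using lmono_add[OF torus_nz[OF u], of _ "- \<beta>"] by (simp only: sum_distrib_right) (simp add: mult.assoc)
    qed
    also have "\<dots> = (\<Sum>\<alpha>\<in>?F. a \<alpha> * tmean (lmono (\<alpha> - \<beta>)))"
      using F0(1) by (subst tmean_sum) (auto intro!: continuous_intros continuous_on_lmono_torus simp: tmean_cmul)
    also have "\<dots> = (\<Sum>\<alpha>\<in>?F. if \<alpha> = \<beta> then a \<beta> else 0)"
      by (intro sum.cong refl) (simp add: tmean_lmono)
    also have "\<dots> = a \<beta>" using F0(1) by simp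
    finally have "tmean (\<lambda>u. g u * lmono (- \<beta>) u) - a \<beta> = tmean (\<lambda>u. (g u - ?S ?F u) * lmono (- \<beta>) u)"
      using tmean_diff[of "\<lambda>u. g u * lmono (- \<beta>) u" "\<lambda>u. ?S ?F u * lmono (- \<beta>) u"] cg cS
      by (simp add: left_diff_distrib continuous_intros continuous_on_lmono_torus)
    also have "cmod \<dots> \<le> e"
    proof (rule tmean_norm_le)
      fix u :: "complex^'d" assume u: "u \<in> torus"
      have "dist (?S ?F u) (g u) < e" by (rule F0(2)) (use F0(1) u in auto)
      then show "cmod ((g u - ?S ?F u) * lmono (- \<beta>) u) \<le> e"
        by (simp only: norm_mult norm_lmono_torus[OF u] dist_norm norm_minus_commute mult_1_right less_imp_le)
    qed (use e cg cS in \<open>auto intro!: continuous_intros continuous_on_lmono_torus\<close>)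
    finally show ?thesis .
  qed
  have "cmod (tmean (\<lambda>u. g u * lmono (- \<beta>) u) - a \<beta>) \<le> 0"
    by (rule field_le_epsilon) (simp add: le)
  then show "tmean (\<lambda>u. g u * lmono (- \<beta>) u) = a \<beta>" by simp
qed

section \<open>Laurent expansion on Reinhardt domains\<close>

definition lgv :: "complex^'d \<Rightarrow> real^'d"
  where "lgv z = (\<chi> k. ln (cmod (z $ k)))"

definition cexpv :: "complex^'d \<Rightarrow> complex^'d"
  where "cexpv u = (\<chi> k. exp (u $ k))"

definition cofr :: "real^'d \<Rightarrow> complex^'d"
  where "cofr x = (\<chi> k. of_real (x $ k))"

definition rx :: "real^'d \<Rightarrow> complex^'d"
  where "rx x = (\<chi> k. of_real (exp (x $ k)))"

definition Rein :: "(real^'d) set \<Rightarrow> (complex^'d) set"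
  where "Rein B = {z \<in> ctorus. lgv z \<in> B}"

text \<open>Holomorphy is only required along exponential lines, which is all that the Laurent expansion
  uses; see \<open>cholomorphic_imp_rhol\<close> for functions holomorphic in the usual sense.\<close>

definition rhol :: "(real^'d) set \<Rightarrow> (complex^'d \<Rightarrow> complex) \<Rightarrow> bool"
  where "rhol B F \<longleftrightarrow> continuous_on (Rein B) F \<and>
    (\<forall>p y. (\<lambda>\<zeta>. F (cexpv (p + \<zeta> *s y))) holomorphic_on {\<zeta>. cexpv (p + \<zeta> *s y) \<in> Rein B})"

text \<open>The Fourier coefficient on the torus of radii exp x, so it contains the factor exp (ip
  \<alpha> x); in this form the supremum on that torus bounds it directly.\<close>

definition fc :: "(complex^'d \<Rightarrow> complex) \<Rightarrow> int^'d \<Rightarrow> real^'d \<Rightarrow> complex"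
  where "fc F \<alpha> x = tmean (\<lambda>u. F (rx x * u) * lmono (- \<alpha>) u)"

lemma cexpv_add: "cexpv (u + v) = cexpv u * cexpv v"
  by (simp add: cexpv_def vec_eq_iff exp_add)

lemma cexpv_cofr: "cexpv (cofr x) = rx x"
  by (simp add: cexpv_def cofr_def rx_def vec_eq_iff exp_of_real)

lemma cexpv_i: "cexpv (\<i> *s cofr \<theta>) = cisv \<theta>"
  by (simp add: cexpv_def cofr_def cisv_def vec_eq_iff cis_conv_exp)

lemma cexpv_line: "cexpv (cofr x + \<zeta> *s cofr y) = rx (x + Re \<zeta> *\<^sub>R y) * cisv (Im \<zeta> *\<^sub>R y)"
proof -
  have "exp (complex_of_real a + \<zeta> * complex_of_real b) = of_real (exp (a + Re \<zeta> * b)) * cis (Im \<zeta> * b)" for a b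
    by (simp add: exp_eq_polar)
  then show ?thesis
    by (simp add: vec_eq_iff cexpv_def cofr_def rx_def cisv_def)
qed

lemma cexpv_in_ctorus [simp]: "cexpv u \<in> ctorus" "rx x \<in> ctorus"
  by (simp_all add: cexpv_def rx_def ctorus_def)

lemma torus_in_ctorus: "u \<in> torus \<Longrightarrow> u \<in> ctorus"
  using torus_nz by (auto simp: ctorus_def)

lemma ctorus_mult: "u \<in> ctorus \<Longrightarrow> v \<in> ctorus \<Longrightarrow> u * v \<in> ctorus"
  by (simp add: ctorus_def)

lemma lgv_mult: "u \<in> ctorus \<Longrightarrow> v \<in> ctorus \<Longrightarrow> lgv (u * v) = lgv u + lgv v"
  by (simp add: ctorus_def lgv_def vec_eq_iff norm_mult ln_mult)

lemma lgv_rx [simp]: "lgv (rx x) = x"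
  by (simp add: lgv_def rx_def vec_eq_iff)

lemma lgv_torus: "u \<in> torus \<Longrightarrow> lgv u = 0"
  by (simp add: lgv_def torus_def vec_eq_iff)

lemma lgv_rx_torus [simp]: "u \<in> torus \<Longrightarrow> lgv (rx x * u) = x"
  by (simp add: lgv_mult torus_in_ctorus lgv_torus)

lemma in_Rein [simp]: "u \<in> torus \<Longrightarrow> rx x * u \<in> Rein B \<longleftrightarrow> x \<in> B"
  by (simp add: Rein_def ctorus_mult torus_in_ctorus)

lemma ctorus_polar:
  assumes "z \<in> ctorus"
  obtains u where "u \<in> torus" "z = rx (lgv z) * u"
proof
  let ?u = "\<chi> k. z $ k / of_real (cmod (z $ k))"
  show "?u \<in> torus"
    using assms by (simp add: torus_def ctorus_def norm_divide)
  show "z = rx (lgv z) * ?u"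
    using assms by (simp add: rx_def lgv_def vec_eq_iff ctorus_def)
qed

lemma continuous_on_rx [continuous_intros]: "continuous_on S f \<Longrightarrow> continuous_on S (\<lambda>x. rx (f x))"
  unfolding rx_def by (intro continuous_intros continuous_on_vec_lambda)

lemma continuous_on_cexpv [continuous_intros]: "continuous_on S f \<Longrightarrow> continuous_on S (\<lambda>x. cexpv (f x))"
  unfolding cexpv_def by (intro continuous_intros continuous_on_vec_lambda)

lemma continuous_on_lgv: "continuous_on ctorus lgv"
  unfolding lgv_def by (intro continuous_intros continuous_on_vec_lambda) (auto simp: ctorus_def)

lemma open_ctorus: "open (ctorus :: (complex^'d) set)"
proof -
  have "ctorus = (\<Inter>k. {z :: complex^'d. z $ k \<noteq> 0})" by (auto simp: ctorus_def)
  moreover have "open {z :: complex^'d. z $ k \<noteq> 0}" for k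
    by (intro open_Collect_neq continuous_intros)
  ultimately show ?thesis by (metis (no_types, lifting) finite open_INT)
qed

lemma open_Rein: "open B \<Longrightarrow> open (Rein B)"
  using continuous_open_preimage[OF continuous_on_lgv open_ctorus, of B]
  by (simp add: Rein_def vimage_def Int_def)

lemma compact_rx_torus:
  assumes "compact Y"
  shows "compact ((\<lambda>(y, u). rx y * u) ` (Y \<times> torus))"
  by (intro compact_continuous_image compact_Times assms compact_torus)
    (auto simp: case_prod_unfold intro!: continuous_intros)

section \<open>Fourier coefficients as functions of the logarithmic radius\<close>

lemma rhol_power: "rhol B F \<Longrightarrow> rhol B (\<lambda>z. F z ^ n)"
  by (auto simp: rhol_def intro!: continuous_intros holomorphic_intros)

lemma rhol_subset: "rhol B F \<Longrightarrow> C \<subseteq> B \<Longrightarrow> rhol C F"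
  unfolding rhol_def by (auto simp: Rein_def intro: continuous_on_subset holomorphic_on_subset)

lemma rhol_torus_cont:
  assumes "rhol B F" "x \<in> B"
  shows "continuous_on torus (\<lambda>u. F (rx x * u))"
  using assms by (auto simp: rhol_def intro!: continuous_on_compose2[of "Rein B" F] continuous_intros)

lemma fc_bound:
  assumes F: "rhol B F" "x \<in> B" and S: "\<And>u. u \<in> torus \<Longrightarrow> cmod (F (rx x * u)) \<le> S"
  shows "cmod (fc F \<alpha> x) \<le> S"
proof -
  have "0 \<le> S" using S[of "cisv 0"] norm_ge_zero order_trans by (metis cisv_in)
  then show ?thesis
    unfolding fc_def using S
    by (intro tmean_norm_le continuous_intros rhol_torus_cont[OF F] continuous_on_lmono_torus)
      (auto simp: norm_mult norm_lmono_torus)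
qed

text \<open>Rotating the integrand shows that the normalised coefficient, as a holomorphic function of a
  complexified direction, is invariant under imaginary translations.\<close>

lemma fc_const_convex:
  fixes F :: "complex^'d \<Rightarrow> complex"
  assumes C: "open C" "convex C" and F: "rhol C F" and xy: "x \<in> C" "y \<in> C"
  shows "fc F \<alpha> y = fc F \<alpha> x * exp (of_real (ip \<alpha> (y - x)))"
proof -
  define v where "v = y - x"
  define U where "U = {\<zeta>. x + Re \<zeta> *\<^sub>R v \<in> C}"
  define \<Phi> where "\<Phi> \<zeta> u = F (cexpv (cofr x + \<zeta> *s cofr v) * u) * lmono (- \<alpha>) u" for \<zeta> u
  define \<psi> where "\<psi> \<zeta> = tmean (\<Phi> \<zeta>) * exp (- \<zeta> * of_real (ip \<alpha> v))" for \<zeta>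
  have Uo: "open U"
    unfolding U_def by (intro open_vimage[OF C(1), unfolded vimage_def] continuous_intros)
  have Uc: "convex U"
  proof (rule convexI)
    fix a b :: complex and s t :: real assume h: "a \<in> U" "b \<in> U" "0 \<le> s" "0 \<le> t" "s + t = 1"
    then have "s *\<^sub>R (x + Re a *\<^sub>R v) + t *\<^sub>R (x + Re b *\<^sub>R v) \<in> C"
      using C(2) by (auto simp: U_def convex_def)
    moreover have "s *\<^sub>R (x + Re a *\<^sub>R v) + t *\<^sub>R (x + Re b *\<^sub>R v) = (s + t) *\<^sub>R x + Re (s *\<^sub>R a + t *\<^sub>R b) *\<^sub>R v"
      by (simp add: algebra_simps)
    ultimately show "s *\<^sub>R a + t *\<^sub>R b \<in> U" using h(5) by (simp add: U_def)
  qed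
  have inC: "cexpv (cofr x + \<zeta> *s cofr v) * u \<in> Rein C" if "\<zeta> \<in> U" "u \<in> torus" for \<zeta> u
    using that by (simp add: cexpv_line mult.assoc torus_mult U_def)
  have contF: "continuous_on (Rein C) F" using F by (simp add: rhol_def)
  have sm: "continuous_on S (\<lambda>z. f z *s cofr v)" if "continuous_on S f" for S and f :: "'z::topological_space \<Rightarrow> complex"
    unfolding vector_scalar_mult_def using that by (intro continuous_intros continuous_on_vec_lambda)
  have "(\<lambda>\<zeta>. tmean (\<Phi> \<zeta>)) holomorphic_on U"
  proof (rule holomorphic_on_tmean[OF Uo])
    have "continuous_on (U \<times> torus) (\<lambda>p. F (cexpv (cofr x + fst p *s cofr v) * snd p) * lmono (- \<alpha>) (snd p))"
      by (intro continuous_intros continuous_on_compose2[OF contF] continuous_on_compose2[OF continuous_on_lmono_torus] sm)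
        (use inC in auto)
    then show "continuous_on (U \<times> torus) (\<lambda>(\<zeta>, u). \<Phi> \<zeta> u)"
      by (simp add: \<Phi>_def case_prod_unfold)
  next
    fix u :: "complex^'d" assume u: "u \<in> torus"
    then obtain \<theta> where \<theta>: "u = cisv \<theta>" using torus_imp_cisv by blast
    have eq: "cexpv (cofr x + \<zeta> *s cofr v) * u = cexpv ((cofr x + \<i> *s cofr \<theta>) + \<zeta> *s cofr v)" for \<zeta>
      by (simp add: \<theta> cexpv_add cexpv_i mult_ac)
    have "(\<lambda>\<zeta>. F (cexpv (cofr x + \<zeta> *s cofr v) * u)) holomorphic_on U"
      unfolding eq
    proof (rule holomorphic_on_subset)
      show "(\<lambda>\<zeta>. F (cexpv (cofr x + \<i> *s cofr \<theta> + \<zeta> *s cofr v))) holomorphic_on {\<zeta>. cexpv (cofr x + \<i> *s cofr \<theta> + \<zeta> *s cofr v) \<in> Rein C}"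
        using F by (simp add: rhol_def)
      show "U \<subseteq> {\<zeta>. cexpv (cofr x + \<i> *s cofr \<theta> + \<zeta> *s cofr v) \<in> Rein C}"
        using inC[OF _ u, unfolded eq] by auto
    qed
    then show "(\<lambda>\<zeta>. \<Phi> \<zeta> u) holomorphic_on U"
      unfolding \<Phi>_def by (intro holomorphic_intros)
  qed
  then have \<psi>h: "\<psi> holomorphic_on U"
    unfolding \<psi>_def by (intro holomorphic_intros)
  \<comment> \<open>So small that \<tau> v has entries of modulus at most 2 pi, the range in which
    rotation invariance is available.\<close>
  define \<delta> where "\<delta> = 2 * pi / (1 + norm v)"
  have \<delta>: "\<delta> > 0" by (simp add: \<delta>_def add_pos_nonneg)
  have 0: "0 \<in> U" and 1: "1 \<in> U" using xy by (auto simp: U_def v_def)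
  have shift: "\<psi> (\<i> * of_real \<tau>) = \<psi> 0" if \<tau>: "\<bar>\<tau>\<bar> \<le> \<delta>" for \<tau>
  proof -
    have c: "continuous_on torus (\<Phi> 0)"
      unfolding \<Phi>_def
      by (intro continuous_intros continuous_on_compose2[OF contF] continuous_on_lmono_torus) (use inC[OF 0] in auto)
    have "\<bar>(\<tau> *\<^sub>R v) $ k\<bar> \<le> 2 * pi" for k
    proof -
      have "\<bar>(\<tau> *\<^sub>R v) $ k\<bar> \<le> \<delta> * (1 + norm v)"
        using component_le_norm_cart[of v k] \<tau> \<delta> by (auto simp: abs_mult intro!: mult_mono)
      also have "\<dots> = 2 * pi"
        using add_pos_nonneg[of 1 "norm v"] by (simp add: \<delta>_def)
      finally show ?thesis .
    qed
    then have "tmean (\<Phi> 0) = tmean (\<lambda>u. \<Phi> 0 (u * cisv (\<tau> *\<^sub>R v)))"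
      by (intro tmean_rotate[OF c, symmetric])
    also have "\<dots> = tmean (\<lambda>u. lmono (- \<alpha>) (cisv (\<tau> *\<^sub>R v)) * \<Phi> (\<i> * of_real \<tau>) u)"
    proof (rule tmean_cong)
      fix u :: "complex^'d"
      have "cexpv (cofr x + 0 *s cofr v) * (u * cisv (\<tau> *\<^sub>R v)) = cexpv (cofr x + (\<i> * of_real \<tau>) *s cofr v) * u"
        using cexpv_line[of x 0 v] cexpv_line[of x "\<i> * of_real \<tau>" v] by (simp add: cisv_def vec_eq_iff)
      then show "\<Phi> 0 (u * cisv (\<tau> *\<^sub>R v)) = lmono (- \<alpha>) (cisv (\<tau> *\<^sub>R v)) * \<Phi> (\<i> * of_real \<tau>) u"
        unfolding \<Phi>_def by (simp only: lmono_mult) (simp only: mult.assoc mult.commute mult.left_commute)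
    qed
    also have "\<dots> = cis (- \<tau> * ip \<alpha> v) * tmean (\<Phi> (\<i> * of_real \<tau>))"
      by (simp add: tmean_cmul lmono_cisv ip_uminus_left ip_scaleR)
    finally show ?thesis
      by (simp add: \<psi>_def cis_conv_exp mult_ac)
  qed
  \<comment> \<open>The identity theorem carries constancy from a segment of the imaginary axis to
    all of \<open>U\<close>, in particular to 1, which corresponds to the point
    \<open>y\<close>.\<close>
  have "\<psi> 1 - \<psi> 0 = 0"
  proof (rule analytic_continuation[where f = "\<lambda>\<zeta>. \<psi> \<zeta> - \<psi> 0" and S = U and U = "(\<lambda>\<tau>. \<i> * of_real \<tau>) ` {0..\<delta>}" and \<xi> = 0])
    show "0 islimpt (\<lambda>\<tau>. \<i> * complex_of_real \<tau>) ` {0..\<delta>}"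
      unfolding islimpt_approachable
    proof (intro allI impI)
      fix e :: real assume "e > 0"
      then show "\<exists>x'\<in>(\<lambda>\<tau>. \<i> * complex_of_real \<tau>) ` {0..\<delta>}. x' \<noteq> 0 \<and> dist x' 0 < e"
        using \<delta> by (intro bexI[of _ "\<i> * of_real (min \<delta> (e / 2))"]) (auto simp: norm_mult min_def)
    qed
    show "(\<lambda>\<tau>. \<i> * complex_of_real \<tau>) ` {0..\<delta>} \<subseteq> U"
      using xy by (auto simp: U_def)
  qed (use Uo Uc 0 1 shift in \<open>auto intro!: holomorphic_intros \<psi>h convex_connected\<close>)
  then have "\<psi> 1 = \<psi> 0" by simp
  moreover have "\<Phi> 0 = (\<lambda>u. F (rx x * u) * lmono (- \<alpha>) u)"
    by (simp add: fun_eq_iff \<Phi>_def cexpv_cofr)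
  then have "\<psi> 0 = fc F \<alpha> x"
    by (simp add: \<psi>_def fc_def)
  moreover have "cexpv (cofr x + 1 *s cofr v) = rx y"
    using cexpv_line[of x 1 v] by (simp add: v_def cisv_def vec_eq_iff)
  then have "\<Phi> 1 = (\<lambda>u. F (rx y * u) * lmono (- \<alpha>) u)"
    by (simp add: fun_eq_iff \<Phi>_def)
  then have "\<psi> 1 = fc F \<alpha> y * exp (- of_real (ip \<alpha> v))"
    by (simp add: \<psi>_def fc_def)
  ultimately show ?thesis
    by (simp add: v_def exp_minus field_simps)
qed

text \<open>The normalised coefficient is locally constant by the convex case on balls, and
  \<open>B\<close> is connected. Convexity of \<open>B\<close> cannot be assumed here, since it is
  derived from the resulting expansion.\<close>

lemma fc_eq:
  assumes B: "open B" "connected B" and F: "rhol B F" and xy: "x \<in> B" "y \<in> B"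
  shows "fc F \<alpha> y = fc F \<alpha> x * exp (of_real (ip \<alpha> (y - x)))"
proof -
  define n where "n x = fc F \<alpha> x * exp (- of_real (ip \<alpha> x))" for x
  have "n x = n y"
  proof (rule connected_local_const[OF B(2) xy], intro ballI)
    fix a assume a: "a \<in> B"
    then obtain e where e: "e > 0" "ball a e \<subseteq> B" using B(1) openE by blast
    have "n a = n b" if "b \<in> ball a e" for b
    proof -
      have "fc F \<alpha> b = fc F \<alpha> a * exp (of_real (ip \<alpha> (b - a)))"
        using that e by (intro fc_const_convex[of "ball a e"] rhol_subset[OF F]) auto
      then show ?thesis by (simp add: n_def ip_diff exp_diff exp_minus field_simps)
    qed
    then show "\<forall>\<^sub>F b in at a within B. n a = n b"
      using e by (auto simp: eventually_at intro!: exI[of _ e] simp: dist_commute)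
  qed
  then show ?thesis
    by (simp add: n_def ip_diff exp_diff exp_minus field_simps)
qed

text \<open>Moving \<open>x\<close> into the corner of a small cube selected by the signs of
  \<alpha> shows that the coefficients decay exponentially in the l1 norm of \<alpha>. The sum of
  the series then has the same Fourier coefficients as \<open>F\<close>, so the two agree.\<close>

theorem laurent_expansion:
  fixes F :: "complex^'d \<Rightarrow> complex"
  assumes B: "open B" "connected B" and F: "rhol B F" and x: "x \<in> B"
  shows "(\<lambda>\<alpha>. cmod (fc F \<alpha> x)) summable_on UNIV"
    and "u \<in> torus \<Longrightarrow> ((\<lambda>\<alpha>. fc F \<alpha> x * lmono \<alpha> u) has_sum F (rx x * u)) UNIV"
proof -
  obtain e0 where e0: "e0 > 0" "cball x e0 \<subseteq> B" using B(1) x open_contains_cball by blast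
  \<comment> \<open>The l1 norm bounds the Euclidean one, so a cube with this half-side fits into
    the ball of radius e0.\<close>
  define e where "e = e0 / real CARD('d)"
  have e: "e > 0" using e0 by (simp add: e_def)
  have Y: "y \<in> B" if "\<And>k. \<bar>y $ k - x $ k\<bar> \<le> e" for y
  proof -
    have "norm (y - x) \<le> (\<Sum>k\<in>UNIV. \<bar>(y - x) $ k\<bar>)" by (rule norm_le_l1_cart)
    also have "\<dots> \<le> (\<Sum>k\<in>(UNIV::'d set). e)" using that by (intro sum_mono) simp
    also have "\<dots> = e0" by (simp add: e_def)
    finally show ?thesis using e0(2) by (auto simp: dist_norm norm_minus_commute)
  qed
  define K where "K = cbox (\<chi> k. x $ k - e) (\<chi> k. x $ k + e)"
  have K: "y \<in> K \<longleftrightarrow> (\<forall>k. \<bar>y $ k - x $ k\<bar> \<le> e)" for y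
    unfolding K_def mem_box_cart abs_le_iff by (intro iff_allI) auto
  have "compact (F ` ((\<lambda>(y, u). rx y * u) ` (K \<times> torus)))"
  proof (rule compact_continuous_image[OF _ compact_rx_torus])
    show "continuous_on ((\<lambda>(y, u). rx y * u) ` (K \<times> torus)) F"
    proof (rule continuous_on_subset)
      show "continuous_on (Rein B) F" using F by (simp add: rhol_def)
      show "(\<lambda>(y, u). rx y * u) ` (K \<times> torus) \<subseteq> Rein B"
        using Y K by auto
    qed
    show "compact K" by (simp add: K_def)
  qed
  then have "bounded (F ` ((\<lambda>(y, u). rx y * u) ` (K \<times> torus)))" by (rule compact_imp_bounded)
  then obtain S where S: "\<And>y u. y \<in> K \<Longrightarrow> u \<in> torus \<Longrightarrow> cmod (F (rx y * u)) \<le> S"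
    unfolding bounded_iff by force
  have bd: "cmod (fc F \<alpha> x) \<le> S * exp (- e * (\<Sum>k\<in>UNIV. \<bar>of_int (\<alpha> $ k)\<bar>))" for \<alpha>
  proof -
    define y where "y = (\<chi> k. x $ k + e * sgn (of_int (\<alpha> $ k)))"
    have yK: "y \<in> K" using e by (auto simp: K y_def abs_mult sgn_real_def)
    have "ip \<alpha> (x - y) = - e * (\<Sum>k\<in>UNIV. \<bar>of_int (\<alpha> $ k)\<bar>)"
      by (simp add: ip_def y_def sum_distrib_left sum_negf [symmetric] mult_ac)
        (intro sum.cong refl, simp add: abs_sgn mult_ac)
    moreover have "fc F \<alpha> x = fc F \<alpha> y * exp (of_real (ip \<alpha> (x - y)))"
      using yK Y by (intro fc_eq[OF B F] x) (auto simp: K)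
    moreover have "cmod (fc F \<alpha> y) \<le> S"
      using S[OF yK] yK Y by (intro fc_bound[OF F]) (auto simp: K)
    ultimately show ?thesis
      by (simp add: norm_mult)
  qed
  have sum: "(\<lambda>\<alpha>. S * exp (- e * (\<Sum>k\<in>UNIV. \<bar>of_int (\<alpha> $ k)\<bar>))) summable_on (UNIV :: (int^'d) set)"
    by (intro summable_on_cmult_right summable_on_exp_l1 e)
  show sn: "(\<lambda>\<alpha>. cmod (fc F \<alpha> x)) summable_on UNIV"
    by (rule summable_on_comparison_test[OF sum bd]) auto
  define G where "G u = (\<Sum>\<^sub>\<infinity>\<alpha>. fc F \<alpha> x * lmono \<alpha> u)" for u
  have G: "((\<lambda>\<alpha>. fc F \<alpha> x * lmono \<alpha> u) has_sum G u) UNIV" if "u \<in> torus" for u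
    unfolding G_def
    by (rule has_sum_infsum, rule abs_summable_summable, rule summable_on_cong[THEN iffD1, OF _ sn])
      (simp add: norm_mult norm_lmono_torus that)
  note cG = tmean_has_sum[OF sn G]
  have cF: "continuous_on torus (\<lambda>u. F (rx x * u))" by (rule rhol_torus_cont[OF F x])
  show "((\<lambda>\<alpha>. fc F \<alpha> x * lmono \<alpha> u) has_sum F (rx x * u)) UNIV" if u: "u \<in> torus"
  proof -
    have "F (rx x * u) - G u = 0"
    proof (rule tmean_unique[OF _ _ u])
      show "continuous_on torus (\<lambda>u. F (rx x * u) - G u)" by (intro continuous_intros cF cG(1))
      show "tmean (\<lambda>u. (F (rx x * u) - G u) * lmono \<alpha> u) = 0" for \<alpha>
        using cG(2)[of "- \<alpha>"] cF cG(1)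
        by (simp add: left_diff_distrib tmean_diff continuous_intros continuous_on_lmono_torus fc_def)
    qed
    then show ?thesis using G[OF u] by simp
  qed
qed

section \<open>Invariance and hull estimates read off from the coefficients\<close>

lemma torus_nonempty [simp]: "torus \<noteq> {}"
  using cisv_in by blast

text \<open>Only exponents orthogonal to \<open>r\<close> occur, and rotation in the direction
  \<open>r\<close> fixes those monomials.\<close>

lemma fc_vanish_invariant:
  assumes B: "open B" "connected B" and F: "rhol B F" and x: "x \<in> B"
    and 0: "\<And>\<alpha>. fc F \<alpha> x \<noteq> 0 \<Longrightarrow> ip \<alpha> r = 0" and u: "u \<in> torus"
  shows "F (rx x * (u * cisv (\<tau> *\<^sub>R r))) = F (rx x * u)"
proof -
  have "fc F \<alpha> x * lmono \<alpha> (u * cisv (\<tau> *\<^sub>R r)) = fc F \<alpha> x * lmono \<alpha> u" for \<alpha>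
    using 0[of \<alpha>] by (cases "fc F \<alpha> x = 0") (auto simp: lmono_mult lmono_cisv ip_scaleR)
  then have "((\<lambda>\<alpha>. fc F \<alpha> x * lmono \<alpha> u) has_sum F (rx x * (u * cisv (\<tau> *\<^sub>R r)))) UNIV"
    using laurent_expansion(2)[OF B F x torus_mult[OF u cisv_in[of "\<tau> *\<^sub>R r"]]] by (simp only:)
  from has_sum_unique[OF this laurent_expansion(2)[OF B F x u]] show ?thesis .
qed

text \<open>Applying the coefficient estimate to all powers of \<open>F\<close> removes the constant lost in summing
  the Laurent series.\<close>

lemma rein_hull:
  fixes F :: "complex^'d \<Rightarrow> complex"
  assumes B: "open B" "connected B" and F: "rhol B F" and x: "x \<in> B" and u: "u \<in> torus" and e: "e > 0"
    and S: "\<And>y u. y \<in> Y \<Longrightarrow> u \<in> torus \<Longrightarrow> cmod (F (rx y * u)) \<le> S" and YB: "Y \<subseteq> B"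
    and Y: "\<And>n \<alpha>. fc (\<lambda>z. F z ^ n) \<alpha> x \<noteq> 0 \<Longrightarrow>
      \<exists>y\<in>Y. ip \<alpha> x + e * (\<Sum>k\<in>UNIV. \<bar>of_int (\<alpha> $ k)\<bar>) \<le> ip \<alpha> y"
    and S0: "S \<ge> 0"
  shows "cmod (F (rx x * u)) \<le> S"
proof -
  define E where "E \<alpha> = exp (- e * (\<Sum>k\<in>UNIV. \<bar>of_int (\<alpha> $ k)\<bar>))" for \<alpha> :: "int^'d"
  have sE: "E summable_on UNIV" unfolding E_def[abs_def] by (rule summable_on_exp_l1[OF e])
  define C where "C = infsum E UNIV"
  have pw: "cmod (F (rx x * u)) ^ n \<le> C * S ^ n" for n
  proof -
    let ?G = "\<lambda>z. F z ^ n"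
    have G: "rhol B ?G" by (rule rhol_power[OF F])
    have le: "cmod (fc ?G \<alpha> x) \<le> E \<alpha> * S ^ n" for \<alpha>
    proof (cases "fc ?G \<alpha> x = 0")
      case True
      then show ?thesis using S0 by (simp add: E_def)
    next
      case False
      from Y[OF this] obtain y where y: "y \<in> Y" "ip \<alpha> x + e * (\<Sum>k\<in>UNIV. \<bar>of_int (\<alpha> $ k)\<bar>) \<le> ip \<alpha> y" by blast
      have eq: "cmod (fc ?G \<alpha> x) = cmod (fc ?G \<alpha> y) * exp (ip \<alpha> (x - y))"
        using fc_eq[OF B G _ x, of y] y YB by (auto simp: norm_mult)
      have 1: "cmod (fc ?G \<alpha> y) \<le> S ^ n"
        using S[OF y(1)] y YB S0 by (intro fc_bound[OF G]) (auto simp: norm_power intro!: power_mono)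
      have 2: "exp (ip \<alpha> (x - y)) \<le> E \<alpha>"
        using y(2) by (simp add: E_def ip_diff)
      have "cmod (fc ?G \<alpha> y) * exp (ip \<alpha> (x - y)) \<le> S ^ n * E \<alpha>"
        by (rule mult_mono[OF 1 2]) (use S0 in auto)
      then show ?thesis by (simp only: eq mult.commute)
    qed
    have "cmod (?G (rx x * u)) \<le> infsum (\<lambda>\<alpha>. cmod (fc ?G \<alpha> x)) UNIV"
    proof -
      have "((\<lambda>\<alpha>. fc ?G \<alpha> x * lmono \<alpha> u) has_sum ?G (rx x * u)) UNIV"
        by (rule laurent_expansion(2)[OF B G x u])
      moreover have "(\<lambda>\<alpha>. cmod (fc ?G \<alpha> x * lmono \<alpha> u)) summable_on UNIV"
        using laurent_expansion(1)[OF B G x] by (simp add: norm_mult norm_lmono_torus u)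
      ultimately show ?thesis
        using norm_infsum_bound[of "\<lambda>\<alpha>. fc ?G \<alpha> x * lmono \<alpha> u" UNIV]
        by (simp add: infsumI norm_mult norm_lmono_torus u)
    qed
    also have "\<dots> \<le> infsum (\<lambda>\<alpha>. E \<alpha> * S ^ n) UNIV"
      by (intro infsum_mono laurent_expansion(1)[OF B G x] summable_on_cmult_left sE le)
    also have "\<dots> = C * S ^ n"
      by (simp add: C_def infsum_cmult_left sE)
    finally show ?thesis by (simp add: norm_power)
  qed
  show ?thesis
  proof (rule ccontr)
    assume "\<not> ?thesis"
    then have gt: "S < cmod (F (rx x * u))" (is "S < ?a") by simp
    show False
    proof (cases "S = 0")
      case True
      then show ?thesis using pw[of 1] gt by simp
    next
      case False
      then have "1 < ?a / S" using gt S0 by (simp add: field_simps)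
      then obtain n where "C < (?a / S) ^ n" using real_arch_pow by blast
      then show ?thesis using pw[of n] S0 False by (simp add: power_divide field_simps)
    qed
  qed
qed

text \<open>Cubes rather than balls, because over a cube ip \<alpha> attains its maximum at a corner
  with a gain of exactly \<open>e\<close> times the l1 norm of \<alpha>, the loss that
  \<open>rein_hull\<close> has to pay.\<close>

definition boxn :: "real^'d \<Rightarrow> real \<Rightarrow> (real^'d) set"
  where "boxn x e = cbox (\<chi> k. x $ k - e) (\<chi> k. x $ k + e)"

lemma in_boxn: "y \<in> boxn x e \<longleftrightarrow> (\<forall>k. \<bar>y $ k - x $ k\<bar> \<le> e)"
  unfolding boxn_def mem_box_cart abs_le_iff by (intro iff_allI) auto

lemma compact_boxn: "compact (boxn x e)"
  by (simp add: boxn_def)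

lemma boxn_subset:
  fixes x :: "real^'d"
  assumes "open B" "x \<in> B"
  obtains e where "e > 0" "boxn x e \<subseteq> B"
proof -
  obtain e0 where e0: "e0 > 0" "cball x e0 \<subseteq> B" using assms open_contains_cball by blast
  have "boxn x (e0 / real CARD('d)) \<subseteq> cball x e0"
  proof
    fix y assume y: "y \<in> boxn x (e0 / real CARD('d))"
    have "norm (y - x) \<le> (\<Sum>k\<in>UNIV. \<bar>(y - x) $ k\<bar>)" by (rule norm_le_l1_cart)
    also have "\<dots> \<le> (\<Sum>k\<in>(UNIV::'d set). e0 / real CARD('d))"
      using y by (intro sum_mono) (simp add: in_boxn)
    finally show "y \<in> cball x e0" by (simp add: dist_norm norm_minus_commute)
  qed
  then show ?thesis using e0 by (intro that[of "e0 / real CARD('d)"]) auto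
qed

lemma boxn_corner:
  fixes \<alpha> :: "int^'d"
  assumes "e \<ge> 0"
  shows "\<exists>y\<in>boxn x e. ip \<alpha> y = ip \<alpha> x + e * (\<Sum>k\<in>UNIV. \<bar>of_int (\<alpha> $ k)\<bar>)"
proof
  let ?y = "\<chi> k. x $ k + e * sgn (of_int (\<alpha> $ k))"
  show "?y \<in> boxn x e" using assms by (auto simp: in_boxn abs_mult sgn_real_def)
  show "ip \<alpha> ?y = ip \<alpha> x + e * (\<Sum>k\<in>UNIV. \<bar>of_int (\<alpha> $ k)\<bar>)"
    by (simp add: ip_def sum_distrib_left distrib_left sum.distrib)
      (intro sum.cong refl, simp add: abs_sgn mult_ac)
qed

section \<open>Functions of several complex variables\<close>

lemma cholomorphic_on_imp_continuous: "cholomorphic_on F D \<Longrightarrow> continuous_on D F"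
  unfolding cholomorphic_on_def continuous_on_eq_continuous_within
  by (meson continuous_at_imp_continuous_at_within has_derivative_continuous)

lemma cholomorphic_on_curve:
  fixes c :: "complex \<Rightarrow> complex^'n"
  assumes F: "cholomorphic_on F D" and c: "\<And>\<zeta> k. \<zeta> \<in> U \<Longrightarrow> ((\<lambda>\<zeta>. c \<zeta> $ k) has_field_derivative c' \<zeta> k) (at \<zeta>)"
    and cD: "\<And>\<zeta>. \<zeta> \<in> U \<Longrightarrow> c \<zeta> \<in> D"
  shows "(\<lambda>\<zeta>. F (c \<zeta>)) holomorphic_on U"
proof (rule holomorphic_onI)
  fix \<zeta> assume \<zeta>: "\<zeta> \<in> U"
  obtain a where a: "(F has_derivative (\<lambda>h. \<Sum>i\<in>UNIV. a $ i * h $ i)) (at (c \<zeta>))"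
    using F cD[OF \<zeta>] by (auto simp: cholomorphic_on_def)
  have "(c has_derivative (\<lambda>h. \<chi> k. c' \<zeta> k * h)) (at \<zeta>)"
    using c[OF \<zeta>]
    by (subst has_derivative_componentwise_within)
      (auto simp: Basis_vec_def has_field_derivative_def inner_axis intro!: has_derivative_inner_left)
  from has_derivative_compose[OF this a]
  have "((\<lambda>\<zeta>. F (c \<zeta>)) has_derivative (\<lambda>h. (\<Sum>i\<in>UNIV. a $ i * c' \<zeta> i) * h)) (at \<zeta>)"
    by (simp add: sum_distrib_right mult.assoc)
  then have "((\<lambda>\<zeta>. F (c \<zeta>)) has_field_derivative (\<Sum>i\<in>UNIV. a $ i * c' \<zeta> i)) (at \<zeta>)"
    by (simp add: has_field_derivative_def mult_commute_abs)
  then show "(\<lambda>\<zeta>. F (c \<zeta>)) field_differentiable at \<zeta> within U"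
    using field_differentiable_at_within field_differentiable_def by blast
qed

lemma cholomorphic_imp_rhol:
  fixes F :: "complex^'d \<Rightarrow> complex"
  assumes "cholomorphic_on F (Rein B)"
  shows "rhol B F"
  unfolding rhol_def
proof (intro conjI allI)
  show "continuous_on (Rein B) F" by (rule cholomorphic_on_imp_continuous[OF assms])
  fix p y :: "complex^'d"
  show "(\<lambda>\<zeta>. F (cexpv (p + \<zeta> *s y))) holomorphic_on {\<zeta>. cexpv (p + \<zeta> *s y) \<in> Rein B}"
    by (rule cholomorphic_on_curve[OF assms, where c' = "\<lambda>\<zeta> k. exp (p $ k + \<zeta> * y $ k) * y $ k"])
      (auto simp: cexpv_def intro!: derivative_eq_intros)
qed

text \<open>The inverse of the chart is the identity only on \<open>D\<close>; derivatives agree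
  because \<open>D\<close> is open.\<close>

lemma holomorphic_functions_open_submanifold:
  fixes D :: "(complex^'n) set"
  assumes "open D"
  shows "holomorphic_functions (open_submanifold D) = {f. cholomorphic_on f D}"
proof -
  have "cholomorphic_on (f \<circ> inv_into D (\<lambda>z. z)) D = cholomorphic_on f D" for f :: "complex^'n \<Rightarrow> complex"
  proof -
    have inv: "inv_into D (\<lambda>z. z) z = z" if "z \<in> D" for z
      using f_inv_into_f[of z "\<lambda>z. z" D] that by simp
    have "((f \<circ> inv_into D (\<lambda>z. z)) has_derivative L) (at z) \<longleftrightarrow> (f has_derivative L) (at z)" if "z \<in> D" for z L
      using has_derivative_transform_within_open[OF _ assms that, of f L UNIV "f \<circ> inv_into D (\<lambda>z. z)"]
        has_derivative_transform_within_open[OF _ assms that, of "f \<circ> inv_into D (\<lambda>z. z)" L UNIV f] inv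
      by auto
    then show ?thesis by (auto simp: cholomorphic_on_def)
  qed
  then show ?thesis by (auto simp: holomorphic_functions_def open_submanifold_def)
qed

section \<open>Logarithmic images of Stein Reinhardt domains\<close>

lemma Reinhardt_eq_Rein:
  fixes D :: "(complex^'d) set"
  assumes "Reinhardt_domain D"
  shows "\<exists>B. open B \<and> connected B \<and> B \<noteq> {} \<and> D = Rein B"
proof -
  define B where "B = lgv ` D"
  have D: "D \<noteq> {}" "open D" "connected D" "D \<subseteq> ctorus" using assms by (auto simp: Reinhardt_domain_def)
  have rot: "cisv \<theta> * z \<in> D" if "z \<in> D" for z \<theta>
  proof -
    have "cisv \<theta> * z = (\<chi> k. exp (\<i> * complex_of_real (\<theta> $ k)) * z $ k)"
      by (simp add: cisv_def vec_eq_iff cis_conv_exp)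
    then show ?thesis using assms that by (simp add: Reinhardt_domain_def)
  qed
  have DB: "z \<in> D" if z: "z \<in> ctorus" "lgv z \<in> B" for z
  proof -
    obtain z' where z': "z' \<in> D" "lgv z = lgv z'" using z by (auto simp: B_def)
    obtain u where u: "u \<in> torus" "z = rx (lgv z) * u" using ctorus_polar z by blast
    obtain u' where u': "u' \<in> torus" "z' = rx (lgv z') * u'" using ctorus_polar z' D by blast
    obtain \<theta> where \<theta>: "u = cisv \<theta>" using torus_imp_cisv u by blast
    obtain \<theta>' where \<theta>': "u' = cisv \<theta>'" using torus_imp_cisv u' by blast
    have "z = cisv (\<theta> - \<theta>') * z'"
    proof -
      have "cisv (\<theta> - \<theta>') * cisv \<theta>' = cisv \<theta>" by (simp flip: cisv_add)
      then show ?thesis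
        by (metis u(2) u'(2) z'(2) \<theta> \<theta>' mult.assoc mult.commute)
    qed
    then show ?thesis using rot z' by simp
  qed
  have DR: "D = Rein B" using DB D(4) by (auto simp: Rein_def B_def)
  \<comment> \<open>Openness of \<open>B\<close> is read off from this preimage, its connectedness
    from the description as an image.\<close>
  have "B = rx -` D"
    using DB by (auto simp: DR Rein_def)
  moreover have "continuous_on UNIV (rx :: real^'d \<Rightarrow> _)" by (intro continuous_intros)
  ultimately have "open B" using open_vimage[OF D(2)] by simp
  moreover have "connected B"
    unfolding B_def by (intro connected_continuous_image continuous_on_subset[OF continuous_on_lgv] D)
  moreover have "B \<noteq> {}" using D(1) by (simp add: B_def)
  ultimately show ?thesis using DR by blast
qed

text \<open>A continuity argument along segments: the hull estimate applies only to points already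
  in \<open>B\<close>, so it cannot give convexity at once. It shows that a segment inside
  \<open>B\<close> lies in the hull of cubes at its ends. Compactness of hulls then makes the set of
  points visible from \<open>a\<close> closed in \<open>B\<close>, and it is open because segments
  are compact.\<close>

theorem Stein_Reinhardt_convex:
  fixes B :: "(real^'d) set"
  assumes B: "open B" "connected B" and st: "Stein_manifold (open_submanifold (Rein B))"
  shows "convex B"
proof -
  have oR: "open (Rein B)" by (rule open_Rein[OF B(1)])
  have hullpt: "rx ((1 - t) *\<^sub>R a + t *\<^sub>R b) \<in> holomorphic_hull (open_submanifold (Rein B)) ((\<lambda>(y, u). rx y * u) ` ((boxn a e \<union> boxn b e) \<times> torus))"
    if ab: "boxn a e \<subseteq> B" "boxn b e \<subseteq> B" "e > 0" and t: "0 \<le> t" "t \<le> 1" "(1 - t) *\<^sub>R a + t *\<^sub>R b \<in> B" for a b e t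
  proof -
    let ?x = "(1 - t) *\<^sub>R a + t *\<^sub>R b"
    let ?Y = "boxn a e \<union> boxn b e"
    let ?K = "(\<lambda>(y, u). rx y * u) ` (?Y \<times> torus)"
    have "cmod (f (rx ?x)) \<le> (SUP y\<in>?K. cmod (f y))" if f: "cholomorphic_on f (Rein B)" for f
    proof -
      have fr: "rhol B f" by (rule cholomorphic_imp_rhol[OF f])
      have "compact ?K" by (intro compact_rx_torus compact_Un compact_boxn)
      moreover have "continuous_on ?K f"
        using ab by (intro continuous_on_subset[OF cholomorphic_on_imp_continuous[OF f]]) auto
      ultimately have "compact ((\<lambda>y. cmod (f y)) ` ?K)"
        using compact_continuous_image[OF continuous_on_norm] by blast
      then have bdd: "bdd_above ((\<lambda>y. cmod (f y)) ` ?K)"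
        by (intro bounded_imp_bdd_above compact_imp_bounded)
      have S: "cmod (f (rx y * u)) \<le> (SUP y\<in>?K. cmod (f y))" if "y \<in> ?Y" "u \<in> torus" for y u
        by (rule cSUP_upper[OF _ bdd]) (use that in force)
      have aY: "a \<in> ?Y" using ab by (simp add: in_boxn)
      have "cmod (f (rx ?x * cisv 0)) \<le> (SUP y\<in>?K. cmod (f y))"
      proof (rule rein_hull[OF B fr t(3) _ ab(3) S])
        show "?Y \<subseteq> B" using ab by auto
        show "0 \<le> (SUP y\<in>?K. cmod (f y))"
          using S[OF aY cisv_in] norm_ge_zero order_trans by blast
        fix n \<alpha>
        obtain ya where ya: "ya \<in> boxn a e" "ip \<alpha> ya = ip \<alpha> a + e * (\<Sum>k\<in>UNIV. \<bar>of_int (\<alpha> $ k)\<bar>)"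
          using boxn_corner[of e a \<alpha>] ab(3) by auto
        obtain yb where yb: "yb \<in> boxn b e" "ip \<alpha> yb = ip \<alpha> b + e * (\<Sum>k\<in>UNIV. \<bar>of_int (\<alpha> $ k)\<bar>)"
          using boxn_corner[of e b \<alpha>] ab(3) by auto
        have "ip \<alpha> ?x = (1 - t) * ip \<alpha> a + t * ip \<alpha> b" by (simp add: ip_add ip_scaleR)
        also have "\<dots> \<le> max (ip \<alpha> a) (ip \<alpha> b)"
          using t by (intro convex_bound_le) auto
        finally show "\<exists>y\<in>?Y. ip \<alpha> ?x + e * (\<Sum>k\<in>UNIV. \<bar>of_int (\<alpha> $ k)\<bar>) \<le> ip \<alpha> y"
          using ya yb
          by (cases "ip \<alpha> a \<le> ip \<alpha> b") (auto intro: bexI[of _ ya] bexI[of _ yb])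
      qed auto
      moreover have "cisv 0 = (1 :: complex^'d)" by (simp add: cisv_def vec_eq_iff)
      ultimately show ?thesis by simp
    qed
    moreover have "rx ?x \<in> Rein B" using t(3) by (simp add: Rein_def)
    ultimately show ?thesis
      by (simp add: holomorphic_hull_def holomorphic_functions_open_submanifold[OF oR])
        (simp add: open_submanifold_def)
  qed
  have "b \<in> {x \<in> B. closed_segment a x \<subseteq> B}" if ab: "a \<in> B" "b \<in> B" for a b
  proof -
    let ?S = "{x \<in> B. closed_segment a x \<subseteq> B}"
    have op: "openin (top_of_set B) ?S"
    proof (rule openin_open_eq[OF B(1), THEN iffD2], intro conjI)
      show "open ?S"
        unfolding open_contains_ball
      proof
        fix x assume x: "x \<in> ?S"
        have "compact (closed_segment a x)" by simp
        then obtain e where e: "e > 0" "(\<Union>y\<in>closed_segment a x. ball y e) \<subseteq> B"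
          using compact_subset_open_imp_ball_epsilon_subset[OF _ B(1), of "closed_segment a x"] x by auto
        have "closed_segment a x' \<subseteq> B" if "x' \<in> ball x e" for x'
        proof
          fix z assume "z \<in> closed_segment a x'"
          then obtain t where t: "0 \<le> t" "t \<le> 1" "z = (1 - t) *\<^sub>R a + t *\<^sub>R x'" by (auto simp: in_segment)
          have "dist ((1 - t) *\<^sub>R a + t *\<^sub>R x) z = t * dist x x'"
            using t by (simp add: dist_norm flip: scaleR_diff_right)
          also have "\<dots> \<le> 1 * dist x x'" using t by (intro mult_right_mono) auto
          also have "\<dots> < e" using that by (simp add: dist_commute)
          finally show "z \<in> B" using e(2) t by (force simp: in_segment)
        qed
        then have "ball x e \<subseteq> ?S" using ends_in_segment(2)[of a] by blast
        then show "\<exists>e>0. ball x e \<subseteq> ?S" using e(1) by blast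
      qed
    qed auto
    have cl: "closedin (top_of_set B) ?S"
    proof (rule closedin_limpt[THEN iffD2], intro conjI allI impI)
      fix x assume "x islimpt ?S \<and> x \<in> B"
      then have x: "x islimpt ?S" "x \<in> B" by auto
      obtain e1 where e1: "e1 > 0" "boxn a e1 \<subseteq> B" using boxn_subset[OF B(1) ab(1)] .
      obtain e2 where e2: "e2 > 0" "boxn x e2 \<subseteq> B" using boxn_subset[OF B(1) x(2)] .
      \<comment> \<open>Halved so that the cube of half-side e at any nearby x' stays inside the
        cube of half-side 2 e at x; one compact set \<open>K\<close> then serves all x'.\<close>
      define e where "e = min e1 e2 / 2"
      have le: "e \<le> e1" "2 * e \<le> e2" "e > 0" using e1 e2 by (auto simp: e_def)
      have sub: "boxn y p \<subseteq> boxn y q" if "p \<le> q" for y :: "real^'d" and p q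
        using that by (auto simp: in_boxn) (meson order_trans)
      have self: "y \<in> boxn y p" if "p > 0" for y :: "real^'d" and p
        using that by (simp add: in_boxn)
      have e: "e > 0" "boxn a e \<subseteq> B" using sub[OF le(1), of a] e1 le by auto
      define K where "K = (\<lambda>(y, u). rx y * u) ` ((boxn a e \<union> boxn x (2 * e)) \<times> (torus :: (complex^'d) set))"
      have xe: "boxn x (2 * e) \<subseteq> B" using sub[OF le(2), of x] e2 by auto
      define H where "H = holomorphic_hull (open_submanifold (Rein B)) K"
      have "compactin (top_of_set (Rein B)) K"
        unfolding compactin_subtopology K_def
        using compact_rx_torus[of "boxn a e \<union> boxn x (2 * e)"] e xe
        by (auto simp: compact_boxn compact_Un)
      moreover have "K \<noteq> {}"
        using self[of e a] e cisv_in[of 0] by (auto simp: K_def)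
      ultimately have cH: "compact H" and HR: "H \<subseteq> Rein B"
        using st unfolding H_def by (auto simp: Stein_manifold_def holomorphically_convex_def open_submanifold_def compactin_subtopology)
      have pt: "rx ((1 - t) *\<^sub>R a + t *\<^sub>R x') \<in> H" if x': "x' \<in> ?S" "x' \<in> boxn x e" and t: "0 \<le> t" "t \<le> 1" for x' t
      proof -
        have "boxn x' e \<subseteq> boxn x (2 * e)"
        proof
          fix y assume y: "y \<in> boxn x' e"
          have "\<bar>y $ k - x $ k\<bar> \<le> 2 * e" for k
          proof -
            have "\<bar>y $ k - x' $ k\<bar> \<le> e" "\<bar>x' $ k - x $ k\<bar> \<le> e" using y x'(2) by (auto simp: in_boxn)
            then show ?thesis by linarith
          qed
          then show "y \<in> boxn x (2 * e)" by (simp add: in_boxn)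
        qed
        then have sub: "(\<lambda>(y, u). rx y * u) ` ((boxn a e \<union> boxn x' e) \<times> (torus :: (complex^'d) set)) \<subseteq> K" (is "?K' \<subseteq> K")
          by (force simp: K_def)
        have inB: "(1 - t) *\<^sub>R a + t *\<^sub>R x' \<in> B" using x'(1) t by (force simp: in_segment)
        have "rx ((1 - t) *\<^sub>R a + t *\<^sub>R x') \<in> holomorphic_hull (open_submanifold (Rein B)) ?K'"
          by (rule hullpt[OF e(2) _ e(1) t inB]) (use \<open>boxn x' e \<subseteq> boxn x (2 * e)\<close> xe in auto)
        also have "\<dots> \<subseteq> H"
        proof -
          have "(SUP y\<in>?K'. cmod (f y)) \<le> (SUP y\<in>K. cmod (f y))" if "cholomorphic_on f (Rein B)" for f
          proof (rule cSUP_subset_mono[OF _ _ sub])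
            show "?K' \<noteq> {}" using self[of e a] e cisv_in[of 0] by auto
            have "compact K" "K \<subseteq> Rein B"
              using \<open>compactin (top_of_set (Rein B)) K\<close> by (auto simp: compactin_subtopology)
            then have "compact ((\<lambda>y. cmod (f y)) ` K)"
              by (intro compact_continuous_image continuous_intros continuous_on_subset[OF cholomorphic_on_imp_continuous[OF that]])
            then show "bdd_above ((\<lambda>y. cmod (f y)) ` K)"
              by (intro bounded_imp_bdd_above compact_imp_bounded)
          qed auto
          then show ?thesis
            unfolding H_def holomorphic_hull_def holomorphic_functions_open_submanifold[OF oR]
            by (auto intro: order_trans)
        qed
        finally show ?thesis .
      qed
      have seg: "rx ((1 - t) *\<^sub>R a + t *\<^sub>R x) \<in> H" if t: "0 \<le> t" "t \<le> 1" for t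
      proof -
        obtain X where X: "\<And>n. X n \<in> ?S" "X \<longlonglongrightarrow> x" using x(1) by (auto simp: islimpt_sequential)
        have "\<forall>\<^sub>F n in sequentially. X n \<in> boxn x e"
        proof -
          have "x \<in> box (\<chi> k. x $ k - e) (\<chi> k. x $ k + e)" using e by (simp add: mem_box_cart)
          then have "\<forall>\<^sub>F n in sequentially. X n \<in> box (\<chi> k. x $ k - e) (\<chi> k. x $ k + e)"
            using X(2) open_box topological_tendstoD by blast
          then show ?thesis
            by eventually_elim (auto simp: boxn_def box_subset_cbox[THEN subsetD])
        qed
        then have "\<forall>\<^sub>F n in sequentially. rx ((1 - t) *\<^sub>R a + t *\<^sub>R X n) \<in> H"
          by eventually_elim (use pt X(1) t in auto)
        moreover have "(\<lambda>n. rx ((1 - t) *\<^sub>R a + t *\<^sub>R X n)) \<longlonglongrightarrow> rx ((1 - t) *\<^sub>R a + t *\<^sub>R x)"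
        proof -
          have "continuous_on UNIV (rx :: real^'d \<Rightarrow> complex^'d)"
            by (intro continuous_on_rx continuous_on_id)
          have "isCont rx ((1 - t) *\<^sub>R a + t *\<^sub>R x)"
            using \<open>continuous_on UNIV (rx :: real^'d \<Rightarrow> complex^'d)\<close> by (simp add: continuous_on_eq_continuous_at)
          then show ?thesis
            by (intro isCont_tendsto_compose[where g = rx] tendsto_intros X(2))
        qed
        ultimately show ?thesis
          by (intro Lim_in_closed_set[OF compact_imp_closed[OF cH] _ trivial_limit_sequentially])
      qed
      show "x \<in> ?S"
      proof -
        have "(1 - t) *\<^sub>R a + t *\<^sub>R x \<in> B" if "0 \<le> t" "t \<le> 1" for t
        proof -
          have "rx ((1 - t) *\<^sub>R a + t *\<^sub>R x) \<in> Rein B" using seg[OF that] HR by blast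
          then show ?thesis by (simp add: Rein_def)
        qed
        then show ?thesis using x(2) by (auto simp: in_segment)
      qed
    qed auto
    have "?S = {} \<or> ?S = B" using B(2) op cl by (auto simp: connected_clopen)
    moreover have "a \<in> ?S" using ab by simp
    ultimately show ?thesis using ab by blast
  qed
  then show ?thesis by (auto simp: convex_contains_segment)
qed

section \<open>A Phragmen-Lindelof principle\<close>

text \<open>Multiply \<open>h\<close> by exp (n exp (k w)) with k = pi / (2 \<eta>): the factor has
  modulus one on the horizontal edges, and since k < l the decay of \<open>h\<close> defeats it far
  to the right. The maximum principle bounds \<open>h\<close> at u by a quantity that tends to 0 as
  n grows.\<close>

lemma half_strip_vanish:
  fixes h :: "complex \<Rightarrow> complex"
  assumes S: "open S" "{w. u0 \<le> Re w \<and> \<bar>Im w\<bar> \<le> \<eta>} \<subseteq> S" and h: "h holomorphic_on S"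
    and \<eta>: "\<eta> > 0" "l * \<eta> > pi / 2" and c: "c > 0"
    and bd: "\<And>w. u0 \<le> Re w \<Longrightarrow> \<bar>Im w\<bar> \<le> \<eta> \<Longrightarrow> cmod (h w) \<le> C * exp (- c * exp (l * Re w))"
    and u: "u > u0"
  shows "h (of_real u) = 0"
proof -
  define k where "k = pi / (2 * \<eta>)"
  have k: "k > 0" "k < l" using \<eta> by (auto simp: k_def field_simps)
  have C: "C \<ge> 0"
  proof -
    have "0 \<le> C * exp (- c * exp (l * u0))" using order_trans[OF norm_ge_zero bd[of "of_real u0"]] \<eta> by simp
    then show ?thesis by (simp add: zero_le_mult_iff)
  qed
  have main: "cmod (h (of_real u)) \<le> C * exp (- real n * (exp (k * u) - exp (k * u0)))" for n
  proof -
    define H where "H w = h w * exp (of_nat n * exp (of_real k * w))" for w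
    have Ree: "Re (exp (of_real k * w)) = exp (k * Re w) * cos (k * Im w)" for w
      by (simp add: Re_exp)
    have nH: "cmod (H w) = cmod (h w) * exp (real n * (exp (k * Re w) * cos (k * Im w)))" for w
      by (simp add: H_def norm_mult Re_exp)
    have "((\<lambda>v. exp (k * v) / exp (l * v)) \<longlongrightarrow> 0) at_top"
      using k by real_asymp
    then have "\<forall>\<^sub>F v in at_top. exp (k * v) / exp (l * v) < c / (real n + 1)"
      using c by (intro order_tendstoD) auto
    \<comment> \<open>The right edge depends on n: it lies far enough out for the decay of
      \<open>h\<close> to absorb the factor with this n.\<close>
    then obtain u1 where u1: "u1 > u" "exp (k * u1) / exp (l * u1) < c / (real n + 1)"
      using eventually_conj[OF eventually_gt_at_top[of u]] by (metis (no_types, lifting) eventually_at_top_linorder order_refl eventually_conj_iff)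
    have r: "real n * exp (k * u1) \<le> c * exp (l * u1)"
    proof -
      have "exp (k * u1) * (real n + 1) < c * exp (l * u1)"
        using u1(2) by (simp add: field_simps)
      moreover have "real n * exp (k * u1) \<le> exp (k * u1) * (real n + 1)" by (simp add: algebra_simps)
      ultimately show ?thesis by linarith
    qed
    define R where "R = cbox (Complex u0 (- \<eta>)) (Complex u1 \<eta>)"
    have RS: "R \<subseteq> S" using S(2) by (auto simp: R_def in_cbox_complex_iff abs_le_iff)
    have Hh: "H holomorphic_on S" unfolding H_def by (intro holomorphic_intros h)
    have "cmod (H (of_real u)) \<le> C * exp (real n * exp (k * u0))"
    proof (rule maximum_modulus_frontier[of H R])
      show "H holomorphic_on interior R" using Hh RS interior_subset holomorphic_on_subset by blast
      show "continuous_on (closure R) H"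
        using Hh RS by (auto simp: R_def intro!: holomorphic_on_imp_continuous_on elim: holomorphic_on_subset)
      show "bounded R" by (simp add: R_def)
      show "complex_of_real u \<in> R" using u u1 \<eta> by (simp add: R_def in_cbox_complex_iff)
      fix z assume "z \<in> frontier R"
      then have z: "z \<in> R" "z \<notin> box (Complex u0 (- \<eta>)) (Complex u1 \<eta>)"
        by (auto simp: R_def frontier_cbox)
      have z1: "u0 \<le> Re z" "Re z \<le> u1" "\<bar>Im z\<bar> \<le> \<eta>" using z(1) by (auto simp: R_def in_cbox_complex_iff)
      have hz: "cmod (h z) \<le> C * exp (- c * exp (l * Re z))" by (rule bd) (use z1 in auto)
      have hC: "cmod (h z) \<le> C"
        by (rule order_trans[OF hz]) (use C c in \<open>auto intro: mult_left_le\<close>)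
      have le0: "exp (0 :: real) \<le> exp (real n * exp (k * u0))" by simp
      consider "Re z = u0" | "Re z = u1" | "\<bar>Im z\<bar> = \<eta>"
        using z z1 by (auto simp: in_box_complex_iff)
      then show "cmod (H z) \<le> C * exp (real n * exp (k * u0))"
      proof cases
        case 1
        then show ?thesis unfolding nH using hC C
          by (intro mult_mono) (auto intro!: mult_left_mono mult_left_le)
      next
        case 2
        have "cmod (H z) \<le> (C * exp (- c * exp (l * u1))) * exp (real n * exp (k * u1))"
          unfolding nH using hz C 2 by (intro mult_mono) (auto intro!: mult_left_mono mult_left_le)
        also have "\<dots> = C * exp (real n * exp (k * u1) - c * exp (l * u1))"
          by (simp add: mult.assoc flip: exp_add)
        also have "\<dots> \<le> C * exp (real n * exp (k * u0))"
        proof (intro mult_left_mono C)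
          have "real n * exp (k * u1) - c * exp (l * u1) \<le> 0" using r by simp
          also have "0 \<le> real n * exp (k * u0)" by simp
          finally show "exp (real n * exp (k * u1) - c * exp (l * u1)) \<le> exp (real n * exp (k * u0))" by simp
        qed
        finally show ?thesis .
      next
        case 3
        have "cos (k * Im z) = cos (k * \<bar>Im z\<bar>)" by (simp add: abs_if)
        also have "\<dots> = 0" using 3 \<eta> by (simp add: k_def)
        finally have "cmod (H z) = cmod (h z)" by (simp add: nH)
        also have "\<dots> \<le> C * 1" using hC by simp
        also have "\<dots> \<le> C * exp (real n * exp (k * u0))" using C by (intro mult_left_mono) auto
        finally show ?thesis .
      qed
    qed
    then have "cmod (h (of_real u)) * exp (real n * exp (k * u)) \<le> C * exp (real n * exp (k * u0))"
      by (simp add: nH)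
    then show ?thesis
      by (simp add: right_diff_distrib exp_diff field_simps exp_minus)
  qed
  have lim: "(\<lambda>n. C * exp (- real n * d)) \<longlonglongrightarrow> 0" if "d > 0" for d
    using that by real_asymp
  have "(\<lambda>n. C * exp (- real n * (exp (k * u) - exp (k * u0)))) \<longlonglongrightarrow> 0"
    by (rule lim) (use u k in simp)
  then have "cmod (h (of_real u)) \<le> 0"
    by (rule LIMSEQ_le_const) (use main in auto)
  then show ?thesis by simp
qed

lemma strip_vanish:
  fixes f :: "complex \<Rightarrow> complex"
  assumes m: "m > 0" and l: "l * m > 2 * pi\<^sup>2" and f: "f holomorphic_on strip m"
    and bd: "\<And>\<eta>. 0 < \<eta> \<Longrightarrow> \<eta> < m / (4 * pi) \<Longrightarrow> \<exists>C c u0. c > 0 \<and>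
      (\<forall>w. u0 \<le> Re w \<and> \<bar>Im w\<bar> \<le> \<eta> \<longrightarrow> cmod (f w) \<le> C * exp (- c * exp (l * Re w)))"
    and w: "w \<in> strip m"
  shows "f w = 0"
proof -
  have l0: "l > 0" using l m by (metis less_trans mult_less_0_iff not_less_iff_gr_or_eq mult_pos_pos pi_gt_zero zero_less_power zero_less_numeral mult_zero_left)
  \<comment> \<open>This is where 2 pi^2 enters: a substrip of half-width \<eta> with l \<eta> > pi
    / 2 fits inside \<open>strip m\<close> exactly if l m > 2 pi^2.\<close>
  have "pi / (2 * l) < m / (4 * pi)" using l l0 m by (simp add: field_simps power2_eq_square)
  then obtain \<eta> where \<eta>: "pi / (2 * l) < \<eta>" "\<eta> < m / (4 * pi)" using dense by blast
  have \<eta>0: "\<eta> > 0" using \<eta>(1) l0 by (meson less_trans divide_pos_pos pi_gt_zero mult_pos_pos zero_less_numeral)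
  obtain C c u0 where b: "c > 0" "\<And>w. u0 \<le> Re w \<Longrightarrow> \<bar>Im w\<bar> \<le> \<eta> \<Longrightarrow> cmod (f w) \<le> C * exp (- c * exp (l * Re w))"
    using bd[OF \<eta>0 \<eta>(2)] by blast
  have op: "open (strip m)"
    unfolding strip_def by (intro open_Collect_less continuous_intros)
  have cv: "convex (strip m)"
  proof -
    have "strip m = {w. Im w < m / (4 * pi)} \<inter> {w. Im w > - (m / (4 * pi))}"
      by (auto simp: strip_def)
    then show ?thesis by (simp add: convex_Int convex_halfspace_Im_lt convex_halfspace_Im_gt)
  qed
  have sub: "{w. u0 \<le> Re w \<and> \<bar>Im w\<bar> \<le> \<eta>} \<subseteq> strip m"
    using \<eta>(2) by (auto simp: strip_def)
  have l\<eta>: "l * \<eta> > pi / 2" using \<eta>(1) l0 by (simp add: field_simps)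
  have z: "f (of_real u) = 0" if "u > u0" for u
    by (rule half_strip_vanish[OF op sub f \<eta>0 l\<eta> b(1) b(2) that])
  show ?thesis
  proof (rule analytic_continuation[OF f op convex_connected[OF cv], of "of_real ` {u0<..}" "of_real (u0 + 1)"])
    show "of_real ` {u0<..} \<subseteq> strip m" "complex_of_real (u0 + 1) \<in> strip m"
      using m by (auto simp: strip_def)
    show "complex_of_real (u0 + 1) islimpt of_real ` {u0<..}"
      unfolding islimpt_approachable
    proof (intro allI impI)
      fix e :: real assume "e > 0"
      then show "\<exists>x'\<in>complex_of_real ` {u0<..}. x' \<noteq> complex_of_real (u0 + 1) \<and> dist x' (complex_of_real (u0 + 1)) < e"
        by (intro bexI[of _ "of_real (u0 + 1 + e / 2)"]) (auto simp: dist_norm simp flip: of_real_diff of_real_add)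
    qed
  qed (use z w in auto)
qed

section \<open>Orbits of linear maps\<close>

text \<open>Generalised eigenspaces are handled through \<open>ann A \<mu>s\<close>, the kernel of the product of the
  \<open>A - \<mu>\<close> for \<open>\<mu>\<close> in the list \<open>\<mu>s\<close>.\<close>

definition shiftp :: "complex^'d^'d \<Rightarrow> complex \<Rightarrow> complex^'d \<Rightarrow> complex^'d"
  where "shiftp A \<mu> x = A *v x - \<mu> *s x"

definition ann :: "complex^'d^'d \<Rightarrow> complex list \<Rightarrow> (complex^'d) set"
  where "ann A \<mu>s = {x. fold (shiftp A) \<mu>s x = 0}"

definition eigval :: "complex^'d^'d \<Rightarrow> complex \<Rightarrow> bool"
  where "eigval A \<mu> \<longleftrightarrow> (\<exists>v. v \<noteq> 0 \<and> A *v v = \<mu> *s v)"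

section \<open>Annihilating products of shifts and growth of iterates\<close>

lemma norm_vsmult: "norm (c *s x) = cmod c * norm x"
  for x :: "complex^'d"
  by (simp add: norm_vec_def norm_mult L2_set_right_distrib)

lemma shiftp_commute: "shiftp A \<mu> (shiftp A \<nu> x) = shiftp A \<nu> (shiftp A \<mu> x)"
  by (simp add: shiftp_def matrix_vector_mult_diff_distrib vector_scalar_commute vector_ssub_ldistrib algebra_simps
      vector_smult_assoc)

lemma shiftp_add: "shiftp A \<mu> (x + y) = shiftp A \<mu> x + shiftp A \<mu> y"
  by (simp add: shiftp_def matrix_vector_right_distrib vector_add_ldistrib)

lemma shiftp_smult: "shiftp A \<mu> (c *s x) = c *s shiftp A \<mu> x"
  by (simp add: shiftp_def vector_scalar_commute vector_ssub_ldistrib vector_smult_assoc mult.commute)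

lemma shiftp_A: "shiftp A \<mu> (A *v x) = A *v shiftp A \<mu> x"
  by (simp add: shiftp_def matrix_vector_mult_diff_distrib vector_scalar_commute)

lemma ann_Nil [simp]: "x \<in> ann A [] \<longleftrightarrow> x = 0"
  by (simp add: ann_def)

lemma ann_Cons [simp]: "x \<in> ann A (\<mu> # \<mu>s) \<longleftrightarrow> shiftp A \<mu> x \<in> ann A \<mu>s"
  by (simp add: ann_def)

lemma ann_0: "0 \<in> ann A \<mu>s"
  by (induction \<mu>s) (auto simp: shiftp_def)

lemma ann_add: "x \<in> ann A \<mu>s \<Longrightarrow> y \<in> ann A \<mu>s \<Longrightarrow> x + y \<in> ann A \<mu>s"
  by (induction \<mu>s arbitrary: x y) (auto simp: shiftp_add)

lemma ann_smult: "x \<in> ann A \<mu>s \<Longrightarrow> c *s x \<in> ann A \<mu>s"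
  by (induction \<mu>s arbitrary: x) (auto simp: shiftp_smult)

lemma ann_diff: "x \<in> ann A \<mu>s \<Longrightarrow> y \<in> ann A \<mu>s \<Longrightarrow> x - y \<in> ann A \<mu>s"
  using ann_add[of x A \<mu>s "(- 1) *s y"] ann_smult[of y A \<mu>s "- 1"] by simp

lemma ann_A: "x \<in> ann A \<mu>s \<Longrightarrow> A *v x \<in> ann A \<mu>s"
  by (induction \<mu>s arbitrary: x) (auto simp: shiftp_A)

lemma ann_iter: "x \<in> ann A \<mu>s \<Longrightarrow> ((*v) A ^^ j) x \<in> ann A \<mu>s"
  by (induction j) (auto simp: ann_A)

lemma ann_mset: "mset \<mu>s = mset \<nu>s \<Longrightarrow> ann A \<mu>s = ann A \<nu>s"
  unfolding ann_def
  by (subst fold_multiset_equiv[of \<mu>s "shiftp A" \<nu>s]) (auto simp: shiftp_commute fun_eq_iff)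

lemma iter_add:
  fixes A :: "complex^'d^'d"
  shows "((*v) A ^^ j) (x + y) = ((*v) A ^^ j) x + ((*v) A ^^ j) y"
  by (induction j) (auto simp: matrix_vector_right_distrib)

lemma iter_smult:
  fixes A :: "complex^'d^'d"
  shows "((*v) A ^^ j) (c *s x) = c *s ((*v) A ^^ j) x"
  by (induction j) (auto simp: vector_scalar_commute)

text \<open>Splitting off one complex root \<mu> turns the relation for \<open>x\<close> into one of
  smaller degree for \<open>shiftp A \<mu> x\<close>.\<close>

lemma ann_of_poly:
  fixes p :: "complex poly"
  assumes "degree p = n" "p \<noteq> 0" "(\<Sum>i\<le>n. coeff p i *s ((*v) A ^^ i) x) = 0"
  shows "\<exists>\<mu>s. x \<in> ann A \<mu>s"
  using assms
proof (induction n arbitrary: p x)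
  case 0
  then have "coeff p 0 \<noteq> 0" by (metis leading_coeff_0_iff)
  with 0 have "x = 0" by simp
  then show ?case by (intro exI[of _ "[]"]) simp
next
  case (Suc n)
  have "p \<noteq> [:a:]" for a using Suc.prems(1) by auto
  then obtain \<mu> where "poly p \<mu> = 0"
    using fundamental_theorem_of_algebra_alt[of p] by auto
  then obtain q where q: "p = [:- \<mu>, 1:] * q" using poly_eq_0_iff_dvd by (auto simp: dvd_def)
  have q0: "q \<noteq> 0" using q Suc.prems by auto
  have dq: "degree q = n" using Suc.prems(1) q0 unfolding q by (subst (asm) degree_mult_eq) auto
  let ?I = "\<lambda>i. ((*v) A ^^ i)"
  have c: "coeff p i = (if i = 0 then 0 else coeff q (i - 1)) - \<mu> * coeff q i" for i
    unfolding q by (simp add: coeff_pCons split: nat.split)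
  have "(\<Sum>i\<le>n. coeff q i *s ?I i (shiftp A \<mu> x)) = (\<Sum>i\<le>n. coeff q i *s ?I (Suc i) x) - (\<Sum>i\<le>n. (\<mu> * coeff q i) *s ?I i x)"
    unfolding sum_subtractf [symmetric]
  proof (intro sum.cong refl)
    fix i
    have "?I i (shiftp A \<mu> x) = ?I i (A *v x) + (- \<mu>) *s ?I i x"
      unfolding iter_smult [symmetric] iter_add [symmetric] by (simp add: shiftp_def)
    then show "coeff q i *s ?I i (shiftp A \<mu> x) = coeff q i *s ?I (Suc i) x - (\<mu> * coeff q i) *s ?I i x"
      by (simp add: funpow_swap1 vector_add_ldistrib vector_smult_assoc mult.commute vector_ssub_ldistrib)
  qed
  also have "(\<Sum>i\<le>n. coeff q i *s ?I (Suc i) x) = (\<Sum>i\<le>Suc n. (if i = 0 then 0 else coeff q (i - 1)) *s ?I i x)"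
    by (subst sum.atMost_Suc_shift) simp
  also have "(\<Sum>i\<le>n. (\<mu> * coeff q i) *s ?I i x) = (\<Sum>i\<le>Suc n. (\<mu> * coeff q i) *s ?I i x)"
    using dq by (simp add: coeff_eq_0)
  also have "(\<Sum>i\<le>Suc n. (if i = 0 then 0 else coeff q (i - 1)) *s ?I i x) - \<dots> = (\<Sum>i\<le>Suc n. coeff p i *s ?I i x)"
    unfolding sum_subtractf [symmetric] c by (intro sum.cong refl) (simp add: vector_sub_rdistrib)
  also have "\<dots> = 0" by (rule Suc.prems)
  finally obtain \<mu>s where "shiftp A \<mu> x \<in> ann A \<mu>s" using Suc.IH[OF dq q0] by blast
  then show ?case by (intro exI[of _ "\<mu> # \<mu>s"]) simp
qed

lemma ann_exists: "\<exists>\<mu>s. x \<in> ann A \<mu>s \<and> (\<forall>\<mu>\<in>set \<mu>s. eigval A \<mu>)"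
  for A :: "complex^'d^'d"
proof -
  let ?n = "CARD('d)"
  let ?I = "\<lambda>i. ((*v) A ^^ i) x"
  have "\<exists>a. (\<exists>i\<le>?n. a i \<noteq> 0) \<and> (\<Sum>i\<le>?n. a i *s ?I i) = 0"
  \<comment> \<open>Linear dependence is a property of the set of iterates, so coinciding iterates
    are treated separately.\<close>
  proof (cases "inj_on ?I {..?n}")
    case True
    have "vec.dependent (?I ` {..?n})"
    proof (rule ccontr)
      assume "vec.independent (?I ` {..?n})"
      then have "card (?I ` {..?n}) \<le> vec.dim (UNIV :: (complex^'d) set)"
        by (intro vec.independent_card_le_dim) auto
      then show False unfolding card_image[OF True] vec_dim_card by simp
    qed
    then obtain S u where S: "finite S" "S \<subseteq> ?I ` {..?n}" "(\<Sum>v\<in>S. u v *s v) = 0" "\<exists>v\<in>S. u v \<noteq> 0"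
      unfolding vec.dependent_explicit by blast
    define a where "a i = (if ?I i \<in> S then u (?I i) else 0)" for i
    have "(\<Sum>i\<le>?n. a i *s ?I i) = (\<Sum>v\<in>?I ` {..?n}. (if v \<in> S then u v else 0) *s v)"
      by (subst sum.reindex[OF True]) (simp add: a_def)
    also have "\<dots> = (\<Sum>v\<in>S. u v *s v)"
      using S(2) by (intro sum.mono_neutral_cong_right) auto
    finally show ?thesis using S by (intro exI[of _ a]) (auto simp: a_def)
  next
    case False
    then obtain i j where ij: "i \<le> ?n" "j \<le> ?n" "i \<noteq> j" "?I i = ?I j" by (auto simp: inj_on_def)
    let ?a = "\<lambda>k. if k = i then 1 else if k = j then -1 else 0 :: complex"
    have "(\<Sum>k\<le>?n. ?a k *s ?I k) = (\<Sum>k\<in>{i, j}. ?a k *s ?I k)"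
      using ij by (intro sum.mono_neutral_cong_right) auto
    also have "\<dots> = 0" using ij by simp
    finally show ?thesis using ij by (intro exI[of _ ?a]) auto
  qed
  then obtain a where a: "\<exists>i\<le>?n. a i \<noteq> 0" "(\<Sum>i\<le>?n. a i *s ?I i) = 0" by blast
  define p where "p = (\<Sum>i\<le>?n. monom (a i) i)"
  have cp: "coeff p i = (if i \<le> ?n then a i else 0)" for i
    unfolding p_def coeff_sum by (simp add: coeff_monom)
  have p0: "p \<noteq> 0" using a(1) cp by (metis coeff_0)
  have dp: "degree p \<le> ?n" using cp by (intro degree_le) auto
  have "(\<Sum>i\<le>degree p. coeff p i *s ?I i) = (\<Sum>i\<le>?n. a i *s ?I i)"
  proof (intro sum.mono_neutral_cong_left)
    show "\<forall>i\<in>{..?n} - {..degree p}. a i *s ?I i = 0"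
    proof
      fix i assume i: "i \<in> {..?n} - {..degree p}"
      then have "a i = coeff p i" by (simp add: cp)
      also have "\<dots> = 0" using i by (intro coeff_eq_0) auto
      finally show "a i *s ?I i = 0" by simp
    qed
  qed (use dp in \<open>auto simp: cp\<close>)
  then obtain \<mu>s where \<mu>s: "x \<in> ann A \<mu>s" using ann_of_poly[OF refl p0] a(2) by metis
  have "x \<in> ann A (filter (eigval A) \<mu>s)" if "x \<in> ann A \<mu>s" for \<mu>s x
    using that
  proof (induction \<mu>s arbitrary: x)
    case (Cons \<mu> \<mu>s)
    then have 1: "shiftp A \<mu> x \<in> ann A (filter (eigval A) \<mu>s)" by simp
    show ?case
    proof (cases "eigval A \<mu>")
      case False
      have "ann A (\<mu> # filter (eigval A) \<mu>s) = ann A (filter (eigval A) \<mu>s @ [\<mu>])" by (rule ann_mset) simp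
      then have "x \<in> ann A (filter (eigval A) \<mu>s @ [\<mu>])"
        using 1 ann_Cons[of x A \<mu>] by blast
      then have "shiftp A \<mu> (fold (shiftp A) (filter (eigval A) \<mu>s) x) = 0"
        by (simp add: ann_def)
      then have "A *v fold (shiftp A) (filter (eigval A) \<mu>s) x = \<mu> *s fold (shiftp A) (filter (eigval A) \<mu>s) x"
        by (simp add: shiftp_def)
      then have "fold (shiftp A) (filter (eigval A) \<mu>s) x = 0"
        using False by (auto simp: eigval_def)
      then have "x \<in> ann A (filter (eigval A) \<mu>s)" unfolding ann_def by (rule CollectI)
      with False show ?thesis by (simp only: filter.simps if_False)
    qed (use 1 in simp)
  qed simp
  from this[OF \<mu>s] show ?thesis by (intro exI[of _ "filter (eigval A) \<mu>s"]) auto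
qed

text \<open>Each further factor A - \<mu> turns the recursion into a sum over earlier iterates,
  which costs one more power of j.\<close>

lemma ann_growth:
  assumes "x \<in> ann A \<mu>s" "\<And>\<mu>. \<mu> \<in> set \<mu>s \<Longrightarrow> cmod \<mu> \<le> \<kappa>" "\<kappa> > 0"
  shows "\<exists>C\<ge>0. \<forall>j. norm (((*v) A ^^ j) x) \<le> C * (1 + real j) ^ length \<mu>s * \<kappa> ^ j"
  using assms(1,2)
proof (induction \<mu>s arbitrary: x)
  case Nil
  have "((*v) A ^^ j) 0 = 0" for j by (induction j) auto
  with Nil show ?case by (intro exI[of _ 0]) simp
next
  case (Cons \<mu> \<mu>s)
  let ?k = "length \<mu>s"
  from Cons obtain C where C: "C \<ge> 0" "\<And>j. norm (((*v) A ^^ j) (shiftp A \<mu> x)) \<le> C * (1 + real j) ^ ?k * \<kappa> ^ j"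
    by (metis ann_Cons list.set_intros(2))
  have bd: "norm (((*v) A ^^ j) x) \<le> (norm x + (C / \<kappa>) * (real j * (1 + real j) ^ ?k)) * \<kappa> ^ j" for j
  proof (induction j)
    case (Suc j)
    have "((*v) A ^^ Suc j) x = ((*v) A ^^ j) (shiftp A \<mu> x + \<mu> *s x)"
      by (simp add: shiftp_def funpow_swap1)
    then have "norm (((*v) A ^^ Suc j) x) \<le> norm (((*v) A ^^ j) (shiftp A \<mu> x)) + cmod \<mu> * norm (((*v) A ^^ j) x)"
      unfolding iter_add iter_smult using norm_triangle_ineq by (metis norm_vsmult)
    also have "\<dots> \<le> C * (1 + real j) ^ ?k * \<kappa> ^ j + \<kappa> * ((norm x + (C / \<kappa>) * (real j * (1 + real j) ^ ?k)) * \<kappa> ^ j)"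
      using Cons.prems(2)[of \<mu>] Suc C assms(3) by (intro add_mono mult_mono) auto
    also have "\<dots> = (norm x + (C / \<kappa>) * (real (Suc j) * (1 + real j) ^ ?k)) * \<kappa> ^ Suc j"
      using assms(3) by (simp add: field_simps)
    also have "\<dots> \<le> (norm x + (C / \<kappa>) * (real (Suc j) * (1 + real (Suc j)) ^ ?k)) * \<kappa> ^ Suc j"
      using C assms(3) by (intro mult_right_mono add_left_mono mult_left_mono power_mono) auto
    finally show ?case .
  qed simp
  show ?case
  proof (intro exI[of _ "norm x + C / \<kappa>"] conjI allI)
    show "0 \<le> norm x + C / \<kappa>" using C assms(3) by simp
    fix j
    have "norm x + (C / \<kappa>) * (real j * (1 + real j) ^ ?k) \<le> norm x * (1 + real j) ^ Suc ?k + (C / \<kappa>) * (1 + real j) ^ Suc ?k"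
    proof (intro add_mono mult_left_mono)
      have "1 \<le> (1 + real j) ^ Suc ?k" by (rule one_le_power) simp
      then show "norm x \<le> norm x * (1 + real j) ^ Suc ?k" using mult_left_mono[of 1 _ "norm x"] by simp
      show "real j * (1 + real j) ^ ?k \<le> (1 + real j) ^ Suc ?k" by (simp add: mult_right_mono)
    qed (use C assms(3) in auto)
    then have "(norm x + (C / \<kappa>) * (real j * (1 + real j) ^ ?k)) * \<kappa> ^ j
        \<le> ((norm x + C / \<kappa>) * (1 + real j) ^ Suc ?k) * \<kappa> ^ j"
      using assms(3) by (intro mult_right_mono) (auto simp: algebra_simps)
    then show "norm (((*v) A ^^ j) x) \<le> (norm x + C / \<kappa>) * (1 + real j) ^ length (\<mu> # \<mu>s) * \<kappa> ^ j"
      using bd[of j] by simp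
  qed
qed

text \<open>One factor 1 + j is paid for by half of the geometric decay: the induction passes from x
  to its square root.\<close>

lemma poly_geom_bounded:
  assumes "0 < x" "x < (1::real)"
  shows "\<exists>C\<ge>0. \<forall>j. (1 + real j) ^ k * x ^ j \<le> C"
  using assms
proof (induction k arbitrary: x)
  case 0
  then show ?case by (intro exI[of _ 1]) (auto intro: power_le_one)
next
  case (Suc k)
  let ?y = "sqrt x"
  have y: "0 < ?y" "?y < 1" using Suc.prems by auto
  obtain C where C: "C \<ge> 0" "\<And>j. (1 + real j) ^ k * ?y ^ j \<le> C" using Suc.IH[OF y] by blast
  have "(\<lambda>j. (1 + real j) * ?y ^ j) \<longlonglongrightarrow> 0" using y by real_asymp
  then have "Bseq (\<lambda>j. (1 + real j) * ?y ^ j)" by (intro convergent_imp_Bseq convergentI)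
  then obtain D where D: "D > 0" "\<And>j. norm ((1 + real j) * ?y ^ j) \<le> D" by (auto simp: Bseq_def)
  show ?case
  proof (intro exI[of _ "C * D"] conjI allI)
    show "0 \<le> C * D" using C D by simp
    fix j
    have "(1 + real j) ^ Suc k * x ^ j = ((1 + real j) ^ k * ?y ^ j) * ((1 + real j) * ?y ^ j)"
      using Suc.prems by (simp add: mult_ac flip: power_mult_distrib)
    also have "\<dots> \<le> C * D"
      using C D y by (intro mult_mono) (auto intro: order_trans[OF abs_ge_self])
    finally show "(1 + real j) ^ Suc k * x ^ j \<le> C * D" .
  qed
qed

section \<open>Real matrices through their complexification\<close>

definition cmat :: "real^'d^'d \<Rightarrow> complex^'d^'d"
  where "cmat R = (\<chi> i j. of_real (R $ i $ j))"

definition repart :: "complex^'d \<Rightarrow> real^'d"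
  where "repart z = (\<chi> k. Re (z $ k))"

text \<open>The rate \<kappa> is strictly below \<rho>, so polynomial factors are absorbed and such
  orbits are negligible against \<rho> ^ j.\<close>

definition slow :: "complex^'d^'d \<Rightarrow> real \<Rightarrow> complex^'d \<Rightarrow> bool"
  where "slow A \<rho> z \<longleftrightarrow> (\<exists>C \<kappa>. 0 < \<kappa> \<and> \<kappa> < \<rho> \<and> C \<ge> 0 \<and> (\<forall>j. norm (((*v) A ^^ j) z) \<le> C * \<kappa> ^ j))"

lemma scaleR_eq_smult: "r *\<^sub>R (x :: complex^'d) = of_real r *s x"
  by (simp add: vec_eq_iff) (simp add: scaleR_conv_of_real)

lemma iter_scaleR: "((*v) A ^^ j) (r *\<^sub>R x) = r *\<^sub>R ((*v) A ^^ j) x"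
  for A :: "complex^'d^'d"
  by (simp add: scaleR_eq_smult iter_smult)

lemma cofr_add: "cofr (x + y) = cofr x + cofr y"
  and cofr_scaleR: "cofr (r *\<^sub>R x) = r *\<^sub>R cofr x"
  and repart_cofr [simp]: "repart (cofr x) = x"
  and repart_add: "repart (u + v) = repart u + repart v"
  and repart_scaleR: "repart (r *\<^sub>R u) = r *\<^sub>R repart u"
  by (simp_all add: cofr_def repart_def vec_eq_iff complex_eq_iff)

lemma norm_cofr: "norm (cofr x) = norm x"
  by (simp add: norm_vec_def cofr_def)

lemma norm_repart: "norm (repart z) \<le> norm z"
  unfolding norm_vec_def by (intro L2_set_mono) (auto simp: repart_def abs_Re_le_cmod)

lemma repart_cmat: "repart (cmat R *v z) = R *v repart z"
  by (simp add: repart_def cmat_def matrix_vector_mult_def vec_eq_iff)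

lemma cofr_cmat: "cofr (R *v x) = cmat R *v cofr x"
  by (simp add: cofr_def cmat_def matrix_vector_mult_def vec_eq_iff)

lemma cofr_iter: "cofr (((*v) R ^^ j) x) = ((*v) (cmat R) ^^ j) (cofr x)"
  for R :: "real^'d^'d"
  by (induction j) (auto simp: cofr_cmat)

lemma repart_iter: "repart (((*v) (cmat R) ^^ j) z) = ((*v) R ^^ j) (repart z)"
  for R :: "real^'d^'d"
  by (induction j) (auto simp: repart_cmat)

lemma ip_repart: "ip \<alpha> (repart z) = Re (ip \<alpha> z)"
  by (simp add: ip_def repart_def)

lemma tendsto_repart: "(f \<longlongrightarrow> l) F \<Longrightarrow> ((\<lambda>x. repart (f x)) \<longlongrightarrow> repart l) F"
  unfolding repart_def by (intro tendsto_intros)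

lemma ip_bound:
  fixes \<alpha> :: "int^'d"
  shows "\<exists>L>0. \<forall>x :: real^'d. \<bar>ip \<alpha> x\<bar> \<le> L * norm x"
proof (intro exI conjI allI)
  let ?L = "1 + (\<Sum>k\<in>UNIV. \<bar>of_int (\<alpha> $ k)\<bar>) :: real"
  show "0 < ?L" by (intro add_pos_nonneg sum_nonneg) auto
  fix x :: "real^'d"
  have "\<bar>ip \<alpha> x\<bar> \<le> (\<Sum>k\<in>UNIV. \<bar>of_int (\<alpha> $ k)\<bar> * \<bar>x $ k\<bar>)"
    unfolding ip_def by (rule order_trans[OF sum_abs]) (simp add: abs_mult)
  also have "\<dots> \<le> (\<Sum>k\<in>UNIV. \<bar>of_int (\<alpha> $ k)\<bar> * norm x)"
    by (intro sum_mono mult_left_mono component_le_norm_cart) auto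
  also have "\<dots> \<le> ?L * norm x" by (simp add: distrib_right sum_distrib_right)
  finally show "\<bar>ip \<alpha> x\<bar> \<le> ?L * norm x" .
qed

lemma ann_slow:
  assumes z: "z \<in> ann A \<mu>s" and \<mu>s: "\<And>\<mu>. \<mu> \<in> set \<mu>s \<Longrightarrow> cmod \<mu> < \<rho>" and \<rho>: "\<rho> > 0"
  shows "slow A \<rho> z"
proof -
  define \<kappa>0 where "\<kappa>0 = Max (insert (\<rho> / 2) (cmod ` set \<mu>s))"
  have "\<kappa>0 \<in> insert (\<rho> / 2) (cmod ` set \<mu>s)" unfolding \<kappa>0_def by (intro Max_in) auto
  then have 1: "\<kappa>0 < \<rho>" using \<mu>s \<rho> by auto
  have "\<rho> / 2 \<le> \<kappa>0" unfolding \<kappa>0_def by (intro Max_ge) auto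
  then have 0: "\<kappa>0 > 0" using \<rho> by simp
  have le: "cmod \<mu> \<le> \<kappa>0" if "\<mu> \<in> set \<mu>s" for \<mu> unfolding \<kappa>0_def using that by (intro Max_ge) auto
  obtain C where C: "C \<ge> 0" "\<And>j. norm (((*v) A ^^ j) z) \<le> C * (1 + real j) ^ length \<mu>s * \<kappa>0 ^ j"
    using ann_growth[OF z le 0] by blast
  define \<kappa> where "\<kappa> = (\<kappa>0 + \<rho>) / 2"
  have \<kappa>: "\<kappa>0 < \<kappa>" "\<kappa> < \<rho>" using 1 by (auto simp: \<kappa>_def)
  obtain D where D: "D \<ge> 0" "\<And>j. (1 + real j) ^ length \<mu>s * (\<kappa>0 / \<kappa>) ^ j \<le> D"
    using poly_geom_bounded[of "\<kappa>0 / \<kappa>" "length \<mu>s"] 0 \<kappa> by auto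
  have "norm (((*v) A ^^ j) z) \<le> (C * D) * \<kappa> ^ j" for j
  proof -
    have "norm (((*v) A ^^ j) z) \<le> C * ((1 + real j) ^ length \<mu>s * (\<kappa>0 / \<kappa>) ^ j) * \<kappa> ^ j"
      using C(2)[of j] 0 \<kappa> by (simp add: power_divide)
    also have "\<dots> \<le> (C * D) * \<kappa> ^ j"
      using C D 0 \<kappa> by (intro mult_right_mono mult_left_mono) auto
    finally show ?thesis .
  qed
  then show ?thesis unfolding slow_def using C D 0 \<kappa> by (intro exI[of _ "C * D"] exI[of _ \<kappa>]) auto
qed

text \<open>A Stolz-Cesaro theorem: errors that are small relative to the weights stay small on
  average, and divergence of the total weight washes out the initial terms.\<close>

lemma weighted_mean_limit:
  fixes c :: "nat \<Rightarrow> 'a::real_normed_vector" and w :: "nat \<Rightarrow> real"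
  assumes w: "\<And>i. w i \<ge> 0" and W: "filterlim (\<lambda>j. \<Sum>i<j. w i) at_top sequentially"
    and c: "\<And>e. e > 0 \<Longrightarrow> \<forall>\<^sub>F i in sequentially. norm (c i - w i *\<^sub>R v) \<le> e * w i"
  shows "(\<lambda>j. (1 / (\<Sum>i<j. w i)) *\<^sub>R (\<Sum>i<j. c i)) \<longlonglongrightarrow> v"
proof (rule tendstoI)
  fix e :: real assume e: "e > 0"
  obtain N where N: "\<And>i. i \<ge> N \<Longrightarrow> norm (c i - w i *\<^sub>R v) \<le> e / 2 * w i"
    using c[of "e / 2"] e by (auto simp: eventually_sequentially)
  define K where "K = (\<Sum>i<N. norm (c i - w i *\<^sub>R v))"
  have K: "K \<ge> 0" by (simp add: K_def sum_nonneg)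
  have "\<forall>\<^sub>F j in sequentially. (\<Sum>i<j. w i) > 2 * K / e" "\<forall>\<^sub>F j in sequentially. (\<Sum>i<j. w i) > 0"
    using W by (auto simp: filterlim_at_top_dense)
  then show "\<forall>\<^sub>F j in sequentially. dist ((1 / (\<Sum>i<j. w i)) *\<^sub>R (\<Sum>i<j. c i)) v < e"
    using eventually_ge_at_top[of N]
  proof eventually_elim
    case (elim j)
    let ?W = "\<Sum>i<j. w i"
    have "(1 / ?W) *\<^sub>R (\<Sum>i<j. c i) - v = (1 / ?W) *\<^sub>R (\<Sum>i<j. c i - w i *\<^sub>R v)"
      using elim(2) by (simp add: sum_subtractf scaleR_diff_right flip: scaleR_sum_left)
    then have "dist ((1 / ?W) *\<^sub>R (\<Sum>i<j. c i)) v = (1 / ?W) * norm (\<Sum>i<j. c i - w i *\<^sub>R v)"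
      using elim(2) by (simp add: dist_norm)
    also have "\<dots> \<le> (1 / ?W) * (\<Sum>i<j. norm (c i - w i *\<^sub>R v))"
      using elim(2) by (intro mult_left_mono norm_sum) auto
    also have "(\<Sum>i<j. norm (c i - w i *\<^sub>R v)) = K + (\<Sum>i\<in>{N..<j}. norm (c i - w i *\<^sub>R v))"
      unfolding K_def using elim(3) by (metis (no_types, lifting) atLeast0LessThan sum.atLeastLessThan_concat zero_le)
    also have "(\<Sum>i\<in>{N..<j}. norm (c i - w i *\<^sub>R v)) \<le> (\<Sum>i\<in>{N..<j}. e / 2 * w i)"
      by (intro sum_mono N) auto
    also have "(\<Sum>i\<in>{N..<j}. e / 2 * w i) \<le> (\<Sum>i<j. e / 2 * w i)"
      using e w by (intro sum_mono2) auto
    also have "(\<Sum>i<j. e / 2 * w i) = e / 2 * ?W" by (simp add: sum_distrib_left)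
    finally have "dist ((1 / ?W) *\<^sub>R (\<Sum>i<j. c i)) v \<le> (1 / ?W) * (K + e / 2 * ?W)"
      using elim(2) by (simp add: divide_right_mono)
    also have "\<dots> < e" using elim e by (simp add: field_simps)
    finally show ?case .
  qed
qed

text \<open>Dividing by \<rho> ^ j turns one factor A - \<rho> into a summation along the orbit of
  \<open>y\<close>. A slow summand gives a convergent series, and if the limit is zero the tails are
  slow again; a summand growing like a binomial coefficient gives the next binomial coefficient by
  averaging. The limit direction is thus reached without Jordan normal form.\<close>

lemma real_eigen_asymp:
  fixes A :: "complex^'d^'d"
  assumes \<rho>: "\<rho> > 0" and \<mu>s: "\<And>\<mu>. \<mu> \<in> set \<mu>s \<Longrightarrow> cmod \<mu> < \<rho>"
    and z: "z \<in> ann A (replicate n (of_real \<rho>) @ \<mu>s)"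
  shows "slow A \<rho> z \<or> (\<exists>p v. v \<noteq> 0 \<and>
    (\<lambda>j. (1 / (\<rho> ^ j * real (j choose p))) *\<^sub>R ((*v) A ^^ j) z) \<longlonglongrightarrow> v)"
  using z
proof (induction n arbitrary: z)
  case 0
  then show ?case using ann_slow[of z A \<mu>s \<rho>] \<mu>s \<rho> by auto
next
  case (Suc n)
  define y where "y = shiftp A (of_real \<rho>) z"
  define c where "c i = (1 / \<rho> ^ Suc i) *\<^sub>R ((*v) A ^^ i) y" for i
  define a where "a j = (1 / \<rho> ^ j) *\<^sub>R ((*v) A ^^ j) z" for j
  have aS: "a (Suc j) = a j + c j" for j
  proof -
    have "((*v) A ^^ Suc j) z = ((*v) A ^^ j) (y + \<rho> *\<^sub>R z)"
      by (simp add: y_def shiftp_def funpow_swap1 scaleR_eq_smult)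
    then show ?thesis using \<rho>
      by (simp only: iter_add iter_scaleR a_def c_def) (simp add: scaleR_add_right add.commute)
  qed
  have a_sum: "a j = z + (\<Sum>i<j. c i)" for j
    by (induction j) (auto simp: aS, simp add: a_def)
  from Suc.prems have "y \<in> ann A (replicate n (of_real \<rho>) @ \<mu>s)" by (simp add: y_def)
  from Suc.IH[OF this] show ?case
  proof (elim disjE exE conjE)
    assume "slow A \<rho> y"
    then obtain C \<kappa> where C: "0 < \<kappa>" "\<kappa> < \<rho>" "C \<ge> 0" "\<And>j. norm (((*v) A ^^ j) y) \<le> C * \<kappa> ^ j"
      by (auto simp: slow_def)
    define q where "q = \<kappa> / \<rho>"
    have q: "0 < q" "q < 1" using C \<rho> by (auto simp: q_def)
    have nc: "norm (c i) \<le> (C / \<rho>) * q ^ i" for i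
      using C(4)[of i] \<rho> by (simp add: c_def q_def power_divide field_simps)
    have sg: "summable (\<lambda>i. (C / \<rho>) * q ^ i)" using q by (intro summable_mult summable_geometric) auto
    have snc: "summable (\<lambda>i. norm (c i))"
      by (rule summable_comparison_test'[OF sg]) (use nc in auto)
    have sc: "summable c" by (rule summable_norm_cancel[OF snc])
    define v where "v = z + suminf c"
    have av: "a \<longlonglongrightarrow> v"
      unfolding v_def a_sum[abs_def] by (intro tendsto_intros summable_LIMSEQ sc)
    show ?thesis
    proof (cases "v = 0")
      case False
      have "(\<lambda>j. (1 / (\<rho> ^ j * real (j choose 0))) *\<^sub>R ((*v) A ^^ j) z) = a" by (simp add: a_def fun_eq_iff)
      then show ?thesis using False av by (intro disjI2 exI[of _ 0] exI[of _ v]) auto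
    next
      \<comment> \<open>The limit is zero, so a j is minus a tail of a geometrically dominated
        series and decays like (\<kappa> / \<rho>) ^ j.\<close>
      case True
      have "norm (((*v) A ^^ j) z) \<le> (C / \<rho> / (1 - q)) * \<kappa> ^ j" for j
      proof -
        have "a j = - (\<Sum>i. c (i + j))"
          using suminf_split_initial_segment[OF sc, of j] True
          by (simp add: a_sum v_def algebra_simps eq_neg_iff_add_eq_0)
        then have "norm (a j) \<le> (\<Sum>i. norm (c (i + j)))"
          using summable_norm[of "\<lambda>i. c (i + j)"] summable_ignore_initial_segment[OF snc, of j] by simp
        also have "\<dots> \<le> (\<Sum>i. (C / \<rho>) * q ^ j * q ^ i)"
        proof (intro suminf_le summable_mult summable_geometric)
          show "norm (c (i + j)) \<le> (C / \<rho>) * q ^ j * q ^ i" for i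
            using nc[of "i + j"] by (simp add: power_add mult_ac)
        qed (use q summable_ignore_initial_segment[OF snc, of j] in auto)
        also have "\<dots> = (C / \<rho>) * q ^ j * (1 / (1 - q))"
          using q by (subst suminf_mult) (auto simp: suminf_geometric summable_geometric)
        finally have "norm (a j) \<le> (C / \<rho>) * q ^ j * (1 / (1 - q))" .
        moreover have "norm (((*v) A ^^ j) z) = norm (a j) * \<rho> ^ j" using \<rho> by (simp add: a_def)
        ultimately have "norm (((*v) A ^^ j) z) \<le> ((C / \<rho>) * q ^ j * (1 / (1 - q))) * \<rho> ^ j"
          using \<rho> by (metis mult_right_mono zero_le_power less_imp_le)
        also have "\<dots> = (C / \<rho> / (1 - q)) * \<kappa> ^ j"
          using \<rho> by (simp add: q_def power_divide)
        finally show ?thesis .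
      qed
      then show ?thesis using C \<rho> q unfolding slow_def
        by (intro disjI1 exI[of _ "C / \<rho> / (1 - q)"] exI[of _ \<kappa>]) auto
    qed
  next
    fix p v assume v: "v \<noteq> 0" and lim: "(\<lambda>j. (1 / (\<rho> ^ j * real (j choose p))) *\<^sub>R ((*v) A ^^ j) y) \<longlonglongrightarrow> v"
    let ?w = "\<lambda>i. real (i choose p)"
    \<comment> \<open>The hockey-stick identity: binomial weights are reproduced by summation, which
      is why they, and not powers of j, measure the polynomial part of the growth.\<close>
    have W: "(\<Sum>i<j. ?w i) = real (j choose Suc p)" for j
    proof (induction j)
      case (Suc j)
      then show ?case by (simp add: add.commute)
    qed simp
    have Wlim: "filterlim (\<lambda>j. real (j choose Suc p)) at_top sequentially"
    proof (rule filterlim_at_top_mono)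
      show "filterlim (\<lambda>j. real j - real p) at_top sequentially" by real_asymp
      show "\<forall>\<^sub>F j in sequentially. real j - real p \<le> real (j choose Suc p)"
        using eventually_gt_at_top[of p]
      proof eventually_elim
        case (elim j)
        have "j - p \<le> j choose Suc p"
          using elim
        proof (induction j)
          case (Suc j)
          show ?case
          proof (cases "p = j")
            case False
            then have "p < j" using Suc.prems by simp
            then have "j - p \<le> j choose Suc p" "1 \<le> j choose p" using Suc.IH by (auto simp: Suc_le_eq)
            then show ?thesis using Suc.prems by simp
          qed simp
        qed simp
        then show ?case using elim by linarith
      qed
    qed
    have "(\<lambda>j. (1 / (\<Sum>i<j. ?w i)) *\<^sub>R (\<Sum>i<j. c i)) \<longlonglongrightarrow> (1 / \<rho>) *\<^sub>R v"
    proof (rule weighted_mean_limit)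
      show "filterlim (\<lambda>j. \<Sum>i<j. ?w i) at_top sequentially" unfolding W by (rule Wlim)
      fix e :: real assume e: "e > 0"
      have "\<forall>\<^sub>F j in sequentially. dist ((1 / (\<rho> ^ j * ?w j)) *\<^sub>R ((*v) A ^^ j) y) v < e * \<rho>"
        using tendstoD[OF lim] e \<rho> by simp
      then show "\<forall>\<^sub>F i in sequentially. norm (c i - ?w i *\<^sub>R (1 / \<rho>) *\<^sub>R v) \<le> e * ?w i"
        using eventually_ge_at_top[of p]
      proof eventually_elim
        case (elim i)
        then have w: "?w i > 0" by simp
        have "c i - ?w i *\<^sub>R (1 / \<rho>) *\<^sub>R v = (?w i / \<rho>) *\<^sub>R ((1 / (\<rho> ^ i * ?w i)) *\<^sub>R ((*v) A ^^ i) y - v)"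
          using w \<rho> by (simp add: c_def scaleR_diff_right mult.commute)
        then have "norm (c i - ?w i *\<^sub>R (1 / \<rho>) *\<^sub>R v) = (?w i / \<rho>) * dist ((1 / (\<rho> ^ i * ?w i)) *\<^sub>R ((*v) A ^^ i) y) v"
          using w \<rho> by (simp add: dist_norm)
        also have "\<dots> \<le> (?w i / \<rho>) * (e * \<rho>)"
          using elim(1) w \<rho> by (intro mult_left_mono) auto
        also have "\<dots> = e * ?w i" using \<rho> by simp
        finally show ?case .
      qed
    qed auto
    then have l1: "(\<lambda>j. (1 / real (j choose Suc p)) *\<^sub>R (\<Sum>i<j. c i)) \<longlonglongrightarrow> (1 / \<rho>) *\<^sub>R v"
      unfolding W .
    have l2: "(\<lambda>j. 1 / real (j choose Suc p)) \<longlonglongrightarrow> 0"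
      by (intro tendsto_divide_0[OF tendsto_const] filterlim_at_top_imp_at_infinity Wlim)
    have "(\<lambda>j. (1 / real (j choose Suc p)) *\<^sub>R z + (1 / real (j choose Suc p)) *\<^sub>R (\<Sum>i<j. c i)) \<longlonglongrightarrow> 0 *\<^sub>R z + (1 / \<rho>) *\<^sub>R v"
      by (intro tendsto_add[OF tendsto_scaleR[OF l2 tendsto_const] l1])
    moreover have "(1 / real (j choose Suc p)) *\<^sub>R z + (1 / real (j choose Suc p)) *\<^sub>R (\<Sum>i<j. c i)
        = (1 / (\<rho> ^ j * real (j choose Suc p))) *\<^sub>R ((*v) A ^^ j) z" for j
      unfolding scaleR_add_right [symmetric] a_sum [symmetric] by (simp add: a_def mult.commute)
    ultimately have "(\<lambda>j. (1 / (\<rho> ^ j * real (j choose Suc p))) *\<^sub>R ((*v) A ^^ j) z) \<longlonglongrightarrow> (1 / \<rho>) *\<^sub>R v" by simp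
    then show ?thesis using v \<rho> by (intro disjI2 exI[of _ "Suc p"] exI[of _ "(1 / \<rho>) *\<^sub>R v"]) auto
  qed
qed

text \<open>The angle \<phi> of \<mu> lies between 0 and pi; the first multiple of \<phi> that
  reaches pi / 2 is still below pi / 2 + \<phi> \<le> 3 pi / 2, where the cosine is
  nonpositive.\<close>

lemma power_Re_nonpos:
  assumes "\<mu> \<notin> \<real>\<^sub>\<ge>\<^sub>0"
  shows "\<exists>n. Re (\<mu> ^ n) \<le> 0"
proof -
  have \<mu>0: "\<mu> \<noteq> 0" using assms by auto
  define \<phi> where "\<phi> = \<bar>Arg \<mu>\<bar>"
  have A0: "Arg \<mu> \<noteq> 0" using assms Arg_eq_0 by (auto simp: nonneg_Reals_def complex_nonneg_Reals_iff complex_is_Real_iff)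
  have \<phi>: "0 < \<phi>" "\<phi> \<le> pi" using A0 Arg_bounded[of \<mu>] by (auto simp: \<phi>_def)
  define n where "n = nat \<lceil>pi / (2 * \<phi>)\<rceil>"
  have n1: "pi / (2 * \<phi>) \<le> real n" unfolding n_def by (rule of_nat_ceiling)
  have "real n < pi / (2 * \<phi>) + 1"
    unfolding n_def using \<phi> ceiling_correct[of "pi / (2 * \<phi>)"] by simp
  then have n2: "real n * \<phi> < pi / 2 + \<phi>" and n3: "pi / 2 \<le> real n * \<phi>"
    using n1 \<phi> by (auto simp: field_simps)
  have "\<mu> ^ n = of_real (cmod \<mu> ^ n) * cis (real n * Arg \<mu>)"
    using rcis_cmod_Arg[of \<mu>] DeMoivre2[of "cmod \<mu>" "Arg \<mu>" n] by (simp add: rcis_def)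
  then have "Re (\<mu> ^ n) = cmod \<mu> ^ n * cos (real n * Arg \<mu>)" by simp
  also have "cos (real n * Arg \<mu>) = cos (real n * \<phi>)" by (auto simp: \<phi>_def abs_if)
  also have "cos (real n * \<phi>) = - cos (real n * \<phi> - pi)" by (simp add: cos_diff)
  finally have "Re (\<mu> ^ n) = - (cmod \<mu> ^ n * cos (real n * \<phi> - pi))" by simp
  moreover have "cos (real n * \<phi> - pi) \<ge> 0"
    using n2 n3 \<phi> by (intro cos_ge_zero) auto
  ultimately show ?thesis by (intro exI[of _ n]) (simp only: neg_le_0_iff_le mult_nonneg_nonneg zero_le_power norm_ge_zero)
qed

text \<open>The polynomial is the product of X ^ n - \<mu> ^ n, which is divisible by X - \<mu>, and
  X ^ n - cnj (\<mu> ^ n). Pairing with the conjugate makes the coefficients real, so it also acts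
  on real vectors.\<close>

lemma ann_quadratic:
  fixes A :: "complex^'d^'d"
  assumes z: "z \<in> ann A (\<mu> # \<mu>s)"
  shows "((*v) A ^^ n) (((*v) A ^^ n) z) + (- 2 * Re (\<mu> ^ n)) *\<^sub>R ((*v) A ^^ n) z + (cmod (\<mu> ^ n))\<^sup>2 *\<^sub>R z \<in> ann A \<mu>s"
proof -
  let ?I = "(*v) A ^^ n"
  have d: "((*v) A ^^ n) z - \<mu> ^ n *s z \<in> ann A \<mu>s" for n
  proof (induction n)
    case 0
    then show ?case by (simp add: ann_0)
  next
    case (Suc n)
    have "((*v) A ^^ Suc n) z - \<mu> ^ Suc n *s z = A *v (((*v) A ^^ n) z - \<mu> ^ n *s z) + \<mu> ^ n *s shiftp A \<mu> z"
      by (simp add: shiftp_def matrix_vector_mult_diff_distrib vector_scalar_commute vector_ssub_ldistrib vector_smult_assoc mult.commute)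
    also have "\<dots> \<in> ann A \<mu>s" using Suc z by (intro ann_add ann_A ann_smult) auto
    finally show ?case .
  qed
  let ?d = "?I z - \<mu> ^ n *s z"
  have lin: "?I (?I z - \<mu> ^ n *s z) = ?I (?I z) - \<mu> ^ n *s ?I z"
    using iter_add[of n A "?I z" "(- (\<mu> ^ n)) *s z"] iter_smult[of n A "- (\<mu> ^ n)" z] by simp
  have c1: "complex_of_real (- 2 * Re (\<mu> ^ n)) = - (\<mu> ^ n) - cnj (\<mu> ^ n)"
    using complex_add_cnj[of "\<mu> ^ n"] by (simp add: algebra_simps)
  have c2: "complex_of_real ((cmod (\<mu> ^ n))\<^sup>2) = \<mu> ^ n * cnj (\<mu> ^ n)"
    by (rule complex_norm_square)
  have "?I (?I z) + (- 2 * Re (\<mu> ^ n)) *\<^sub>R ?I z + (cmod (\<mu> ^ n))\<^sup>2 *\<^sub>R z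
      = ?I ?d - cnj (\<mu> ^ n) *s ?d"
    unfolding lin scaleR_eq_smult c1 c2
    by (simp add: vec_eq_iff algebra_simps)
  also have "\<dots> \<in> ann A \<mu>s" by (intro ann_diff ann_iter ann_smult d)
  finally show ?thesis .
qed

text \<open>An eigenvalue \<open>\<mu>\<close> outside the half-line of nonnegative reals is a root of
  \<open>X ^ (2 * n) - 2 * Re (\<mu> ^ n) * X ^ n + (cmod (\<mu> ^ n))\<^sup>2\<close>, whose coefficients are nonnegative for a
  suitable \<open>n\<close>; after normalisation this polynomial of \<open>R\<close> maps the convex invariant set \<open>B\<close> to itself.\<close>

lemma kill_eigenvalues:
  fixes R :: "real^'d^'d" and B :: "(real^'d) set"
  assumes B: "convex B" "\<And>x. x \<in> B \<Longrightarrow> R *v x \<in> B"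
    and x: "x \<in> B" "cofr x \<in> ann (cmat R) (bs @ \<mu>s)" and bs: "\<And>\<mu>. \<mu> \<in> set bs \<Longrightarrow> \<mu> \<notin> \<real>\<^sub>\<ge>\<^sub>0"
    and l: "linear l" "\<And>y. l (R *v y) = \<rho> *\<^sub>R (l y :: complex)" "\<rho> > 0"
  shows "\<exists>x'\<in>B. cofr x' \<in> ann (cmat R) \<mu>s \<and> (l x \<noteq> 0 \<longrightarrow> l x' \<noteq> 0)"
  using x bs
proof (induction bs arbitrary: x)
  case Nil
  then show ?case by auto
next
  case (Cons \<mu> bs)
  obtain n where n: "Re (\<mu> ^ n) \<le> 0" using power_Re_nonpos[of \<mu>] Cons.prems by auto
  define b where "b = - 2 * Re (\<mu> ^ n)"
  define c where "c = (cmod (\<mu> ^ n))\<^sup>2"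
  have b: "b \<ge> 0" and c: "c \<ge> 0" using n by (auto simp: b_def c_def)
  let ?I = "(*v) R ^^ n"
  have IB: "?I y \<in> B" if "y \<in> B" for y using that B(2) by (induction n) auto
  define y where "y = ?I (?I x) + b *\<^sub>R ?I x + c *\<^sub>R x"
  define x' where "x' = (1 / (1 + b + c)) *\<^sub>R y"
  have "(1 / (1 + b + c)) *\<^sub>R ?I (?I x) + (b / (1 + b + c)) *\<^sub>R ?I x + (c / (1 + b + c)) *\<^sub>R x \<in> B"
  proof -
    have 1: "1 + b > 0" "1 + b + c > 0" using b c by auto
    have pB: "(1 / (1 + b)) *\<^sub>R ?I (?I x) + (b / (1 + b)) *\<^sub>R ?I x \<in> B"
      using b 1 Cons.prems(1) by (intro convexD[OF B(1)] IB) (auto simp flip: add_divide_distrib)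
    have "((1 + b) / (1 + b + c)) *\<^sub>R ((1 / (1 + b)) *\<^sub>R ?I (?I x) + (b / (1 + b)) *\<^sub>R ?I x) + (c / (1 + b + c)) *\<^sub>R x \<in> B"
      using b c 1 by (intro convexD[OF B(1) pB Cons.prems(1)]) (auto simp flip: add_divide_distrib)
    then show ?thesis using 1 by (simp add: scaleR_add_right)
  qed
  then have x'B: "x' \<in> B" by (simp add: x'_def y_def scaleR_add_right)
  have "cofr y \<in> ann (cmat R) (bs @ \<mu>s)"
    using ann_quadratic[of "cofr x" "cmat R" \<mu> "bs @ \<mu>s" n] Cons.prems(2)
    unfolding y_def cofr_add cofr_scaleR cofr_iter b_def c_def append_Cons by blast
  then have x'a: "cofr x' \<in> ann (cmat R) (bs @ \<mu>s)"
    unfolding x'_def cofr_scaleR scaleR_eq_smult by (rule ann_smult)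
  have lI: "l (((*v) R ^^ j) y) = \<rho> ^ j *\<^sub>R l y" for j y
    by (induction j) (auto simp: l(2))
  \<comment> \<open>On values of \<open>l\<close> the matrix acts as \<rho>, so l x is multiplied by
    a positive number and stays nonzero.\<close>
  have "l x' = (1 / (1 + b + c)) *\<^sub>R ((\<rho> ^ n * \<rho> ^ n + b * \<rho> ^ n + c) *\<^sub>R l x)"
    unfolding x'_def y_def by (simp add: linear_add[OF l(1)] linear_scale[OF l(1)] lI algebra_simps)
  moreover have "\<rho> ^ n * \<rho> ^ n + b * \<rho> ^ n + c > 0"
    using b c l(3) by (intro add_pos_nonneg) auto
  moreover have "1 + b + c > 0" using b c by linarith
  ultimately have "l x \<noteq> 0 \<Longrightarrow> l x' \<noteq> 0" by simp
  with Cons.IH[OF x'B x'a] Cons.prems(3) show ?case by auto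
qed

text \<open>The point may depend on j but ranges in one compact set, on which a holomorphic function
  on the bundle has a uniform bound.\<close>

definition growing :: "real^'d^'d \<Rightarrow> (real^'d) set \<Rightarrow> real \<Rightarrow> int^'d \<Rightarrow> bool"
  where "growing R B \<rho> \<alpha> \<longleftrightarrow> (\<exists>X c J. compact X \<and> X \<subseteq> B \<and> c > 0 \<and>
    (\<forall>j\<ge>J. \<exists>x\<in>X. ip \<alpha> (((*v) R ^^ j) x) \<ge> c * \<rho> ^ j))"

section \<open>The spectral dichotomy for orbits in open convex sets\<close>

lemma left_eigenvector:
  fixes A :: "complex^'d^'d"
  assumes "eigval A \<mu>"
  obtains l where "l \<noteq> 0" "transpose A *v l = \<mu> *s l"
proof -
  have mat: "mat \<mu> *v x = \<mu> *s x" for x :: "complex^'d"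
    by (simp add: mat_def matrix_vector_mult_def vec_eq_iff mult_delta_left)
  have "\<not> invertible (A - mat \<mu>)"
  proof
    assume "invertible (A - mat \<mu>)"
    then obtain C where C: "C ** (A - mat \<mu>) = mat 1" by (auto simp: invertible_def)
    obtain v where v: "v \<noteq> 0" "A *v v = \<mu> *s v" using assms by (auto simp: eigval_def)
    have "v = C *v ((A - mat \<mu>) *v v)" using C by (simp add: matrix_vector_mul_assoc)
    also have "(A - mat \<mu>) *v v = 0" using v by (simp add: matrix_vector_mult_diff_rdistrib mat)
    finally show False using v by simp
  qed
  then have "det (A - mat \<mu>) = 0" by (simp add: invertible_det_nz)
  then have "det (transpose (A - mat \<mu>)) = 0" by (simp add: det_transpose)
  then have "\<not> invertible (transpose (A - mat \<mu>))" by (simp add: invertible_det_nz)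
  then have "\<not> (\<forall>x. transpose (A - mat \<mu>) *v x = 0 \<longrightarrow> x = 0)"
    using matrix_left_invertible_ker[of "transpose (A - mat \<mu>)"] invertible_left_inverse[of "transpose (A - mat \<mu>)"] by blast
  then obtain l where l: "l \<noteq> 0" "transpose (A - mat \<mu>) *v l = 0" by blast
  have "transpose (A - mat \<mu>) = transpose A - mat \<mu>"
    by (simp add: transpose_def mat_def vec_eq_iff)
  then have "transpose A *v l = \<mu> *s l" using l(2) by (simp add: matrix_vector_mult_diff_rdistrib mat)
  then show ?thesis using that l(1) by blast
qed

text \<open>The first alternative arises if \<rho> is itself an eigenvalue, the second if the
  modulus \<rho> is attained only elsewhere. In the first, the other eigenvalues of modulus \<rho>
  are removed while a left eigenvector for \<rho> certifies that the orbit still grows at full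
  rate.\<close>

theorem spectral_dichotomy:
  fixes R :: "real^'d^'d" and B :: "(real^'d) set"
  assumes B: "open B" "convex B" "B \<noteq> {}" and RB: "\<And>x. x \<in> B \<Longrightarrow> R *v x \<in> B"
    and \<rho>: "\<rho> > 1" and ev: "\<And>\<mu>. eigval (cmat R) \<mu> \<Longrightarrow> cmod \<mu> \<le> \<rho>"
    and \<mu>0: "eigval (cmat R) \<mu>0" "cmod \<mu>0 = \<rho>"
  shows "(\<exists>v. v \<noteq> 0 \<and> (\<forall>x\<in>B. \<forall>t\<ge>0. x + t *\<^sub>R v \<in> B) \<and> (\<forall>\<alpha>. ip \<alpha> v > 0 \<longrightarrow> growing R B \<rho> \<alpha>)) \<or>
    (\<exists>r :: real^'d. r \<noteq> 0 \<and> (\<forall>\<alpha>. ip \<alpha> r \<noteq> 0 \<longrightarrow> growing R B \<rho> \<alpha>))"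
proof -
  let ?A = "cmat R"
  have IB: "((*v) R ^^ j) x \<in> B" if "x \<in> B" for x j
    using that RB by (induction j) auto
  \<comment> \<open>The shifts commute, so the list can be sorted into the eigenvalues to be
    removed, the copies of \<rho>, and those of smaller modulus.\<close>
  have reorder: "cofr x \<in> ann ?A (filter (\<lambda>\<mu>. cmod \<mu> = \<rho> \<and> \<mu> \<noteq> of_real \<rho>) \<mu>s
      @ replicate (count_list \<mu>s (of_real \<rho>)) (of_real \<rho>) @ filter (\<lambda>\<mu>. cmod \<mu> < \<rho>) \<mu>s)"
    if "cofr x \<in> ann ?A \<mu>s" "\<forall>\<mu>\<in>set \<mu>s. eigval ?A \<mu>" for x \<mu>s
  proof -
    have le: "\<forall>\<mu>\<in>set \<mu>s. cmod \<mu> \<le> \<rho>" using that(2) ev by auto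
    have "mset (filter (\<lambda>\<mu>. cmod \<mu> = \<rho> \<and> \<mu> \<noteq> of_real \<rho>) \<mu>s
      @ replicate (count_list \<mu>s (of_real \<rho>)) (of_real \<rho>) @ filter (\<lambda>\<mu>. cmod \<mu> < \<rho>) \<mu>s) = mset \<mu>s"
      using le \<rho> by (induction \<mu>s) auto
    then show ?thesis using that(1) ann_mset by blast
  qed
  have bad: "\<mu> \<notin> \<real>\<^sub>\<ge>\<^sub>0" if "\<mu> \<in> set (filter (\<lambda>\<mu>. cmod \<mu> = \<rho> \<and> \<mu> \<noteq> of_real \<rho>) \<mu>s)" for \<mu> \<mu>s
    using that by (auto simp: nonneg_Reals_def)
  show ?thesis
  proof (cases "eigval ?A (of_real \<rho>)")
    case True
    obtain l0 where l0: "l0 \<noteq> 0" "transpose ?A *v l0 = of_real \<rho> *s l0" using left_eigenvector[OF True] .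
    define l where "l x = (\<Sum>k\<in>UNIV. l0 $ k * of_real (x $ k))" for x :: "real^'d"
    have linl: "linear l"
    proof (rule linearI)
      show "l (r *\<^sub>R b) = r *\<^sub>R l b" for r b
        unfolding l_def scaleR_sum_right by (intro sum.cong refl) (simp add: complex_eq_iff algebra_simps)
    qed (simp add: l_def sum.distrib distrib_left)
    have lR: "l (R *v x) = \<rho> *\<^sub>R l x" for x
    proof -
      have "l (R *v x) = (\<Sum>k\<in>UNIV. \<Sum>j\<in>UNIV. l0 $ k * of_real (R $ k $ j) * of_real (x $ j))"
        by (simp add: l_def matrix_vector_mult_def sum_distrib_left mult.assoc)
      also have "\<dots> = (\<Sum>j\<in>UNIV. (transpose ?A *v l0) $ j * of_real (x $ j))"
        by (subst sum.swap) (simp add: matrix_vector_mult_def transpose_def cmat_def sum_distrib_right sum_distrib_left mult_ac)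
      also have "\<dots> = \<rho> *\<^sub>R l x"
        unfolding l0(2) by (simp add: l_def scaleR_conv_of_real sum_distrib_left mult.assoc)
      finally show ?thesis .
    qed
    obtain x where x: "x \<in> B" "l x \<noteq> 0"
    proof -
      obtain b where b: "b \<in> B" using B by blast
      obtain e where e: "e > 0" "cball b e \<subseteq> B" using B(1) b open_contains_cball by blast
      obtain k where k: "l0 $ k \<noteq> 0" using l0(1) by (auto simp: vec_eq_iff)
      have "l (b + axis k e) = l b + l (axis k e)" by (rule linear_add[OF linl])
      moreover have "l (axis k e) = (\<Sum>i\<in>UNIV. if i = k then l0 $ k * of_real e else 0)"
        unfolding l_def by (intro sum.cong) (auto simp: axis_def)
      ultimately have "l (b + axis k e) = l b + l0 $ k * of_real e" by simp
      moreover have "axis k e = e *\<^sub>R (axis k 1 :: real^'d)" by (simp add: vec_eq_iff axis_def)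
      then have "b + axis k e \<in> B" using e by (intro subsetD[OF e(2)]) (simp add: dist_norm)
      ultimately show ?thesis using that b k e by (cases "l b = 0") auto
    qed
    obtain \<mu>s where \<mu>s: "cofr x \<in> ann ?A \<mu>s" "\<forall>\<mu>\<in>set \<mu>s. eigval ?A \<mu>" using ann_exists by blast
    obtain z where z: "z \<in> B" "l z \<noteq> 0"
      "cofr z \<in> ann ?A (replicate (count_list \<mu>s (of_real \<rho>)) (of_real \<rho>) @ filter (\<lambda>\<mu>. cmod \<mu> < \<rho>) \<mu>s)"
      using kill_eigenvalues[OF B(2) RB x(1) reorder[OF \<mu>s] bad[of _ \<mu>s] linl lR] x(2) \<rho> by auto
    \<comment> \<open>On the orbit of \<open>z\<close> the functional \<open>l\<close> grows exactly
      like \<rho> ^ j and does not vanish.\<close>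
    have "\<not> slow ?A \<rho> (cofr z)"
    proof
      assume "slow ?A \<rho> (cofr z)"
      then obtain C \<kappa> where C: "0 < \<kappa>" "\<kappa> < \<rho>" "C \<ge> 0" "\<And>j. norm (((*v) ?A ^^ j) (cofr z)) \<le> C * \<kappa> ^ j"
        by (auto simp: slow_def)
      obtain L where L: "L > 0" "\<And>y. norm (l y) \<le> norm y * L"
        using bounded_linear.pos_bounded[OF linear_conv_bounded_linear[THEN iffD1, OF linl]] by blast
      have lI: "l (((*v) R ^^ j) y) = \<rho> ^ j *\<^sub>R l y" for j y
        by (induction j) (auto simp: lR)
      have "norm (l z) \<le> L * C * (\<kappa> / \<rho>) ^ j" for j
      proof -
        have "\<rho> ^ j * norm (l z) = norm (l (((*v) R ^^ j) z))" using \<rho> by (simp add: lI)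
        also have "\<dots> \<le> norm (((*v) R ^^ j) z) * L" by (rule L(2))
        also have "norm (((*v) R ^^ j) z) \<le> C * \<kappa> ^ j" using C(4)[of j] by (simp add: norm_cofr flip: cofr_iter)
        finally have "\<rho> ^ j * norm (l z) \<le> C * \<kappa> ^ j * L" using L by simp
        then show ?thesis using \<rho> by (simp add: power_divide field_simps)
      qed
      moreover have "(\<lambda>j. L * C * (\<kappa> / \<rho>) ^ j) \<longlonglongrightarrow> L * C * 0"
        using C \<rho> by (intro tendsto_intros LIMSEQ_power_zero) auto
      ultimately have "norm (l z) \<le> L * C * 0" by (intro LIMSEQ_le_const) auto
      then show False using z by simp
    qed
    moreover have "slow ?A \<rho> (cofr z) \<or> (\<exists>p v. v \<noteq> 0 \<and>
        (\<lambda>j. (1 / (\<rho> ^ j * real (j choose p))) *\<^sub>R ((*v) ?A ^^ j) (cofr z)) \<longlonglongrightarrow> v)"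
      by (rule real_eigen_asymp[OF _ _ z(3)]) (use \<rho> in auto)
    ultimately obtain p w where w: "w \<noteq> 0" "(\<lambda>j. (1 / (\<rho> ^ j * real (j choose p))) *\<^sub>R ((*v) ?A ^^ j) (cofr z)) \<longlonglongrightarrow> w"
      by blast
    define s where "s j = 1 / (\<rho> ^ j * real (j choose p))" for j
    have w': "(\<lambda>j. s j *\<^sub>R cofr (((*v) R ^^ j) z)) \<longlonglongrightarrow> w" using w(2) by (simp add: s_def cofr_iter)
    define v where "v = repart w"
    have sv: "(\<lambda>j. s j *\<^sub>R ((*v) R ^^ j) z) \<longlonglongrightarrow> v"
      using tendsto_repart[OF w'] by (simp add: v_def repart_scaleR)
    \<comment> \<open>A limit of real vectors is real, so \<open>w\<close> is determined by its real
      part \<open>v\<close>, which therefore does not vanish.\<close>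
    have "(\<lambda>j. s j *\<^sub>R cofr (((*v) R ^^ j) z)) \<longlonglongrightarrow> cofr v"
    proof -
      have "(\<lambda>j. cofr (s j *\<^sub>R ((*v) R ^^ j) z)) \<longlonglongrightarrow> cofr v"
        unfolding cofr_def using sv by (intro tendsto_intros) auto
      then show ?thesis by (simp add: cofr_scaleR)
    qed
    then have "cofr v = w" using w' LIMSEQ_unique by blast
    moreover have "cofr 0 = (0 :: complex^'d)" by (simp add: cofr_def vec_eq_iff)
    ultimately have v0: "v \<noteq> 0" using w(1) by metis
    have s0: "s \<longlonglongrightarrow> 0"
    proof (rule tendsto_sandwich[OF _ _ tendsto_const])
      show "\<forall>\<^sub>F j in sequentially. 0 \<le> s j" using \<rho> by (auto simp: s_def)
      show "\<forall>\<^sub>F j in sequentially. s j \<le> (1 / \<rho>) ^ j"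
        using eventually_ge_at_top[of p]
      proof eventually_elim
        case (elim j)
        then have "1 \<le> j choose p" by (simp add: Suc_le_eq)
        then have "\<rho> ^ j * 1 \<le> \<rho> ^ j * real (j choose p)" using \<rho> by (intro mult_left_mono) auto
        then show ?case using \<rho> by (simp add: s_def power_divide frac_le)
      qed
      show "(\<lambda>j. (1 / \<rho>) ^ j) \<longlonglongrightarrow> 0" using \<rho> by (intro LIMSEQ_power_zero) auto
    qed
    have rec: "x + t *\<^sub>R v \<in> B" if x: "x \<in> B" and t: "t \<ge> 0" for x t
    proof -
      \<comment> \<open>Solved from the wish that x + t v be the convex combination of y j and the
        j-th orbit point with weight t s j on the latter. As y j tends to \<open>x\<close>, it
        eventually lies in the open set \<open>B\<close>.\<close>
      define y where "y j = (1 / (1 - t * s j)) *\<^sub>R (x + t *\<^sub>R v - t *\<^sub>R (s j *\<^sub>R ((*v) R ^^ j) z))" for j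
      have "y \<longlonglongrightarrow> (1 / (1 - t * 0)) *\<^sub>R (x + t *\<^sub>R v - t *\<^sub>R v)"
        unfolding y_def by (intro tendsto_intros s0 sv) auto
      then have "y \<longlonglongrightarrow> x" by simp
      then have "\<forall>\<^sub>F j in sequentially. y j \<in> B" using topological_tendstoD[OF _ B(1) x] by blast
      moreover have "(\<lambda>j. t * s j) \<longlonglongrightarrow> t * 0" by (intro tendsto_intros s0)
      then have "\<forall>\<^sub>F j in sequentially. t * s j < 1" by (intro order_tendstoD) auto
      ultimately obtain j where j: "y j \<in> B" "t * s j < 1"
        using eventually_conj eventually_happens trivial_limit_sequentially by (metis (mono_tags, lifting) eventually_conj_iff)
      have "(1 - t * s j) *\<^sub>R y j + (t * s j) *\<^sub>R ((*v) R ^^ j) z \<in> B"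
        using j t IB[OF z(1), of j] \<rho> by (intro convexD[OF B(2)]) (auto simp: s_def)
      moreover have "(1 - t * s j) *\<^sub>R y j + (t * s j) *\<^sub>R ((*v) R ^^ j) z = x + t *\<^sub>R v"
        using j(2) by (simp add: y_def)
      ultimately show ?thesis by simp
    qed
    have "growing R B \<rho> \<alpha>" if \<alpha>: "ip \<alpha> v > 0" for \<alpha>
    proof -
      have "(\<lambda>j. ip \<alpha> (s j *\<^sub>R ((*v) R ^^ j) z)) \<longlonglongrightarrow> ip \<alpha> v"
        unfolding ip_def by (intro tendsto_intros sv)
      then have "\<forall>\<^sub>F j in sequentially. ip \<alpha> (s j *\<^sub>R ((*v) R ^^ j) z) > ip \<alpha> v / 2"
        using \<alpha> by (intro order_tendstoD) auto
      then have "\<forall>\<^sub>F j in sequentially. ip \<alpha> (((*v) R ^^ j) z) \<ge> ip \<alpha> v / 2 * \<rho> ^ j"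
        using eventually_ge_at_top[of p]
      proof eventually_elim
        case (elim j)
        then have c1: "1 \<le> real (j choose p)" by (simp add: Suc_le_eq)
        have "ip \<alpha> v / 2 * \<rho> ^ j \<le> ip \<alpha> v / 2 * (\<rho> ^ j * real (j choose p))"
          using c1 \<alpha> \<rho> by (intro mult_left_mono) auto
        also have "\<dots> \<le> ip \<alpha> (((*v) R ^^ j) z)"
        proof -
          have P: "\<rho> ^ j * real (j choose p) > 0" using \<rho> elim(2) by (intro mult_pos_pos) auto
          have "ip \<alpha> v / 2 < ip \<alpha> (((*v) R ^^ j) z) / (\<rho> ^ j * real (j choose p))"
            using elim(1) by (simp add: ip_scaleR s_def)
          then show ?thesis using P by (simp add: pos_less_divide_eq)
        qed
        finally show ?case .
      qed
      then obtain J where "\<forall>j\<ge>J. ip \<alpha> (((*v) R ^^ j) z) \<ge> ip \<alpha> v / 2 * \<rho> ^ j"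
        by (auto simp: eventually_sequentially)
      then show ?thesis
        unfolding growing_def using z(1) \<alpha> by (intro exI[of _ "{z}"] exI[of _ "ip \<alpha> v / 2"] exI[of _ J]) auto
    qed
    then show ?thesis using v0 rec by (intro disjI1 exI[of _ v] conjI ballI allI impI) simp_all
  next
    case False
    obtain x where x: "x \<in> B" using B by blast
    obtain \<mu>s where \<mu>s: "cofr x \<in> ann ?A \<mu>s" "\<forall>\<mu>\<in>set \<mu>s. eigval ?A \<mu>" using ann_exists by blast
    have "count_list \<mu>s (of_real \<rho>) = 0" using False \<mu>s(2) by (auto simp: count_list_0_iff)
    \<comment> \<open>No functional has to be preserved here, so the zero functional is
      supplied.\<close>
    then obtain z where z: "z \<in> B" "cofr z \<in> ann ?A (filter (\<lambda>\<mu>. cmod \<mu> < \<rho>) \<mu>s)"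
      using kill_eigenvalues[OF B(2) RB x reorder[OF \<mu>s] bad[of _ \<mu>s], of "\<lambda>_. 0" 1] by (auto simp: linear_iff)
    have "slow ?A \<rho> (cofr z)" by (rule ann_slow[OF z(2)]) (use \<rho> in auto)
    then obtain C \<kappa> where C: "0 < \<kappa>" "\<kappa> < \<rho>" "C \<ge> 0" "\<And>j. norm (((*v) ?A ^^ j) (cofr z)) \<le> C * \<kappa> ^ j"
      by (auto simp: slow_def)
    obtain w where w: "w \<noteq> 0" "?A *v w = \<mu>0 *s w" using \<mu>0(1) by (auto simp: eigval_def)
    have Iw: "((*v) ?A ^^ j) (\<zeta> *s w) = (\<zeta> * \<mu>0 ^ j) *s w" for j \<zeta>
      by (induction j) (auto simp: vector_scalar_commute w(2) vector_smult_assoc mult_ac)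
    obtain e where e: "e > 0" "cball z e \<subseteq> B" using B(1) z(1) open_contains_cball by blast
    define d where "d = e / norm w"
    have d: "d > 0" using e w by (simp add: d_def)
    \<comment> \<open>The whole disc of phases \<zeta> is kept, so that the phase can be adapted to
      each j.\<close>
    define X where "X = (\<lambda>\<zeta>. z + d *\<^sub>R repart (\<zeta> *s w)) ` cball 0 1"
    have cX: "compact X"
      unfolding X_def repart_def vector_scalar_mult_def
      by (intro compact_continuous_image continuous_intros continuous_on_vec_lambda) auto
    have XB: "X \<subseteq> B"
    proof
      fix y assume "y \<in> X"
      then obtain \<zeta> where \<zeta>: "cmod \<zeta> \<le> 1" "y = z + d *\<^sub>R repart (\<zeta> *s w)" by (auto simp: X_def)
      have "norm (d *\<^sub>R repart (\<zeta> *s w)) \<le> d * (cmod \<zeta> * norm w)"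
        using d norm_repart[of "\<zeta> *s w"] by (simp add: norm_vsmult)
      also have "\<dots> \<le> d * (1 * norm w)" using \<zeta> d by (intro mult_left_mono mult_right_mono) auto
      also have "\<dots> = e" using w by (simp add: d_def)
      finally show "y \<in> B" using e(2) \<zeta>(2) by (auto simp: dist_norm)
    qed
    have gr: "growing R B \<rho> \<alpha>" if \<alpha>: "ip \<alpha> w \<noteq> 0" for \<alpha>
    proof -
      define g where "g = cmod (ip \<alpha> w)"
      have g: "g > 0" using \<alpha> by (simp add: g_def)
      obtain L where L: "L > 0" "\<And>x. \<bar>ip \<alpha> x\<bar> \<le> L * norm x" using ip_bound by blast
      have "(\<lambda>j. L * C * (\<kappa> / \<rho>) ^ j) \<longlonglongrightarrow> L * C * 0"
        using C \<rho> by (intro tendsto_intros LIMSEQ_power_zero) auto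
      then have "\<forall>\<^sub>F j in sequentially. L * C * (\<kappa> / \<rho>) ^ j < d * g / 2"
        using d g by (intro order_tendstoD) auto
      then obtain J where J: "\<And>j. j \<ge> J \<Longrightarrow> L * C * (\<kappa> / \<rho>) ^ j < d * g / 2"
        by (auto simp: eventually_sequentially)
      have "\<exists>y\<in>X. ip \<alpha> (((*v) R ^^ j) y) \<ge> d * g / 2 * \<rho> ^ j" if j: "j \<ge> J" for j
      proof -
        define q where "q = \<mu>0 ^ j * ip \<alpha> w"
        have q: "cmod q = \<rho> ^ j * g" using \<mu>0(2) by (simp add: q_def g_def norm_mult norm_power)
        then have q0: "cmod q > 0" using g \<rho> by simp
        \<comment> \<open>Cancels the phase of \<mu>0 ^ j times ip \<alpha> w, so the perturbation
          contributes its full modulus with positive sign.\<close>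
        define \<zeta> where "\<zeta> = cnj q / of_real (cmod q)"
        have \<zeta>1: "cmod \<zeta> \<le> 1" using q0 by (simp add: \<zeta>_def norm_divide)
        have \<zeta>q: "\<zeta> * q = of_real (cmod q)"
          using q0 complex_norm_square[of q] by (simp add: \<zeta>_def divide_eq_eq power2_eq_square mult.commute)
        let ?y = "z + d *\<^sub>R repart (\<zeta> *s w)"
        have "((*v) R ^^ j) ?y = repart (((*v) ?A ^^ j) (cofr z + d *\<^sub>R (\<zeta> *s w)))"
          by (simp add: repart_iter repart_add repart_scaleR)
        also have "\<dots> = ((*v) R ^^ j) z + d *\<^sub>R repart ((\<zeta> * \<mu>0 ^ j) *s w)"
          unfolding iter_add iter_scaleR Iw by (simp add: repart_add repart_scaleR repart_iter)
        finally have "ip \<alpha> (((*v) R ^^ j) ?y) = ip \<alpha> (((*v) R ^^ j) z) + d * Re (\<zeta> * q)"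
          by (simp add: ip_add ip_scaleR ip_repart ip_smult q_def mult.assoc)
        also have "Re (\<zeta> * q) = \<rho> ^ j * g" unfolding \<zeta>q q by simp
        finally have eq: "ip \<alpha> (((*v) R ^^ j) ?y) = ip \<alpha> (((*v) R ^^ j) z) + d * (\<rho> ^ j * g)" .
        have "\<bar>ip \<alpha> (((*v) R ^^ j) z)\<bar> \<le> L * norm (((*v) R ^^ j) z)" by (rule L(2))
        also have "norm (((*v) R ^^ j) z) \<le> C * \<kappa> ^ j" using C(4)[of j] by (simp add: norm_cofr flip: cofr_iter)
        finally have "\<bar>ip \<alpha> (((*v) R ^^ j) z)\<bar> \<le> L * (C * \<kappa> ^ j)" using L(1) by simp
        also have "\<dots> = L * C * (\<kappa> / \<rho>) ^ j * \<rho> ^ j" using \<rho> by (simp add: power_divide)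
        also have "\<dots> \<le> d * g / 2 * \<rho> ^ j" using J[OF j] \<rho> by (intro mult_right_mono) auto
        finally have "ip \<alpha> (((*v) R ^^ j) ?y) \<ge> d * g / 2 * \<rho> ^ j" unfolding eq by (simp add: algebra_simps)
        moreover have "?y \<in> X" using \<zeta>1 by (auto simp: X_def)
        ultimately show ?thesis by blast
      qed
      then show ?thesis unfolding growing_def using cX XB d g
        by (intro exI[of _ X] exI[of _ "d * g / 2"] exI[of _ J]) auto
    qed
    \<comment> \<open>The imaginary part of \<open>w\<close>; at least one of its two parts is a
      nonzero real vector.\<close>
    define w2 where "w2 = repart ((- \<i>) *s w)"
    have "repart w \<noteq> 0 \<or> w2 \<noteq> 0"
      using w(1) by (auto simp: w2_def repart_def vec_eq_iff complex_eq_iff)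
    moreover have "ip \<alpha> w \<noteq> 0" if "ip \<alpha> (repart w) \<noteq> 0 \<or> ip \<alpha> w2 \<noteq> 0" for \<alpha>
      using that by (auto simp only: w2_def ip_repart ip_smult mult_zero_right zero_complex.sel)
    ultimately have "(repart w \<noteq> 0 \<and> (\<forall>\<alpha>. ip \<alpha> (repart w) \<noteq> 0 \<longrightarrow> growing R B \<rho> \<alpha>)) \<or>
        (w2 \<noteq> 0 \<and> (\<forall>\<alpha>. ip \<alpha> w2 \<noteq> 0 \<longrightarrow> growing R B \<rho> \<alpha>))"
      by (metis gr)
    then show ?thesis by (elim disjE) (intro disjI2, rule exI, assumption)+
  qed
qed

section \<open>Quotients by discrete translations along one coordinate\<close>

lemma cholomorphic_on_local:
  assumes "\<And>z. z \<in> D \<Longrightarrow> \<exists>N g E. open N \<and> z \<in> N \<and> z \<in> E \<and> cholomorphic_on g E \<and> (\<forall>y\<in>N. f y = g y)"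
  shows "cholomorphic_on f D"
  unfolding cholomorphic_on_def
proof
  fix z assume "z \<in> D"
  then obtain N g E where N: "open N" "z \<in> N" "z \<in> E" "cholomorphic_on g E" "\<And>y. y \<in> N \<Longrightarrow> f y = g y"
    using assms by metis
  then obtain a where "(g has_derivative (\<lambda>h. \<Sum>i\<in>UNIV. a $ i * h $ i)) (at z)"
    by (auto simp: cholomorphic_on_def)
  then have "(f has_derivative (\<lambda>h. \<Sum>i\<in>UNIV. a $ i * h $ i)) (at z)"
    by (rule has_derivative_transform_within_open[OF _ N(1,2)]) (simp add: N(5))
  then show "\<exists>a. (f has_derivative (\<lambda>h. \<Sum>i\<in>UNIV. a $ i * h $ i)) (at z)" by blast
qed

lemma cholomorphic_on_subset: "cholomorphic_on f D \<Longrightarrow> E \<subseteq> D \<Longrightarrow> cholomorphic_on f E"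
  by (auto simp: cholomorphic_on_def)

text \<open>The last assumption makes the action free and properly discontinuous: distinct points of
  an orbit are at distance at least 1 in the coordinate \<open>c0\<close>.\<close>

locale translation_action =
  fixes \<Omega> :: "(complex^'n) set" and act :: "int \<Rightarrow> complex^'n \<Rightarrow> complex^'n" and c0 :: 'n
  assumes open_\<Omega>: "open \<Omega>"
    and act_in: "x \<in> \<Omega> \<Longrightarrow> act j x \<in> \<Omega>"
    and act_0: "x \<in> \<Omega> \<Longrightarrow> act 0 x = x"
    and act_add: "x \<in> \<Omega> \<Longrightarrow> act (i + j) x = act i (act j x)"
    and act_hol: "cholomorphic_map_on (act j) \<Omega>"
    and act_c0: "x \<in> \<Omega> \<Longrightarrow> act j x $ c0 = x $ c0 + of_int j"
begin

definition q where "q = int_orbit act"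

definition Q where "Q = quotient_topology (top_of_set \<Omega>) q"

lemma q_eq: "x \<in> \<Omega> \<Longrightarrow> y \<in> \<Omega> \<Longrightarrow> q x = q y \<longleftrightarrow> (\<exists>j. y = act j x)"
proof
  assume xy: "x \<in> \<Omega>" "y \<in> \<Omega>" "q x = q y"
  have "act 0 y \<in> q y" unfolding q_def int_orbit_def by blast
  then show "\<exists>j. y = act j x" using xy by (auto simp: act_0 q_def int_orbit_def)
next
  assume xy: "x \<in> \<Omega>" "y \<in> \<Omega>" "\<exists>j. y = act j x"
  then obtain j where j: "y = act j x" by blast
  have "act i y = act (i + j) x" for i using xy j by (simp add: act_add)
  then have "q y = range (\<lambda>i. act (i + j) x)" by (simp add: q_def int_orbit_def)
  also have "\<dots> = (\<lambda>k. act k x) ` range (\<lambda>i. i + j)" by (rule image_image [symmetric])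
  also have "range (\<lambda>i. i + j) = (UNIV :: int set)" by (auto simp: image_iff intro: exI[of _ "_ - j"])
  finally show "q x = q y" by (simp add: q_def int_orbit_def)
qed

lemma q_act: "x \<in> \<Omega> \<Longrightarrow> q (act j x) = q x"
  using q_eq[of x "act j x"] act_in by auto

lemma continuous_act: "continuous_on \<Omega> (act j)"
proof -
  have "continuous_on \<Omega> (\<lambda>x. act j x $ k)" for k
    using act_hol cholomorphic_on_imp_continuous unfolding cholomorphic_map_on_def by blast
  then have "continuous_on \<Omega> (\<lambda>x. \<chi> k. act j x $ k)" by (intro continuous_on_vec_lambda)
  then show ?thesis by simp
qed

lemma open_act_vimage: "open V \<Longrightarrow> open {x \<in> \<Omega>. act j x \<in> V}"
  using continuous_open_preimage[OF continuous_act open_\<Omega>, of V j]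
  by (simp add: vimage_def Int_def)

lemma openin_Q: "openin Q W \<longleftrightarrow> W \<subseteq> q ` \<Omega> \<and> open {x \<in> \<Omega>. q x \<in> W}"
proof -
  have "openin (top_of_set \<Omega>) {x \<in> \<Omega>. q x \<in> W} \<longleftrightarrow> open {x \<in> \<Omega>. q x \<in> W}"
    using openin_open_eq[OF open_\<Omega>] by auto
  then show ?thesis by (simp add: Q_def openin_quotient_topology)
qed

lemma topspace_Q: "topspace Q = q ` \<Omega>"
proof
  show "topspace Q \<subseteq> q ` \<Omega>" using openin_Q[of "topspace Q"] by simp
  have "{x \<in> \<Omega>. q x \<in> q ` \<Omega>} = \<Omega>" by auto
  then have "openin Q (q ` \<Omega>)" by (simp add: openin_Q open_\<Omega>)
  then show "q ` \<Omega> \<subseteq> topspace Q" by (rule openin_subset)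
qed

lemma openin_q_image:
  assumes "open V" "V \<subseteq> \<Omega>"
  shows "openin Q (q ` V)"
proof -
  have "{x \<in> \<Omega>. q x \<in> q ` V} = (\<Union>j. {x \<in> \<Omega>. act j x \<in> V})"
  proof (intro equalityI subsetI)
    fix x assume "x \<in> {x \<in> \<Omega>. q x \<in> q ` V}"
    then obtain v where "x \<in> \<Omega>" "v \<in> V" "q x = q v" by auto
    then show "x \<in> (\<Union>j. {x \<in> \<Omega>. act j x \<in> V})" using assms q_eq[of x v] by auto
  next
    fix x assume "x \<in> (\<Union>j. {x \<in> \<Omega>. act j x \<in> V})"
    then show "x \<in> {x \<in> \<Omega>. q x \<in> q ` V}" using q_act by (auto simp: image_iff)
  qed
  then show ?thesis using assms open_act_vimage by (auto simp: openin_Q)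
qed

lemma continuous_q: "continuous_map (top_of_set \<Omega>) Q q"
  unfolding continuous_map_def
proof (intro conjI allI impI)
  fix U assume "openin Q U"
  then have "open {x \<in> \<Omega>. q x \<in> U}" by (simp add: openin_Q)
  then show "openin (top_of_set \<Omega>) {x \<in> topspace (top_of_set \<Omega>). q x \<in> U}"
    using openin_open_eq[OF open_\<Omega>] by auto
qed (auto simp: topspace_Q)

lemma open_map_q: "open_map (top_of_set \<Omega>) Q q"
  unfolding open_map_def using openin_q_image openin_open_eq[OF open_\<Omega>] by auto

text \<open>Radius 1 / 2 in the coordinate \<open>c0\<close>: two points of a slice differ there by
  less than 1, so no orbit meets it twice.\<close>

definition slice where "slice x = {y \<in> \<Omega>. cmod (y $ c0 - x $ c0) < 1 / 2}"

lemma open_slice: "open (slice x)"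
proof -
  have "slice x = \<Omega> \<inter> {y. cmod (y $ c0 - x $ c0) < 1 / 2}" by (auto simp: slice_def)
  moreover have "open {y :: complex^'n. cmod (y $ c0 - x $ c0) < 1 / 2}" by (intro open_Collect_less continuous_intros)
  ultimately show ?thesis using open_\<Omega> by auto
qed

lemma inj_slice: "inj_on q (slice x)"
proof (rule inj_onI)
  fix y z assume yz: "y \<in> slice x" "z \<in> slice x" "q y = q z"
  then obtain j where j: "z = act j y" using q_eq[of y z] by (auto simp: slice_def)
  have "cmod (of_int j) = cmod ((z $ c0 - x $ c0) - (y $ c0 - x $ c0))"
    using yz j by (simp add: act_c0 slice_def)
  also have "\<dots> \<le> cmod (z $ c0 - x $ c0) + cmod (y $ c0 - x $ c0)" by (rule norm_triangle_ineq4)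
  also have "\<dots> < 1" using yz by (simp add: slice_def)
  finally have "j = 0" by simp
  then show "y = z" using j yz by (simp add: act_0 slice_def)
qed

section \<open>The quotient as a complex manifold\<close>

definition E where "E = quotient_manifold \<Omega> act"

lemma fst_E: "fst E = Q"
  by (simp add: E_def quotient_manifold_def Q_def q_def)

lemma snd_E: "snd E = {(q ` V, inv_into V q) |V. open V \<and> V \<subseteq> \<Omega> \<and> inj_on q V}"
  by (simp add: E_def quotient_manifold_def q_def)

lemma inv_chart:
  assumes "inj_on q V" "v \<in> V"
  shows "inv_into (q ` V) (inv_into V q) v = q v"
proof -
  have "inj_on (inv_into V q) (q ` V)" by (rule inj_on_inv_into) simp
  then have "inv_into (q ` V) (inv_into V q) (inv_into V q (q v)) = q v"
    using assms by (intro inv_into_f_f) auto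
  then show ?thesis using assms by simp
qed

lemma chart_image: "inj_on q V \<Longrightarrow> inv_into V q ` q ` V = V"
  by (simp add: image_image)

text \<open>Each slice gives a chart whose inverse is \<open>q\<close> itself, so holomorphy on the
  quotient is holomorphy of the lift.\<close>

lemma holomorphic_functions_E: "holomorphic_functions E = {f. cholomorphic_on (f \<circ> q) \<Omega>}"
proof (intro equalityI subsetI CollectI)
  fix f assume f: "f \<in> holomorphic_functions E"
  show "cholomorphic_on (f \<circ> q) \<Omega>"
  proof (rule cholomorphic_on_local)
    fix x assume x: "x \<in> \<Omega>"
    let ?V = "slice x"
    have V: "open ?V" "?V \<subseteq> \<Omega>" "inj_on q ?V" "x \<in> ?V"
      using open_slice inj_slice x by (auto simp: slice_def)
    then have "(q ` ?V, inv_into ?V q) \<in> snd E" unfolding snd_E by blast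
    with f have "cholomorphic_on (f \<circ> inv_into (q ` ?V) (inv_into ?V q)) (inv_into ?V q ` q ` ?V)"
      unfolding holomorphic_functions_def by (cases E) (auto simp: case_prod_unfold)
    then have "cholomorphic_on (f \<circ> inv_into (q ` ?V) (inv_into ?V q)) ?V" using chart_image[OF V(3)] by simp
    moreover have "\<forall>y\<in>?V. (f \<circ> q) y = (f \<circ> inv_into (q ` ?V) (inv_into ?V q)) y"
      using inv_chart[OF V(3)] by simp
    ultimately show "\<exists>N g E. open N \<and> x \<in> N \<and> x \<in> E \<and> cholomorphic_on g E \<and> (\<forall>y\<in>N. (f \<circ> q) y = g y)"
      using V by (intro exI[of _ ?V] exI[of _ "f \<circ> inv_into (q ` ?V) (inv_into ?V q)"]) auto
  qed
next
  fix f assume "f \<in> {f. cholomorphic_on (f \<circ> q) \<Omega>}"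
  then have f: "cholomorphic_on (f \<circ> q) \<Omega>" by simp
  have "cholomorphic_on (f \<circ> inv_into (q ` V) (inv_into V q)) (inv_into V q ` q ` V)"
    if V: "open V" "V \<subseteq> \<Omega>" "inj_on q V" for V
    unfolding chart_image[OF V(3)]
  proof (rule cholomorphic_on_local)
    fix z assume z: "z \<in> V"
    show "\<exists>N g E. open N \<and> z \<in> N \<and> z \<in> E \<and> cholomorphic_on g E \<and> (\<forall>y\<in>N. (f \<circ> inv_into (q ` V) (inv_into V q)) y = g y)"
      using V z f inv_chart[OF V(3)] by (intro exI[of _ V] exI[of _ "f \<circ> q"] exI[of _ \<Omega>]) auto
  qed
  then show "f \<in> holomorphic_functions E"
    using snd_E unfolding holomorphic_functions_def by (cases E) auto
qed

text \<open>Points of the slices at x and y can be related only by those j that bring x within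
  distance 1 of y in the coordinate \<open>c0\<close>. These are finitely many, and each is excluded
  by separating \<open>act j x\<close> from y.\<close>

lemma Hausdorff_Q: "Hausdorff_space Q"
  unfolding Hausdorff_space_def
proof (intro allI impI, elim conjE)
  fix X Y assume XY: "X \<in> topspace Q" "Y \<in> topspace Q" "X \<noteq> Y"
  then obtain x y where x: "x \<in> \<Omega>" "X = q x" and y: "y \<in> \<Omega>" "Y = q y" by (auto simp: topspace_Q)
  define J where "J = {j :: int. cmod (x $ c0 + of_int j - y $ c0) < 1}"
  have fJ: "finite J"
  proof (rule finite_subset)
    show "J \<subseteq> {\<lfloor>Re (y $ c0 - x $ c0)\<rfloor> - 1..\<lceil>Re (y $ c0 - x $ c0)\<rceil> + 1}"
    proof
      fix j assume "j \<in> J"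
      then have "\<bar>Re (x $ c0 + of_int j - y $ c0)\<bar> < 1"
        using abs_Re_le_cmod[of "x $ c0 + of_int j - y $ c0"] by (simp add: J_def)
      then have "\<bar>of_int j - Re (y $ c0 - x $ c0)\<bar> < 1" by (simp add: algebra_simps)
      then show "j \<in> {\<lfloor>Re (y $ c0 - x $ c0)\<rfloor> - 1..\<lceil>Re (y $ c0 - x $ c0)\<rceil> + 1}" by auto linarith+
    qed
  qed simp
  have "\<exists>P R. open P \<and> open R \<and> act j x \<in> P \<and> y \<in> R \<and> P \<inter> R = {}" for j
  proof -
    have "act j x \<noteq> y" using XY(3) x y q_act by metis
    then show ?thesis by (rule hausdorff)
  qed
  then obtain P R where PR: "\<And>j. open (P j)" "\<And>j. open (R j)" "\<And>j. act j x \<in> P j" "\<And>j. y \<in> R j" "\<And>j. P j \<inter> R j = {}"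
    by metis
  define U where "U = \<Omega> \<inter> (\<Inter>j\<in>J. {z \<in> \<Omega>. act j z \<in> P j}) \<inter> slice x"
  define V where "V = (\<Inter>j\<in>J. R j) \<inter> slice y"
  have oU: "open U" unfolding U_def
  proof (intro open_Int open_\<Omega> open_slice)
    show "open (\<Inter>j\<in>J. {z \<in> \<Omega>. act j z \<in> P j})"
      by (rule open_INT[OF fJ]) (auto intro: open_act_vimage PR)
  qed
  have oV: "open V" unfolding V_def
    by (intro open_Int open_slice open_INT[OF fJ]) (auto simp: PR)
  have sub: "U \<subseteq> \<Omega>" "V \<subseteq> \<Omega>" by (auto simp: U_def V_def slice_def)
  have xU: "x \<in> U" and yV: "y \<in> V" using x y PR by (auto simp: U_def V_def slice_def)
  have "disjnt (q ` U) (q ` V)"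
    unfolding disjnt_iff
  proof (intro allI notI)
    fix Z assume "Z \<in> q ` U \<and> Z \<in> q ` V"
    then obtain u v where u: "u \<in> U" "Z = q u" and v: "v \<in> V" "Z = q v" by auto
    then have "q u = q v" by simp
    then obtain j where j: "v = act j u" using q_eq[of u v] u(1) v(1) sub by auto
    have "v $ c0 = u $ c0 + of_int j" using j u(1) sub by (auto simp: act_c0)
    then have "x $ c0 + of_int j - y $ c0 = (v $ c0 - y $ c0) - (u $ c0 - x $ c0)" by simp
    then have "cmod (x $ c0 + of_int j - y $ c0) \<le> cmod (v $ c0 - y $ c0) + cmod (u $ c0 - x $ c0)"
      by (simp only: norm_triangle_ineq4)
    also have "\<dots> < 1" using u(1) v(1) by (simp add: U_def V_def slice_def)
    finally have "j \<in> J" by (simp add: J_def)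
    then have "v \<in> P j" "v \<in> R j" using u(1) v(1) j by (auto simp: U_def V_def)
    then show False using PR(5) by blast
  qed
  then show "\<exists>U V. openin Q U \<and> openin Q V \<and> X \<in> U \<and> Y \<in> V \<and> disjnt U V"
    using openin_q_image[OF oU sub(1)] openin_q_image[OF oV sub(2)] xU yV x y by blast
qed

lemma chart_E:
  assumes V: "open V" "V \<subseteq> \<Omega>" "inj_on q V"
  shows "is_chart Q (q ` V, inv_into V q)"
proof -
  have oV: "openin Q (q ` V)" by (rule openin_q_image[OF V(1,2)])
  have tV: "topspace (subtopology Q (q ` V)) = q ` V"
    using openin_subset[OF oV] by (simp add: topspace_subtopology Int_absorb1)
  have "homeomorphic_maps (subtopology Q (q ` V)) (top_of_set V) (inv_into V q) q"
    unfolding homeomorphic_maps_def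
  proof (intro conjI ballI)
    show "continuous_map (subtopology Q (q ` V)) (top_of_set V) (inv_into V q)"
      unfolding continuous_map_def tV
    proof (intro conjI allI impI)
      show "inv_into V q \<in> q ` V \<rightarrow> topspace (top_of_set V)" using V(3) by auto
      fix W assume "openin (top_of_set V) W"
      then have W: "open W" "W \<subseteq> V" using openin_open_eq[OF V(1)] by auto
      have "{x \<in> q ` V. inv_into V q x \<in> W} = q ` W" using V(3) W(2) by auto
      moreover have "openin Q (q ` W)" using W V by (intro openin_q_image) auto
      ultimately show "openin (subtopology Q (q ` V)) {x \<in> q ` V. inv_into V q x \<in> W}"
        using W(2) by (auto simp: openin_subtopology intro!: exI[of _ "q ` W"])
    qed
    have "continuous_map (subtopology (top_of_set \<Omega>) V) Q q"
      using continuous_q by (rule continuous_map_from_subtopology)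
    then show "continuous_map (top_of_set V) (subtopology Q (q ` V)) q"
      using V(2) by (auto simp: continuous_map_in_subtopology subtopology_subtopology Int_absorb1)
  qed (use V(3) tV in auto)
  then show ?thesis
    unfolding is_chart_def using oV V(1) chart_image[OF V(3)] by (auto simp: homeomorphic_map_maps)
qed

text \<open>Two lifts of a point of the quotient differ by some \<open>act j\<close>, and the same j
  works nearby.\<close>

lemma transition_E:
  assumes V: "open V" "V \<subseteq> \<Omega>" "inj_on q V" and V': "open V'" "V' \<subseteq> \<Omega>" "inj_on q V'"
  shows "cholomorphic_map_on (inv_into V' q \<circ> inv_into (q ` V) (inv_into V q)) (inv_into V q ` (q ` V \<inter> q ` V'))"
  unfolding cholomorphic_map_on_def
proof (intro allI cholomorphic_on_local)
  fix i z assume "z \<in> inv_into V q ` (q ` V \<inter> q ` V')"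
  then obtain X where X: "X \<in> q ` V" "X \<in> q ` V'" "z = inv_into V q X" by blast
  then have z: "z \<in> V" "q z \<in> q ` V'" using V(3) by (auto simp: inv_into_into f_inv_into_f)
  then obtain z' where z': "z' \<in> V'" "q z = q z'" by auto
  then obtain j where j: "z' = act j z" using q_eq[of z z'] z V(2) V'(2) by auto
  let ?N = "V \<inter> {y \<in> \<Omega>. act j y \<in> V'}"
  have "(inv_into V' q \<circ> inv_into (q ` V) (inv_into V q)) y $ i = act j y $ i" if "y \<in> ?N" for y
  proof -
    have "q y = q (act j y)" using that by (simp add: q_act)
    then have "inv_into V' q (q y) = act j y" using that V'(3) by simp
    then show ?thesis using that by (simp add: inv_chart[OF V(3)])
  qed
  moreover have "open ?N" using V(1) V'(1) open_act_vimage by auto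
  moreover have "cholomorphic_on (\<lambda>y. act j y $ i) \<Omega>" using act_hol by (simp add: cholomorphic_map_on_def)
  ultimately show "\<exists>N g E. open N \<and> z \<in> N \<and> z \<in> E \<and> cholomorphic_on g E \<and>
      (\<forall>y\<in>N. (inv_into V' q \<circ> inv_into (q ` V) (inv_into V q)) y $ i = g y)"
    using z z' j V by (intro exI[of _ ?N] exI[of _ "\<lambda>y. act j y $ i"] exI[of _ \<Omega>]) auto
qed

theorem complex_manifold_E: "complex_manifold E"
proof -
  obtain \<B> :: "(complex^'n) set set" where \<B>: "countable \<B>" "\<And>C. C \<in> \<B> \<Longrightarrow> open C"
      "\<And>S. open S \<Longrightarrow> \<exists>U. U \<subseteq> \<B> \<and> S = \<Union>U"
    using univ_second_countable by blast
  have "second_countable (euclidean :: (complex^'n) topology)"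
    unfolding second_countable_def
  proof (intro exI[of _ \<B>] conjI allI impI ballI)
    fix U x assume "openin euclidean U \<and> (x :: complex^'n) \<in> U"
    then have U: "open U" "x \<in> U" by auto
    then obtain V where "V \<subseteq> \<B>" "U = \<Union>V" using \<B>(3) by blast
    then show "\<exists>V\<in>\<B>. x \<in> V \<and> V \<subseteq> U" using U(2) by blast
  qed (use \<B> in auto)
  then have "second_countable (top_of_set \<Omega>)" by (rule second_countable_subtopology)
  then have sc: "second_countable Q"
    by (rule second_countable_open_map_image[OF continuous_q open_map_q, rotated]) (simp add: topspace_Q)
  have un: "(\<Union>(U, \<phi>)\<in>snd E. U) = q ` \<Omega>"
  proof
    show "(\<Union>(U, \<phi>)\<in>snd E. U) \<subseteq> q ` \<Omega>" unfolding snd_E by auto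
    show "q ` \<Omega> \<subseteq> (\<Union>(U, \<phi>)\<in>snd E. U)"
    proof
      fix X assume "X \<in> q ` \<Omega>"
      then obtain x where x: "x \<in> \<Omega>" "X = q x" by auto
      have "(q ` slice x, inv_into (slice x) q) \<in> snd E"
        unfolding snd_E by (intro CollectI exI[of _ "slice x"] conjI refl open_slice inj_slice) (simp add: slice_def)
      moreover have "X \<in> q ` slice x" using x by (auto simp: slice_def)
      ultimately show "X \<in> (\<Union>(U, \<phi>)\<in>snd E. U)"
        by (intro UN_I[of "(q ` slice x, inv_into (slice x) q)"]) auto
    qed
  qed
  have "complex_manifold (Q, snd E)"
    unfolding complex_manifold_def prod.case
  proof (intro conjI Hausdorff_Q sc)
    show "\<forall>c\<in>snd E. is_chart Q c" unfolding snd_E using chart_E by auto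
    show "(\<Union>(U, \<phi>)\<in>snd E. U) = topspace Q" using un by (simp add: topspace_Q)
    show "\<forall>(U, \<phi>)\<in>snd E. \<forall>(V, \<psi>)\<in>snd E. cholomorphic_map_on (\<psi> \<circ> inv_into U \<phi>) (\<phi> ` (U \<inter> V))"
      unfolding snd_E using transition_E by auto
  qed
  then show ?thesis by (metis fst_E prod.collapse)
qed

lemma compactin_q_image: "compact C \<Longrightarrow> C \<subseteq> \<Omega> \<Longrightarrow> compactin Q (q ` C)"
  using image_compactin[OF _ continuous_q, of C] by (simp add: compactin_subtopology)

lemma continuous_map_hol:
  assumes "cholomorphic_on (f \<circ> q) \<Omega>"
  shows "continuous_map Q euclidean f"
  unfolding continuous_map_def
proof (intro conjI allI impI)
  fix U :: "complex set" assume "openin euclidean U"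
  then have "open {x \<in> \<Omega>. (f \<circ> q) x \<in> U}"
    using continuous_open_preimage[OF cholomorphic_on_imp_continuous[OF assms] open_\<Omega>, of U]
    by (simp add: vimage_def Int_def)
  moreover have "{x \<in> \<Omega>. (f \<circ> q) x \<in> U} = {x \<in> \<Omega>. q x \<in> {X \<in> q ` \<Omega>. f X \<in> U}}" by auto
  ultimately show "openin Q {X \<in> topspace Q. f X \<in> U}" by (auto simp: openin_Q topspace_Q)
qed auto

lemma closedin_hull: "closedin Q (holomorphic_hull E K)"
proof -
  have "holomorphic_hull E K = topspace Q \<inter> (\<Inter>f\<in>holomorphic_functions E. {X \<in> topspace Q. cmod (f X) \<in> {..SUP y\<in>K. cmod (f y)}})"
    by (auto simp: holomorphic_hull_def fst_E)
  also have "closedin Q \<dots>"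
  proof (rule closedin_Int[OF closedin_topspace])
    show "closedin Q (\<Inter>f\<in>holomorphic_functions E. {X \<in> topspace Q. cmod (f X) \<in> {..SUP y\<in>K. cmod (f y)}})"
    proof (rule closedin_INT)
      show "holomorphic_functions E \<noteq> {}"
        unfolding holomorphic_functions_E
        by (auto simp: cholomorphic_on_def o_def intro!: exI[of _ "\<lambda>_. 0"] exI[of _ 0])
      fix f assume "f \<in> holomorphic_functions E"
      then have "continuous_map Q euclidean (\<lambda>x. cmod (f x))"
        using continuous_map_hol by (auto simp: holomorphic_functions_E intro: continuous_map_norm)
      then show "closedin Q {X \<in> topspace Q. cmod (f X) \<in> {..SUP y\<in>K. cmod (f y)}}"
        by (rule closedin_continuous_map_preimage) simp
    qed
  qed
  finally show ?thesis .
qed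

text \<open>Images of open balls whose closed balls stay in \<Omega> cover the quotient; finitely
  many suffice, and their closed balls form the lift.\<close>

lemma compactin_cover:
  assumes K: "compactin Q K"
  shows "\<exists>C. compact C \<and> C \<subseteq> \<Omega> \<and> K \<subseteq> q ` C"
proof -
  define \<U> where "\<U> = {q ` ball x e |x e. cball x e \<subseteq> \<Omega>}"
  have o: "\<And>U. U \<in> \<U> \<Longrightarrow> openin Q U"
    unfolding \<U>_def using openin_q_image ball_subset_cball by (auto intro!: openin_q_image dest: subsetD[OF ball_subset_cball])
  have "topspace Q \<subseteq> \<Union> \<U>"
  proof
    fix X assume "X \<in> topspace Q"
    then obtain x where x: "x \<in> \<Omega>" "X = q x" by (auto simp: topspace_Q)
    then obtain e where "e > 0" "cball x e \<subseteq> \<Omega>" using open_\<Omega> open_contains_cball by blast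
    then have "q ` ball x e \<in> \<U>" "X \<in> q ` ball x e" using x by (auto simp: \<U>_def)
    then show "X \<in> \<Union> \<U>" by blast
  qed
  then have "K \<subseteq> \<Union> \<U>" using compactin_subset_topspace[OF K] by blast
  then have "\<exists>\<F>. finite \<F> \<and> \<F> \<subseteq> \<U> \<and> K \<subseteq> \<Union> \<F>"
    using K o unfolding compactin_def by simp
  then obtain \<F> where F: "finite \<F>" "\<F> \<subseteq> \<U>" "K \<subseteq> \<Union> \<F>" by (elim exE conjE)
  have "\<forall>U\<in>\<F>. \<exists>C. compact C \<and> C \<subseteq> \<Omega> \<and> U \<subseteq> q ` C"
  proof
    fix U assume "U \<in> \<F>"
    then obtain x e where "U = q ` ball x e" "cball x e \<subseteq> \<Omega>" using F(2) by (auto simp: \<U>_def)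
    then show "\<exists>C. compact C \<and> C \<subseteq> \<Omega> \<and> U \<subseteq> q ` C"
      by (intro exI[of _ "cball x e"]) (auto intro: subsetD[OF ball_subset_cball])
  qed
  then obtain C where C: "\<And>U. U \<in> \<F> \<Longrightarrow> compact (C U) \<and> C U \<subseteq> \<Omega> \<and> U \<subseteq> q ` C U" by metis
  show ?thesis
    using F C by (intro exI[of _ "\<Union>U\<in>\<F>. C U"]) (auto intro!: compact_UN, blast)
qed

end

section \<open>Monomial maps\<close>

definition imat :: "int^'d^'d \<Rightarrow> ('a::comm_ring_1)^'d^'d"
  where "imat A = (\<chi> i j. of_int (A $ i $ j))"

lemma imat_mult: "imat (A ** C) = imat A ** imat C"
  by (simp add: imat_def matrix_matrix_mult_def vec_eq_iff)

lemma imat_one: "imat (mat 1) = mat 1"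
  by (simp add: imat_def mat_def vec_eq_iff)

lemma cmat_imat: "cmat (imat A) = imat A"
  by (simp add: imat_def cmat_def vec_eq_iff)

lemma ip_vmat: "ip (\<alpha> v* A) u = ip \<alpha> (imat A *v u)"
proof -
  have "ip (\<alpha> v* A) u = (\<Sum>j\<in>UNIV. \<Sum>i\<in>UNIV. of_int (A $ i $ j) * of_int (\<alpha> $ i) * u $ j)"
    by (simp add: ip_def vector_matrix_mult_def sum_distrib_left sum_distrib_right mult_ac)
  also have "\<dots> = (\<Sum>i\<in>UNIV. \<Sum>j\<in>UNIV. of_int (A $ i $ j) * of_int (\<alpha> $ i) * u $ j)" by (rule sum.swap)
  also have "\<dots> = ip \<alpha> (imat A *v u)"
    by (simp add: ip_def imat_def matrix_vector_mult_def sum_distrib_left mult_ac)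
  finally show ?thesis .
qed

lemma vmat_assoc: "\<alpha> v* A v* C = \<alpha> v* (A ** C)"
  for A C :: "int^'d^'d"
  by (rule vector_matrix_mul_assoc)

lemma monomial_map_nth: "monomial_map A z $ i = lmono (A $ i) z"
  by (simp add: monomial_map_def lmono_def)

lemma lmono_nz: "z \<in> ctorus \<Longrightarrow> lmono \<alpha> z \<noteq> 0"
  by (simp add: lmono_def ctorus_def)

lemma monomial_map_in_ctorus: "z \<in> ctorus \<Longrightarrow> monomial_map A z \<in> ctorus"
  using lmono_nz[of z] by (simp add: monomial_map_nth ctorus_def)

lemma lmono_sum:
  assumes "z \<in> ctorus" "finite S"
  shows "lmono (\<Sum>i\<in>S. f i) z = (\<Prod>i\<in>S. lmono (f i) z)"
  using assms(2)
proof induction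
  case (insert a S)
  then show ?case using lmono_add[of z "f a" "sum f S"] assms(1) by (simp add: ctorus_def)
qed simp

lemma lmono_scale: "lmono (n *s \<alpha>) z = lmono \<alpha> z powi n"
proof -
  have "(\<Prod>k\<in>S. f k) powi n = (\<Prod>k\<in>S. f k powi n)" if "finite S" for S and f :: "'a \<Rightarrow> complex"
    using that by induction (auto simp: power_int_mult_distrib)
  then show ?thesis
    by (simp add: lmono_def mult.commute[of n] flip: power_int_mult)
qed

lemma lmono_monomial_map:
  fixes z :: "complex^'d"
  assumes "z \<in> ctorus"
  shows "lmono \<alpha> (monomial_map A z) = lmono (\<alpha> v* A) z"
proof -
  have "\<alpha> v* A = (\<Sum>i\<in>UNIV. (\<alpha> $ i) *s (A $ i))"
    by (simp add: vector_matrix_mult_def vec_eq_iff mult.commute)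
  then have "lmono (\<alpha> v* A) z = (\<Prod>i\<in>UNIV. lmono ((\<alpha> $ i) *s (A $ i)) z)"
    by (simp add: lmono_sum[OF assms])
  also have "\<dots> = lmono \<alpha> (monomial_map A z)"
    by (simp add: lmono_scale lmono_def[of \<alpha>] monomial_map_nth)
  finally show ?thesis by simp
qed

lemma monomial_map_mult:
  assumes "z \<in> ctorus"
  shows "monomial_map (A ** C) z = monomial_map A (monomial_map C z)"
proof -
  have "(A ** C) $ i = A $ i v* C" for i
    by (simp add: matrix_matrix_mult_def vector_matrix_mult_def vec_eq_iff mult.commute)
  then show ?thesis
    by (intro vec_eq_iff[THEN iffD2] allI) (simp add: monomial_map_nth lmono_monomial_map[OF assms])
qed

lemma monomial_map_one:
  fixes z :: "complex^'d"
  shows "monomial_map (mat 1) z = z"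
proof -
  have "(mat 1 :: int^'d^'d) $ i = axis i 1" for i by (simp add: mat_def axis_def vec_eq_iff)
  then show ?thesis by (intro vec_eq_iff[THEN iffD2] allI) (simp add: monomial_map_nth lmono_axis)
qed

lemma norm_lmono: "z \<in> ctorus \<Longrightarrow> cmod (lmono \<alpha> z) = exp (ip \<alpha> (lgv z))"
proof -
  assume z: "z \<in> ctorus"
  have "exp (of_int n * ln a) = a powi n" if "a > 0" for a :: real and n
    using that by (metis exp_ln exp_power_int mult.commute)
  then show ?thesis using z
    by (simp add: lmono_def ip_def lgv_def ctorus_def exp_sum prod_norm [symmetric] norm_power_int)
qed

lemma lgv_monomial_map:
  assumes "z \<in> ctorus"
  shows "lgv (monomial_map A z) = imat A *v lgv z"
proof -
  have "ip (A $ i) (lgv z) = (imat A *v lgv z) $ i" for i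
    by (simp add: ip_def imat_def matrix_vector_mult_def)
  then show ?thesis
    by (simp add: vec_eq_iff norm_lmono[OF assms] monomial_map_nth lgv_def[of "monomial_map A z"])
qed

lemma monomial_map_torus: "u \<in> torus \<Longrightarrow> monomial_map A u \<in> torus"
  by (simp add: torus_def monomial_map_nth norm_lmono_torus)

lemma monomial_map_rx:
  fixes x :: "real^'d"
  shows "monomial_map A (rx x * u) = rx (imat A *v x) * monomial_map A u"
proof -
  have "lmono \<alpha> (rx x) = of_real (exp (ip \<alpha> x))" for \<alpha> :: "int^'d" and x :: "real^'d"
    by (simp add: lmono_def rx_def ip_def exp_sum exp_power_int mult.commute flip: of_real_power_int of_real_prod)
  moreover have "ip (A $ i) x = (imat A *v x) $ i" for i
    by (simp add: ip_def imat_def matrix_vector_mult_def)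
  ultimately show ?thesis
    by (intro vec_eq_iff[THEN iffD2] allI) (simp add: monomial_map_nth lmono_mult rx_def[of "imat A *v x"])
qed

text \<open>The series of F1 is pulled back term by term and reindexed by the bijection of
  exponents. Uniqueness of coefficients identifies it with the series of F0, which avoids a change
  of variables in the torus integral.\<close>

lemma fc_matrix:
  fixes A A' :: "int^'d^'d"
  assumes A: "A ** A' = mat 1" "A' ** A = mat 1"
    and B: "open B" "connected B" and F: "rhol B F1" "imat A *v x \<in> B"
    and eq: "\<And>u. u \<in> torus \<Longrightarrow> F1 (monomial_map A (rx x * u)) = F0 (rx x * u)"
  shows "fc F1 \<alpha> (imat A *v x) = fc F0 (\<alpha> v* A) x"
proof -
  let ?c = "\<lambda>\<alpha>. fc F1 \<alpha> (imat A *v x)"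
  have b: "bij_betw (\<lambda>\<beta>. \<beta> v* A') UNIV UNIV"
    by (rule bij_betwI[of _ _ _ "\<lambda>\<beta>. \<beta> v* A"]) (auto simp: vmat_assoc A)
  have s: "(\<lambda>\<beta>. cmod (?c (\<beta> v* A'))) summable_on UNIV"
    using summable_on_reindex_bij_betw[OF b, of "\<lambda>\<alpha>. cmod (?c \<alpha>)"] laurent_expansion(1)[OF B F] by simp
  have h: "((\<lambda>\<beta>. ?c (\<beta> v* A') * lmono \<beta> u) has_sum F0 (rx x * u)) UNIV" if u: "u \<in> torus" for u
  proof -
    have "((\<lambda>\<alpha>. ?c \<alpha> * lmono \<alpha> (monomial_map A u)) has_sum F1 (rx (imat A *v x) * monomial_map A u)) UNIV"
      by (rule laurent_expansion(2)[OF B F monomial_map_torus[OF u]])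
    then have "((\<lambda>\<alpha>. ?c \<alpha> * lmono (\<alpha> v* A) u) has_sum F0 (rx x * u)) UNIV"
      using eq[OF u] by (simp add: monomial_map_rx lmono_monomial_map torus_in_ctorus[OF u])
    then have "((\<lambda>\<beta>. ?c (\<beta> v* A') * lmono (\<beta> v* A' v* A) u) has_sum F0 (rx x * u)) UNIV"
      by (subst has_sum_reindex_bij_betw[OF b, of "\<lambda>\<alpha>. ?c \<alpha> * lmono (\<alpha> v* A) u"])
    then show ?thesis by (simp add: vmat_assoc A)
  qed
  have "fc F0 (\<alpha> v* A) x = ?c (\<alpha> v* A v* A')"
    unfolding fc_def[of F0] by (rule tmean_has_sum(2)[OF s h])
  then show ?thesis by (simp add: vmat_assoc A)
qed

section \<open>Integer powers of the matrix and of the monomial map\<close>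

definition mpow :: "int^'d^'d \<Rightarrow> nat \<Rightarrow> int^'d^'d"
  where "mpow A n = ((**) A ^^ n) (mat 1)"

definition zmat :: "int^'d^'d \<Rightarrow> int \<Rightarrow> int^'d^'d"
  where "zmat M j = (if 0 \<le> j then mpow M (nat j) else mpow (matrix_inv M) (nat (- j)))"

lemma int_matrix_inv:
  fixes M :: "int^'d^'d"
  assumes "invertible M"
  shows "M ** matrix_inv M = mat 1" "matrix_inv M ** M = mat 1"
  using someI_ex[OF assms[unfolded invertible_def]] by (auto simp: matrix_inv_def)

lemma mpow_0 [simp]: "mpow A 0 = mat 1"
  and mpow_Suc [simp]: "mpow A (Suc n) = A ** mpow A n"
  by (simp_all add: mpow_def)

lemma zmat_Suc:
  assumes "invertible M"
  shows "zmat M (j + 1) = M ** zmat M j"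
proof (cases "j \<ge> 0")
  case True
  then show ?thesis by (simp add: zmat_def nat_add_distrib)
next
  case False
  define n where "n = nat (- j - 1)"
  have "nat (- j) = Suc n" "nat (- (j + 1)) = n" using False by (auto simp: n_def)
  moreover have "zmat M (j + 1) = mpow (matrix_inv M) n"
    using False calculation by (cases "j = -1") (auto simp: zmat_def)
  ultimately show ?thesis
    using False int_matrix_inv[OF assms] by (simp add: zmat_def matrix_mul_assoc)
qed

lemma zmat_add:
  assumes "invertible M"
  shows "zmat M (i + j) = zmat M i ** zmat M j"
proof (induction i rule: int_induct[of _ 0])
  case base
  then show ?case by (simp add: zmat_def)
next
  case (step1 i)
  then show ?case
    using zmat_Suc[OF assms, of "i + j"] zmat_Suc[OF assms, of i] by (simp add: matrix_mul_assoc add_ac)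
next
  case (step2 i)
  have "M ** zmat M (i - 1 + j) = M ** (zmat M (i - 1) ** zmat M j)"
    using step2 zmat_Suc[OF assms, of "i - 1 + j"] zmat_Suc[OF assms, of "i - 1"]
    by (simp add: matrix_mul_assoc algebra_simps)
  then have "matrix_inv M ** (M ** zmat M (i - 1 + j)) = matrix_inv M ** (M ** (zmat M (i - 1) ** zmat M j))" by simp
  then show ?case
    by (simp only: matrix_mul_assoc int_matrix_inv[OF assms] matrix_mul_lid)
qed

lemma zmat_0 [simp]: "zmat M 0 = mat 1"
  by (simp add: zmat_def)

lemma zmat_inverse:
  assumes "invertible M"
  shows "zmat M j ** zmat M (- j) = mat 1" "zmat M (- j) ** zmat M j = mat 1"
  using zmat_add[OF assms, of j "- j"] zmat_add[OF assms, of "- j" j] by simp_all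

lemma imat_mpow: "imat (mpow A n) *v x = ((*v) (imat A) ^^ n) x"
  by (induction n) (auto simp: imat_one imat_mult matrix_vector_mul_assoc [symmetric])

text \<open>\<open>monomial_action\<close> inverts the monomial map on \<open>ctorus\<close>, where
  the inverse matrix provides the inverse.\<close>

lemma monomial_action_eq:
  assumes M: "invertible M" and z: "z \<in> ctorus"
  shows "monomial_action M j z = monomial_map (zmat M j) z"
proof -
  have inj: "inj_on (monomial_map M) ctorus"
  proof (rule inj_on_inverseI)
    fix z :: "complex^'a" assume "z \<in> ctorus"
    then show "monomial_map (matrix_inv M) (monomial_map M z) = z"
      using monomial_map_mult[of z "matrix_inv M" M] int_matrix_inv[OF M] by (simp add: monomial_map_one)
  qed
  have inv: "inv_into ctorus (monomial_map M) z = monomial_map (matrix_inv M) z" if "z \<in> ctorus" for z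
  proof (rule inv_into_f_eq[OF inj])
    show "monomial_map M (monomial_map (matrix_inv M) z) = z"
      using monomial_map_mult[OF that, of M "matrix_inv M"] int_matrix_inv[OF M] by (simp add: monomial_map_one)
  qed (rule monomial_map_in_ctorus[OF that])
  have p: "(f ^^ n) z = monomial_map (mpow A n) z"
    if "\<And>z. z \<in> ctorus \<Longrightarrow> f z = monomial_map A z" for f A n
    using z by (induction n) (auto simp: monomial_map_one monomial_map_mult that monomial_map_in_ctorus)
  show ?thesis
    using p[of "monomial_map M" M] p[of "inv_into ctorus (monomial_map M)" "matrix_inv M"] inv
    by (simp add: monomial_action_def zmat_def)
qed

section \<open>Closure properties of holomorphic functions\<close>

lemma cholo_const: "cholomorphic_on (\<lambda>x. c) D"
  unfolding cholomorphic_on_def by (intro ballI exI[of _ 0]) simp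

lemma cholo_nth: "cholomorphic_on (\<lambda>x. x $ k) D"
  unfolding cholomorphic_on_def
proof
  fix z
  have "(\<lambda>h. \<Sum>i\<in>UNIV. axis k 1 $ i * h $ i) = (\<lambda>h :: complex^'a. h $ k)"
    by (simp add: axis_def mult_delta_left)
  moreover have "((\<lambda>x :: complex^'a. x $ k) has_derivative (\<lambda>h. h $ k)) (at z)"
    by (rule bounded_linear.has_derivative[OF bounded_linear_vec_nth has_derivative_ident])
  ultimately show "\<exists>a. ((\<lambda>x. x $ k) has_derivative (\<lambda>h. \<Sum>i\<in>UNIV. a $ i * h $ i)) (at z)"
    by metis
qed

lemma cholo_add:
  assumes "cholomorphic_on f D" "cholomorphic_on g D"
  shows "cholomorphic_on (\<lambda>x. f x + g x) D"
  unfolding cholomorphic_on_def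
proof
  fix z assume "z \<in> D"
  then obtain a b where "(f has_derivative (\<lambda>h. \<Sum>i\<in>UNIV. a $ i * h $ i)) (at z)"
      "(g has_derivative (\<lambda>h. \<Sum>i\<in>UNIV. b $ i * h $ i)) (at z)"
    using assms unfolding cholomorphic_on_def by blast
  from has_derivative_add[OF this]
  show "\<exists>a. ((\<lambda>x. f x + g x) has_derivative (\<lambda>h. \<Sum>i\<in>UNIV. a $ i * h $ i)) (at z)"
    by (intro exI[of _ "a + b"]) (simp add: sum.distrib distrib_right)
qed

lemma cholo_mult:
  assumes "cholomorphic_on f D" "cholomorphic_on g D"
  shows "cholomorphic_on (\<lambda>x. f x * g x) D"
  unfolding cholomorphic_on_def
proof
  fix z assume "z \<in> D"
  then obtain a b where "(f has_derivative (\<lambda>h. \<Sum>i\<in>UNIV. a $ i * h $ i)) (at z)"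
      "(g has_derivative (\<lambda>h. \<Sum>i\<in>UNIV. b $ i * h $ i)) (at z)"
    using assms unfolding cholomorphic_on_def by blast
  from has_derivative_mult[OF this]
  show "\<exists>a. ((\<lambda>x. f x * g x) has_derivative (\<lambda>h. \<Sum>i\<in>UNIV. a $ i * h $ i)) (at z)"
    by (intro exI[of _ "\<chi> i. f z * b $ i + a $ i * g z"])
      (simp add: sum.distrib sum_distrib_left sum_distrib_right algebra_simps)
qed

lemma cholo_compose:
  assumes f: "cholomorphic_on f D" and g: "g holomorphic_on S" "open S" and S: "\<And>x. x \<in> D \<Longrightarrow> f x \<in> S"
  shows "cholomorphic_on (\<lambda>x. g (f x)) D"
  unfolding cholomorphic_on_def
proof
  fix z assume z: "z \<in> D"
  then obtain a where a: "(f has_derivative (\<lambda>h. \<Sum>i\<in>UNIV. a $ i * h $ i)) (at z)"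
    using f unfolding cholomorphic_on_def by blast
  obtain d where "(g has_field_derivative d) (at (f z))"
    using g S[OF z] holomorphic_on_imp_differentiable_at field_differentiable_def by blast
  then have "(g has_derivative (*) d) (at (f z))" by (simp add: has_field_derivative_def)
  from has_derivative_compose[OF a this]
  show "\<exists>a. ((\<lambda>x. g (f x)) has_derivative (\<lambda>h. \<Sum>i\<in>UNIV. a $ i * h $ i)) (at z)"
    by (intro exI[of _ "d *s a"]) (simp add: sum_distrib_left mult.assoc)
qed

lemma cholo_prod:
  assumes "finite S" "\<And>i. i \<in> S \<Longrightarrow> cholomorphic_on (f i) D"
  shows "cholomorphic_on (\<lambda>x. \<Prod>i\<in>S. f i x) D"
  using assms by induction (auto intro: cholo_const cholo_mult)

lemma cholo_sum:
  assumes "finite S" "\<And>i. i \<in> S \<Longrightarrow> cholomorphic_on (f i) D"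
  shows "cholomorphic_on (\<lambda>x. \<Sum>i\<in>S. f i x) D"
  using assms by induction (auto intro: cholo_const cholo_add)

lemma cholo_powi:
  assumes "cholomorphic_on f D" "\<And>x. x \<in> D \<Longrightarrow> f x \<noteq> 0"
  shows "cholomorphic_on (\<lambda>x. f x powi n) D"
  by (rule cholo_compose[OF assms(1), of "\<lambda>z. z powi n" "- {0}"])
    (use assms(2) in \<open>auto intro!: holomorphic_intros\<close>)

section \<open>The bundle\<close>

lemma fst_pair [simp]: "fst_vec (pair_vec w z) = w"
  and snd_pair [simp]: "snd_vec (pair_vec w z) = z"
  and pair_fst_snd [simp]: "pair_vec (fst_vec x) (snd_vec x) = x"
  by (auto simp: fst_vec_def snd_vec_def pair_vec_def vec_eq_iff split: option.split)

lemma pair_nth [simp]: "pair_vec w z $ None = w" "pair_vec w z $ Some i = z $ i"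
  by (simp_all add: pair_vec_def)

lemma continuous_on_pair [continuous_intros]:
  assumes "continuous_on S f" "continuous_on S g"
  shows "continuous_on S (\<lambda>x. pair_vec (f x) (g x))"
  unfolding pair_vec_def
proof (rule continuous_on_vec_lambda)
  fix k show "continuous_on S (\<lambda>x. case k of None \<Rightarrow> f x | Some i \<Rightarrow> g x $ i)"
    by (cases k) (auto intro: continuous_intros assms)
qed

lemma continuous_on_fst_snd [continuous_intros]:
  assumes "continuous_on S f"
  shows "continuous_on S (\<lambda>x. fst_vec (f x))" "continuous_on S (\<lambda>x. snd_vec (f x))"
  unfolding fst_vec_def snd_vec_def by (intro continuous_intros continuous_on_vec_lambda assms)+

lemma open_strip: "open (strip m)"
  unfolding strip_def by (intro open_Collect_less continuous_intros)

lemma strip_add_int [simp]: "w + of_int j \<in> strip m \<longleftrightarrow> w \<in> strip m"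
  by (simp add: strip_def)

text \<open>\<open>B\<close> is the logarithmic image of the fibre, on which the action becomes
  linear.\<close>

locale monomial_bundle =
  fixes M :: "int^'d^'d" and m :: real and B :: "(real^'d) set"
  assumes inv: "invertible M" and m: "m > 0"
    and B: "open B" "convex B" "B \<noteq> {}"
    and MB: "\<And>j x. x \<in> B \<Longrightarrow> imat (zmat M j) *v x \<in> B"
begin

definition "Om = {pair_vec w z |w z. w \<in> strip m \<and> z \<in> Rein B}"

lemma Om_iff: "x \<in> Om \<longleftrightarrow> fst_vec x \<in> strip m \<and> snd_vec x \<in> Rein B"
  by (auto simp: Om_def intro!: exI[of _ "fst_vec x"] exI[of _ "snd_vec x"])

lemma pair_in_Om [simp]: "pair_vec w z \<in> Om \<longleftrightarrow> w \<in> strip m \<and> z \<in> Rein B"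
  by (simp add: Om_iff)

lemma Om_nz: "x \<in> Om \<Longrightarrow> x $ Some l \<noteq> 0"
  by (auto simp: Om_iff Rein_def ctorus_def snd_vec_def)

lemma open_Om: "open Om"
proof -
  have "Om = {x. fst_vec x \<in> strip m} \<inter> {x. snd_vec x \<in> Rein B}" by (auto simp: Om_iff)
  moreover have "open {x :: complex^('d option). fst_vec x \<in> strip m}"
    using open_vimage[OF open_strip, of fst_vec m] continuous_on_fst_snd(1)[OF continuous_on_id, of UNIV]
    by (simp add: vimage_def)
  moreover have "open {x :: complex^('d option). snd_vec x \<in> Rein B}"
    using open_vimage[OF open_Rein[OF B(1)], of snd_vec] continuous_on_fst_snd(2)[OF continuous_on_id, of UNIV]
    by (simp add: vimage_def)
  ultimately show ?thesis by auto
qed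

lemma connB: "connected B"
  using B(2) by (rule convex_connected)

lemma Rein_ctorus: "z \<in> Rein B \<Longrightarrow> z \<in> ctorus"
  by (simp add: Rein_def)

lemma monomial_map_Rein: "z \<in> Rein B \<Longrightarrow> monomial_map (zmat M j) z \<in> Rein B"
  by (simp add: Rein_def monomial_map_in_ctorus lgv_monomial_map MB)

lemma act_eq:
  assumes "x \<in> Om"
  shows "diagonal_action M j x = pair_vec (fst_vec x + of_int j) (monomial_map (zmat M j) (snd_vec x))"
  using assms monomial_action_eq[OF inv] Rein_ctorus by (simp add: diagonal_action_def Om_iff)

sublocale translation_action Om "diagonal_action M" None
proof
  show "open Om" by (rule open_Om)
next
  fix x j assume x: "x \<in> Om"
  show "diagonal_action M j x \<in> Om"
    unfolding act_eq[OF x] using x monomial_map_Rein by (simp add: Om_iff)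
  show "diagonal_action M j x $ None = x $ None + of_int j"
    unfolding act_eq[OF x] by (simp add: fst_vec_def)
next
  fix x assume x: "x \<in> Om"
  show "diagonal_action M 0 x = x" unfolding act_eq[OF x] by (simp add: monomial_map_one)
next
  fix x i j assume x: "x \<in> Om"
  have y: "pair_vec (fst_vec x + of_int j) (monomial_map (zmat M j) (snd_vec x)) \<in> Om"
    using x monomial_map_Rein by (simp add: Om_iff)
  show "diagonal_action M (i + j) x = diagonal_action M i (diagonal_action M j x)"
    unfolding act_eq[OF x] act_eq[OF y] using x Rein_ctorus
    by (simp add: zmat_add[OF inv] monomial_map_mult Om_iff add_ac)
next
  fix j
  show "cholomorphic_map_on (diagonal_action M j) Om"
    unfolding cholomorphic_map_on_def
  proof (intro allI cholomorphic_on_local)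
    fix i x assume x: "x \<in> Om"
    note o = open_Om
    show "\<exists>N g E. open N \<and> x \<in> N \<and> x \<in> E \<and> cholomorphic_on g E \<and> (\<forall>y\<in>N. diagonal_action M j y $ i = g y)"
    proof (cases i)
      case None
      have "cholomorphic_on (\<lambda>y. y $ None + of_int j) Om" by (intro cholo_add cholo_nth cholo_const)
      then show ?thesis using None x o by (intro exI[of _ Om] exI[of _ "\<lambda>y. y $ None + of_int j"]) (auto simp: act_eq fst_vec_def)
    next
      case (Some k)
      have "cholomorphic_on (\<lambda>y. \<Prod>l\<in>UNIV. (y $ Some l) powi (zmat M j $ k $ l)) Om"
        by (intro cholo_prod cholo_powi cholo_nth) (auto simp: Om_nz)
      moreover have "diagonal_action M j y $ i = (\<Prod>l\<in>UNIV. (y $ Some l) powi (zmat M j $ k $ l))" if "y \<in> Om" for y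
        unfolding act_eq[OF that] by (simp add: Some monomial_map_def snd_vec_def)
      ultimately show ?thesis using x o
        by (intro exI[of _ Om] exI[of _ "\<lambda>y. \<Prod>l\<in>UNIV. (y $ Some l) powi (zmat M j $ k $ l)"]) auto
    qed
  qed
qed

lemma E_bundle_eq: "E_bundle m (Rein B) M = E"
  by (simp add: E_bundle_def E_def flip: Om_def)

section \<open>Laurent coefficients along the fibres\<close>

definition slF where "slF f w z = f (q (pair_vec w z))"

lemma hol_iff: "f \<in> holomorphic_functions E \<longleftrightarrow> cholomorphic_on (\<lambda>x. f (q x)) Om"
  by (simp add: holomorphic_functions_E o_def)

lemma hol_power: "f \<in> holomorphic_functions E \<Longrightarrow> (\<lambda>X. f X ^ n) \<in> holomorphic_functions E"
  unfolding hol_iff by (induction n) (auto intro: cholo_const cholo_mult)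

lemma slF_rhol:
  assumes f: "f \<in> holomorphic_functions E" and w: "w \<in> strip m"
  shows "rhol B (slF f w)"
  unfolding rhol_def
proof (intro conjI allI)
  have F: "cholomorphic_on (\<lambda>x. f (q x)) Om" using f by (simp add: hol_iff)
  show "continuous_on (Rein B) (slF f w)"
    unfolding slF_def
    by (rule continuous_on_compose2[OF cholomorphic_on_imp_continuous[OF F]])
      (use w in \<open>auto intro!: continuous_intros\<close>)
  fix p y :: "complex^'d"
  have "(\<lambda>\<zeta>. (\<lambda>x. f (q x)) (pair_vec w (cexpv (p + \<zeta> *s y)))) holomorphic_on {\<zeta>. cexpv (p + \<zeta> *s y) \<in> Rein B}"
  proof (rule cholomorphic_on_curve[OF F, where c' = "\<lambda>\<zeta> k. case k of None \<Rightarrow> 0 | Some k \<Rightarrow> exp (p $ k + \<zeta> * y $ k) * y $ k"])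
    fix \<zeta> k
    show "((\<lambda>\<zeta>. pair_vec w (cexpv (p + \<zeta> *s y)) $ k) has_field_derivative (case k of None \<Rightarrow> 0 | Some k \<Rightarrow> exp (p $ k + \<zeta> * y $ k) * y $ k)) (at \<zeta>)"
      by (cases k) (auto simp: cexpv_def intro!: derivative_eq_intros)
  qed (use w in auto)
  then show "(\<lambda>\<zeta>. slF f w (cexpv (p + \<zeta> *s y))) holomorphic_on {\<zeta>. cexpv (p + \<zeta> *s y) \<in> Rein B}"
    by (simp add: slF_def)
qed

lemma slF_shift:
  assumes "w \<in> strip m" "z \<in> Rein B"
  shows "slF f (w + of_int j) (monomial_map (zmat M j) z) = slF f w z"
proof -
  have "pair_vec w z \<in> Om" using assms by auto
  from q_act[OF this, of j] show ?thesis
    unfolding act_eq[OF \<open>pair_vec w z \<in> Om\<close>] by (simp add: slF_def)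
qed

definition base where "base = (SOME x. x \<in> B)"

lemma base: "base \<in> B"
  using B(3) by (auto simp: base_def intro: someI)

text \<open>The Laurent coefficient of \<open>f\<close> in the fibre over \<open>w\<close>, normalised at the point \<open>base\<close> of \<open>B\<close>.\<close>

definition lco where "lco f \<alpha> w = fc (slF f w) \<alpha> base"

lemma lco_nonzero:
  assumes f: "f \<in> holomorphic_functions E" and w: "w \<in> strip m" and x: "x \<in> B"
    and 0: "lco f \<alpha> w = 0"
  shows "fc (slF f w) \<alpha> x = 0"
  using fc_eq[OF B(1) connB slF_rhol[OF f w] base x] 0 by (simp add: lco_def)

lemma lco_holomorphic:
  assumes f: "f \<in> holomorphic_functions E"
  shows "lco f \<alpha> holomorphic_on strip m"
proof -
  have F: "cholomorphic_on (\<lambda>x. f (q x)) Om" using f by (simp add: hol_iff)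
  have "(\<lambda>w. tmean (\<lambda>u. slF f w (rx base * u) * lmono (- \<alpha>) u)) holomorphic_on strip m"
  proof (rule holomorphic_on_tmean[OF open_strip])
    have "continuous_on (strip m \<times> torus) (\<lambda>p. f (q (pair_vec (fst p) (rx base * snd p))) * lmono (- \<alpha>) (snd p))"
      by (intro continuous_intros continuous_on_compose2[OF cholomorphic_on_imp_continuous[OF F]]
          continuous_on_compose2[OF continuous_on_lmono_torus])
        (use base in \<open>auto\<close>)
    then show "continuous_on (strip m \<times> torus) (\<lambda>(w, u). slF f w (rx base * u) * lmono (- \<alpha>) u)"
      by (simp add: slF_def case_prod_unfold)
    fix u :: "complex^'d" assume u: "u \<in> torus"
    have "(\<lambda>w. (\<lambda>x. f (q x)) (pair_vec w (rx base * u))) holomorphic_on strip m"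
    proof (rule cholomorphic_on_curve[OF F, where c' = "\<lambda>\<zeta> k. case k of None \<Rightarrow> 1 | Some k \<Rightarrow> 0"])
      fix \<zeta> k
      show "((\<lambda>w. pair_vec w (rx base * u) $ k) has_field_derivative (case k of None \<Rightarrow> 1 | Some k \<Rightarrow> 0)) (at \<zeta>)"
        by (cases k) (auto intro!: derivative_eq_intros)
    qed (use u base in \<open>auto\<close>)
    then show "(\<lambda>w. slF f w (rx base * u) * lmono (- \<alpha>) u) holomorphic_on strip m"
      unfolding slF_def by (intro holomorphic_intros)
  qed
  then show ?thesis by (simp add: lco_def[abs_def] fc_def[abs_def])
qed

text \<open>Invariance identifies the coefficient \<alpha> over w + j at the point M^j x with the
  coefficient \<alpha> M^j over w at x, which is at most \<open>S\<close>. Returning from M^j x to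
  \<open>base\<close> produces the exponential factors.\<close>

lemma lco_bound:
  assumes f: "f \<in> holomorphic_functions E" and w: "w \<in> strip m" and x: "x \<in> B"
    and S: "\<And>u. u \<in> torus \<Longrightarrow> cmod (slF f w (rx x * u)) \<le> S"
  shows "cmod (lco f \<alpha> (w + of_int j)) \<le> S * exp (ip \<alpha> base) * exp (- ip \<alpha> (imat (zmat M j) *v x))"
proof -
  let ?A = "zmat M j"
  have wj: "w + of_int j \<in> strip m" using w by simp
  have "fc (slF f (w + of_int j)) \<alpha> (imat ?A *v x) = fc (slF f w) (\<alpha> v* ?A) x"
  proof (rule fc_matrix[OF zmat_inverse[OF inv] B(1) connB slF_rhol[OF f wj] MB[OF x]])
    fix u :: "complex^'d" assume "u \<in> torus"
    then show "slF f (w + of_int j) (monomial_map ?A (rx x * u)) = slF f w (rx x * u)"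
      using x by (intro slF_shift w) simp
  qed
  then have "cmod (fc (slF f (w + of_int j)) \<alpha> (imat ?A *v x)) \<le> S"
    using fc_bound[OF slF_rhol[OF f w] x S] by simp
  moreover have "lco f \<alpha> (w + of_int j) = fc (slF f (w + of_int j)) \<alpha> (imat ?A *v x) * exp (of_real (ip \<alpha> (base - imat ?A *v x)))"
    unfolding lco_def by (rule fc_eq[OF B(1) connB slF_rhol[OF f wj] MB[OF x] base])
  ultimately show ?thesis
  proof -
    assume le: "cmod (fc (slF f (w + of_int j)) \<alpha> (imat ?A *v x)) \<le> S"
      and eq: "lco f \<alpha> (w + of_int j) = fc (slF f (w + of_int j)) \<alpha> (imat ?A *v x) * exp (of_real (ip \<alpha> (base - imat ?A *v x)))"
    have "cmod (lco f \<alpha> (w + of_int j)) \<le> S * exp (ip \<alpha> (base - imat ?A *v x))"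
      unfolding eq norm_mult using le by (simp add: mult_right_mono)
    then show ?thesis by (simp add: ip_diff exp_add [symmetric] mult.assoc)
  qed
qed

lemma compact_bound:
  assumes f: "f \<in> holomorphic_functions E" and K: "compact K" "K \<subseteq> strip m" and X: "compact X" "X \<subseteq> B"
  shows "\<exists>S\<ge>0. \<forall>w\<in>K. \<forall>x\<in>X. \<forall>u\<in>torus. cmod (slF f w (rx x * u)) \<le> S"
proof -
  have F: "continuous_on Om (\<lambda>x. f (q x))" using f by (simp add: hol_iff cholomorphic_on_imp_continuous)
  have "compact ((\<lambda>(w, x, u). f (q (pair_vec w (rx x * u)))) ` (K \<times> X \<times> torus))"
  proof (intro compact_continuous_image compact_Times K X compact_torus)
    have "continuous_on (K \<times> X \<times> torus) (\<lambda>p. f (q (pair_vec (fst p) (rx (fst (snd p)) * snd (snd p)))))"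
      by (intro continuous_on_compose2[OF F] continuous_intros)
        (use K X in \<open>auto\<close>)
    then show "continuous_on (K \<times> X \<times> torus) (\<lambda>(w, x, u). f (q (pair_vec w (rx x * u))))"
      by (simp add: case_prod_unfold)
  qed
  then have "bounded ((\<lambda>(w, x, u). f (q (pair_vec w (rx x * u)))) ` (K \<times> X \<times> torus))"
    by (rule compact_imp_bounded)
  then obtain S where "\<forall>y\<in>(\<lambda>(w, x, u). f (q (pair_vec w (rx x * u)))) ` (K \<times> X \<times> torus). cmod y \<le> S"
    by (auto simp: bounded_iff)
  then have "\<forall>w\<in>K. \<forall>x\<in>X. \<forall>u\<in>torus. cmod (slF f w (rx x * u)) \<le> max S 0"
    by (fastforce simp: slF_def le_max_iff_disj)
  then show ?thesis by (intro exI[of _ "max S 0"]) auto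
qed

text \<open>\<sigma> selects the end of the strip: for \<sigma> = - 1 the reflection of w turns
  powers of the inverse matrix into decay to the right. Each w is split into an integer j and a
  remainder in a fixed compact rectangle, over which \<open>f\<close> is bounded.\<close>

lemma lco_vanish:
  assumes f: "f \<in> holomorphic_functions E" and \<rho>: "\<rho> > 1" "m * ln \<rho> > 2 * pi\<^sup>2"
    and \<sigma>: "\<sigma> = 1 \<or> \<sigma> = - 1" and N: "\<And>j. zmat M (\<sigma> * int j) = mpow N j"
    and gr: "growing (imat N) B \<rho> \<alpha>" and w: "w \<in> strip m"
  shows "lco f \<alpha> w = 0"
proof -
  define h where "h w = lco f \<alpha> (of_int \<sigma> * w)" for w
  have \<sigma>s: "of_int \<sigma> * w \<in> strip m \<longleftrightarrow> w \<in> strip m" for w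
    using \<sigma> by (auto simp: strip_def)
  obtain X c J where X: "compact X" "X \<subseteq> B" "c > 0"
      "\<And>j. j \<ge> J \<Longrightarrow> \<exists>x\<in>X. ip \<alpha> (((*v) (imat N) ^^ j) x) \<ge> c * \<rho> ^ j"
    using gr by (auto simp: growing_def)
  have "h w = 0" if w: "w \<in> strip m" for w
  proof (rule strip_vanish[OF m _ _ _ w, of "ln \<rho>"])
    show "2 * pi\<^sup>2 < ln \<rho> * m" using \<rho> by (simp add: mult.commute)
    show "h holomorphic_on strip m"
      unfolding h_def
      by (rule holomorphic_on_compose_gen[OF _ lco_holomorphic[OF f], unfolded o_def])
        (auto intro!: holomorphic_intros simp: \<sigma>s)
    fix \<eta> assume \<eta>: "0 < \<eta>" "\<eta> < m / (4 * pi)"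
    \<comment> \<open>Real parts from - 1 to 1, since for \<sigma> = - 1 the remainder of w is
      reflected.\<close>
    define K where "K = cbox (Complex (- 1) (- \<eta>)) (Complex 1 \<eta>)"
    have K: "compact K" "K \<subseteq> strip m"
      using \<eta> by (auto simp: K_def in_cbox_complex_iff strip_def)
    obtain S where S: "S \<ge> 0" "\<And>w x u. w \<in> K \<Longrightarrow> x \<in> X \<Longrightarrow> u \<in> torus \<Longrightarrow> cmod (slF f w (rx x * u)) \<le> S"
      using compact_bound[OF f K X(1,2)] by blast
    show "\<exists>C c u0. 0 < c \<and> (\<forall>w. u0 \<le> Re w \<and> \<bar>Im w\<bar> \<le> \<eta> \<longrightarrow> cmod (h w) \<le> C * exp (- c * exp (ln \<rho> * Re w)))"
    proof (intro exI conjI allI impI)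
      \<comment> \<open>One factor \<rho> is lost because Re w may exceed its integer part j by
        almost 1.\<close>
      show "0 < c / \<rho>" using X(3) \<rho> by simp
      fix w assume w: "real J \<le> Re w \<and> \<bar>Im w\<bar> \<le> \<eta>"
      define j where "j = nat \<lfloor>Re w\<rfloor>"
      have Rw: "Re w \<ge> 0" using w by (meson of_nat_0_le_iff order_trans)
      have rj: "real j = of_int \<lfloor>Re w\<rfloor>" using Rw by (simp add: j_def)
      have j: "real j \<le> Re w" "Re w < real j + 1" unfolding rj by linarith+
      have jJ: "j \<ge> J" using w by (simp add: j_def le_nat_floor)
      obtain x where x: "x \<in> X" "ip \<alpha> (((*v) (imat N) ^^ j) x) \<ge> c * \<rho> ^ j" using X(4)[OF jJ] by blast
      define w' where "w' = of_int \<sigma> * (w - of_nat j)"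
      have w'K: "w' \<in> K" using j w \<sigma> by (auto simp: w'_def K_def in_cbox_complex_iff abs_le_iff)
      have "of_int \<sigma> * w = w' + of_int (\<sigma> * int j)" by (simp add: w'_def algebra_simps)
      then have "cmod (h w) = cmod (lco f \<alpha> (w' + of_int (\<sigma> * int j)))" by (simp add: h_def)
      also have "\<dots> \<le> S * exp (ip \<alpha> base) * exp (- ip \<alpha> (imat (zmat M (\<sigma> * int j)) *v x))"
        using w'K x K X by (intro lco_bound[OF f]) (auto intro!: S)
      also have "imat (zmat M (\<sigma> * int j)) *v x = ((*v) (imat N) ^^ j) x" by (simp add: N imat_mpow)
      also have "S * exp (ip \<alpha> base) * exp (- ip \<alpha> (((*v) (imat N) ^^ j) x)) \<le> S * exp (ip \<alpha> base) * exp (- (c / \<rho>) * exp (ln \<rho> * Re w))"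
      proof (intro mult_left_mono)
        have "exp (ln \<rho> * Re w) \<le> exp (ln \<rho> * (real j + 1))" using j \<rho> by simp
        also have "\<dots> = \<rho> ^ j * \<rho>" using \<rho> by (simp add: distrib_left exp_add exp_of_nat2_mult)
        finally have "c / \<rho> * exp (ln \<rho> * Re w) \<le> c / \<rho> * (\<rho> ^ j * \<rho>)" using X(3) \<rho> by (intro mult_left_mono) auto
        also have "\<dots> = c * \<rho> ^ j" using \<rho> by simp
        finally show "exp (- ip \<alpha> (((*v) (imat N) ^^ j) x)) \<le> exp (- (c / \<rho>) * exp (ln \<rho> * Re w))" using x(2) by simp
      qed (use S in auto)
      finally show "cmod (h w) \<le> S * exp (ip \<alpha> base) * exp (- (c / \<rho>) * exp (ln \<rho> * Re w))" .
    qed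
  qed
  from this[of "of_int \<sigma> * w"] show ?thesis using w \<sigma> by (auto simp: h_def \<sigma>s)
qed

section \<open>Obstructions to the Stein property\<close>

lemma zmat_bound: "\<exists>L\<ge>0. \<forall>x :: real^'d. norm (imat (zmat M j) *v x) \<le> L * norm x"
  using bounded_linear.nonneg_bounded[OF matrix_vector_mul_bounded_linear[of "imat (zmat M j) :: real^'d^'d"]]
  by (auto simp: mult.commute)

text \<open>All functions agree at two points over w = 0 that differ by a rotation in the direction
  \<open>r\<close>. Since their base coordinates are equal, the action does not identify
  them.\<close>

lemma separable_rotation:
  assumes sep: "holomorphically_separable E" and r: "(r :: real^'d) \<noteq> 0"
    and van: "\<And>f \<alpha>. f \<in> holomorphic_functions E \<Longrightarrow> ip \<alpha> r \<noteq> 0 \<Longrightarrow> lco f \<alpha> 0 = 0"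
  shows False
proof -
  have 0: "0 \<in> strip m" using m by (simp add: strip_def)
  obtain k where k: "r $ k \<noteq> 0" using r by (auto simp: vec_eq_iff)
  \<comment> \<open>Turns coordinate k by the angle pi, so the two points really differ.\<close>
  define \<tau> where "\<tau> = pi / r $ k"
  define P where "P = pair_vec 0 (rx base * cisv 0)"
  define P' where "P' = pair_vec 0 (rx base * (cisv 0 * cisv (\<tau> *\<^sub>R r)))"
  have PO: "P \<in> Om" "P' \<in> Om"
    using base 0 in_Rein[OF torus_mult[OF cisv_in cisv_in]] by (auto simp: P_def P'_def)
  have "f (q P') = f (q P)" if f: "f \<in> holomorphic_functions E" for f
  proof -
    have "slF f 0 (rx base * (cisv 0 * cisv (\<tau> *\<^sub>R r))) = slF f 0 (rx base * cisv 0)"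
      by (rule fc_vanish_invariant[OF B(1) connB slF_rhol[OF f 0] base _ cisv_in])
        (use van[OF f] in \<open>auto simp: lco_def\<close>)
    then show ?thesis by (simp add: slF_def P_def P'_def)
  qed
  then have "q P = q P'"
    using sep PO unfolding holomorphically_separable_def fst_E topspace_Q by (metis imageI)
  then obtain j where j: "P' = diagonal_action M j P" using q_eq[OF PO] by blast
  then have "P' $ None = P $ None + of_int j" using act_c0[OF PO(1)] by simp
  then have "j = 0" by (simp add: P_def P'_def)
  then have "P' = P" using j act_0[OF PO(1)] by simp
  then have "snd_vec P' $ k = snd_vec P $ k" by simp
  then have "cis (\<tau> * r $ k) = 1" by (simp add: P_def P'_def rx_def cisv_def)
  then show False using k by (simp add: \<tau>_def)
qed

text \<open>Exponents with ip \<alpha> v > 0 are absent, so no Laurent term grows along the ray, and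
  the hull estimate puts the whole ray into the hull of a cube. A compact hull would lift to a
  compact set; its base coordinates allow only finitely many translations j, which would bound the
  ray.\<close>

lemma hull_noncompact:
  assumes hc: "holomorphically_convex E" and v: "v \<noteq> 0" "\<And>x t. x \<in> B \<Longrightarrow> t \<ge> 0 \<Longrightarrow> x + t *\<^sub>R v \<in> B"
    and van: "\<And>f \<alpha>. f \<in> holomorphic_functions E \<Longrightarrow> ip \<alpha> v > 0 \<Longrightarrow> lco f \<alpha> 0 = 0"
  shows False
proof -
  have 0: "0 \<in> strip m" using m by (simp add: strip_def)
  obtain e where e: "e > 0" "boxn base e \<subseteq> B" using boxn_subset[OF B(1) base] .
  define C where "C = (\<lambda>(y, u). pair_vec 0 (rx y * u)) ` (boxn base e \<times> torus)"
  have CO: "C \<subseteq> Om" using e 0 by (auto simp: C_def)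
  have cC: "compact C"
    unfolding C_def by (intro compact_continuous_image compact_Times compact_boxn compact_torus)
      (auto simp: case_prod_unfold intro!: continuous_intros)
  define K where "K = q ` C"
  have K: "compactin Q K" unfolding K_def by (rule compactin_q_image[OF cC CO])
  have bb: "base \<in> boxn base e" using e by (simp add: in_boxn)
  have K0: "K \<noteq> {}" using bb by (auto simp: K_def C_def)
  have "compactin Q (holomorphic_hull E K)"
    using hc K K0 by (simp add: holomorphically_convex_def fst_E)
  from compactin_cover[OF this] obtain C' where C': "compact C'" "C' \<subseteq> Om" "holomorphic_hull E K \<subseteq> q ` C'" by blast
  have hull: "q (pair_vec 0 (rx (base + t *\<^sub>R v) * cisv 0)) \<in> holomorphic_hull E K" if t: "t \<ge> 0" for t
  proof -
    let ?x = "base + t *\<^sub>R v"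
    have xB: "?x \<in> B" by (rule v(2)[OF base t])
    have "cmod (f (q (pair_vec 0 (rx ?x * cisv 0)))) \<le> (SUP y\<in>K. cmod (f y))" if f: "f \<in> holomorphic_functions E" for f
    proof -
      have "compact ((\<lambda>x. cmod (f (q x))) ` C)"
        using f by (intro compact_continuous_image cC continuous_intros continuous_on_subset[OF _ CO] cholomorphic_on_imp_continuous)
          (simp add: hol_iff)
      then have bdd: "bdd_above ((\<lambda>y. cmod (f y)) ` K)"
        unfolding K_def image_image by (intro bounded_imp_bdd_above compact_imp_bounded)
      have S: "cmod (slF f 0 (rx y * u)) \<le> (SUP y\<in>K. cmod (f y))" if "y \<in> boxn base e" "u \<in> torus" for y u
        unfolding slF_def by (rule cSUP_upper[OF _ bdd]) (use that in \<open>force simp: K_def C_def\<close>)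
      have "cmod (slF f 0 (rx ?x * cisv 0)) \<le> (SUP y\<in>K. cmod (f y))"
      proof (rule rein_hull[OF B(1) connB slF_rhol[OF f 0] xB cisv_in e(1) S e(2)])
        show "0 \<le> (SUP y\<in>K. cmod (f y))"
          using S[OF bb cisv_in] norm_ge_zero order_trans by blast
        fix n \<alpha> assume nz: "fc (\<lambda>z. slF f 0 z ^ n) \<alpha> ?x \<noteq> 0"
        have "(\<lambda>z. slF f 0 z ^ n) = slF (\<lambda>X. f X ^ n) 0" by (simp add: slF_def fun_eq_iff)
        \<comment> \<open>Powers of \<open>f\<close> are again functions on the bundle, so the
          vanishing applies to their coefficients too.\<close>
        then have "lco (\<lambda>X. f X ^ n) \<alpha> 0 \<noteq> 0"
          using lco_nonzero[OF hol_power[OF f] 0 xB, of n \<alpha>] nz by auto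
        then have "ip \<alpha> v \<le> 0" using van[OF hol_power[OF f]] not_less by blast
        then have "ip \<alpha> ?x \<le> ip \<alpha> base" using t by (simp add: ip_add ip_scaleR mult_nonneg_nonpos)
        then show "\<exists>y\<in>boxn base e. ip \<alpha> ?x + e * (\<Sum>k\<in>UNIV. \<bar>of_int (\<alpha> $ k)\<bar>) \<le> ip \<alpha> y"
        proof -
          obtain y where y: "y \<in> boxn base e" "ip \<alpha> y = ip \<alpha> base + e * (\<Sum>k\<in>UNIV. \<bar>of_int (\<alpha> $ k)\<bar>)"
            using boxn_corner[of e base \<alpha>] e by auto
          show ?thesis using \<open>ip \<alpha> ?x \<le> ip \<alpha> base\<close> y by (intro bexI[of _ y]) auto
        qed
      qed
      then show ?thesis by (simp add: slF_def)
    qed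
    moreover have "q (pair_vec 0 (rx ?x * cisv 0)) \<in> topspace Q"
      unfolding topspace_Q using xB 0 by (intro imageI) (simp add: pair_in_Om)
    ultimately show ?thesis by (simp add: holomorphic_hull_def fst_E)
  qed
  have "bounded (fst_vec ` C')"
    by (intro compact_imp_bounded compact_continuous_image C' continuous_intros)
  then obtain R where R: "\<And>c. c \<in> C' \<Longrightarrow> cmod (fst_vec c) \<le> R" unfolding bounded_iff by auto
  have "continuous_on C' (\<lambda>c. lgv (snd_vec c))"
    by (intro continuous_on_compose2[OF continuous_on_lgv] continuous_intros)
      (use C'(2) in \<open>auto simp: Om_iff Rein_def\<close>)
  then have "bounded ((\<lambda>c. lgv (snd_vec c)) ` C')"
    by (intro compact_imp_bounded compact_continuous_image C')
  then obtain R' where R': "\<And>c. c \<in> C' \<Longrightarrow> norm (lgv (snd_vec c)) \<le> R'" unfolding bounded_iff by auto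
  obtain L where L: "\<And>j. L j \<ge> 0" "\<And>j x. norm (imat (zmat M j) *v (x :: real^'d)) \<le> L j * norm x"
    using zmat_bound by metis
  have R'0: "R' \<ge> 0"
    using R' hull[of 0] C'(3) norm_ge_zero order_trans by (metis imageE order_refl subsetD)
  define J where "J = {- \<lceil>R\<rceil>..\<lceil>R\<rceil>}"
  define T where "T = (\<Sum>j\<in>J. L (- j) * R')"
  have bnd: "norm (base + t *\<^sub>R v) \<le> T" if t: "t \<ge> 0" for t
  proof -
    let ?x = "base + t *\<^sub>R v"
    let ?P = "pair_vec 0 (rx ?x * cisv 0)"
    have PO: "?P \<in> Om" unfolding pair_in_Om using v(2)[OF base t] 0 by simp
    obtain c where c: "c \<in> C'" "q ?P = q c" using hull[OF t] C'(3) by blast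
    then obtain j where j: "c = diagonal_action M j ?P" using q_eq[OF PO, of c] C'(2) by blast
    have ce: "c = pair_vec (of_int j) (monomial_map (zmat M j) (rx ?x * cisv 0))"
      unfolding j act_eq[OF PO] by simp
    have "\<bar>of_int j\<bar> \<le> R" using R[OF c(1)] by (simp add: ce)
    then have jJ: "j \<in> J" unfolding J_def by (auto simp: abs_le_iff) linarith+
    have "lgv (snd_vec c) = imat (zmat M j) *v ?x"
      by (simp add: ce lgv_monomial_map ctorus_mult torus_in_ctorus)
    then have "norm (imat (zmat M j) *v ?x) \<le> R'" using R'[OF c(1)] by simp
    moreover have "?x = imat (zmat M (- j)) *v (imat (zmat M j) *v ?x)"
      by (simp add: matrix_vector_mul_assoc imat_one zmat_inverse[OF inv] flip: imat_mult)
    then have "norm ?x \<le> L (- j) * norm (imat (zmat M j) *v ?x)"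
      using L(2)[of "- j" "imat (zmat M j) *v ?x"] by simp
    ultimately have "norm ?x \<le> L (- j) * R'"
      using mult_left_mono[OF _ L(1)[of "- j"]] order_trans by blast
    also have "\<dots> \<le> T" unfolding T_def using jJ L R'0
      by (intro member_le_sum) (auto simp: J_def)
    finally show ?thesis .
  qed
  \<comment> \<open>Long enough that base + t v has norm beyond T.\<close>
  define t where "t = (T + norm base + 1) / norm v"
  have T0: "T \<ge> 0" using bnd[of 0] norm_ge_zero order_trans by (metis order_refl)
  have t: "t \<ge> 0" using T0 by (simp add: t_def)
  have "t * norm v = norm (t *\<^sub>R v)" using t by simp
  also have "\<dots> \<le> norm (base + t *\<^sub>R v) + norm base"
    using norm_triangle_ineq4[of "base + t *\<^sub>R v" base] by simp
  also have "\<dots> \<le> T + norm base" using bnd[OF t] by simp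
  finally show False using v(1) by (simp add: t_def)
qed

lemma not_Stein:
  assumes \<rho>: "\<rho> > 1" "m * ln \<rho> > 2 * pi\<^sup>2"
    and \<sigma>: "\<sigma> = 1 \<or> \<sigma> = - 1" and N: "\<And>j. zmat M (\<sigma> * int j) = mpow N j"
    and ev: "\<And>\<mu>. eigval (imat N) \<mu> \<Longrightarrow> cmod \<mu> \<le> \<rho>" and \<mu>0: "eigval (imat N) \<mu>0" "cmod \<mu>0 = \<rho>"
  shows "\<not> Stein_manifold E"
proof
  assume st: "Stein_manifold E"
  have 0: "0 \<in> strip m" using m by (simp add: strip_def)
  have NB: "imat N *v x \<in> B" if "x \<in> B" for x
    using MB[OF that, of "\<sigma>"] N[of 1] by simp
  have van: "lco f \<alpha> 0 = 0" if "f \<in> holomorphic_functions E" "growing (imat N) B \<rho> \<alpha>" for f \<alpha>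
    by (rule lco_vanish[OF that(1) \<rho> \<sigma> N that(2) 0])
  have "(\<exists>v. v \<noteq> 0 \<and> (\<forall>x\<in>B. \<forall>t\<ge>0. x + t *\<^sub>R v \<in> B) \<and> (\<forall>\<alpha>. ip \<alpha> v > 0 \<longrightarrow> growing (imat N) B \<rho> \<alpha>)) \<or>
      (\<exists>r :: real^'d. r \<noteq> 0 \<and> (\<forall>\<alpha>. ip \<alpha> r \<noteq> 0 \<longrightarrow> growing (imat N) B \<rho> \<alpha>))"
    by (rule spectral_dichotomy[of B "imat N" \<rho> \<mu>0, unfolded cmat_imat]) (fact B NB \<rho>(1) ev \<mu>0)+
  then show False
  proof (elim disjE exE conjE)
    fix v assume "v \<noteq> 0" "\<forall>x\<in>B. \<forall>t\<ge>0. x + t *\<^sub>R v \<in> B" "\<forall>\<alpha>. ip \<alpha> v > 0 \<longrightarrow> growing (imat N) B \<rho> \<alpha>"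
    then show False using st van
      by (intro hull_noncompact[of v]) (auto simp: Stein_manifold_def)
  next
    fix r :: "real^'d" assume "r \<noteq> 0" "\<forall>\<alpha>. ip \<alpha> r \<noteq> 0 \<longrightarrow> growing (imat N) B \<rho> \<alpha>"
    then show False using st van
      by (intro separable_rotation[of r]) (auto simp: Stein_manifold_def)
  qed
qed

end

section \<open>Locally uniform limits of holomorphic functions\<close>

lemma slice_holomorphic:
  assumes f: "cholomorphic_on f (cball z0 r)" and z: "z \<in> ball z0 (r / 2)" and r: "r > 0"
  shows "(\<lambda>\<zeta>. f (z + axis i \<zeta>)) holomorphic_on cball 0 (r / 2)"
proof (rule cholomorphic_on_curve[OF f, where c' = "\<lambda>\<zeta> k. if k = i then 1 else 0"])
  fix \<zeta> :: complex assume \<zeta>: "\<zeta> \<in> cball 0 (r / 2)"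
  have "axis i \<zeta> = \<zeta> *s axis i 1" by (simp add: axis_def vec_eq_iff)
  then have "norm (axis i \<zeta>) = cmod \<zeta>" by (simp add: norm_vsmult)
  then have "dist z0 (z + axis i \<zeta>) \<le> dist z0 z + cmod \<zeta>"
    using norm_triangle_ineq4[of "z0 - z" "axis i \<zeta>"] by (simp add: dist_norm algebra_simps)
  then show "z + axis i \<zeta> \<in> cball z0 r" using z \<zeta> by simp
  show "((\<lambda>\<zeta>. (z + axis i \<zeta>) $ k) has_field_derivative (if k = i then 1 else 0)) (at \<zeta>)" for k
    by (cases "k = i") (auto simp: axis_def intro!: derivative_eq_intros)
qed

lemma partial_bound:
  assumes f: "cholomorphic_on f (cball z0 r)" and z: "z \<in> ball z0 (r / 2)" and r: "r > 0"
    and a: "(f has_derivative (\<lambda>h. \<Sum>i\<in>UNIV. a $ i * h $ i)) (at z)"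
    and B: "\<And>y. y \<in> cball z0 r \<Longrightarrow> cmod (f y) \<le> B"
  shows "cmod (a $ i) \<le> B / (r / 2)"
proof -
  let ?g = "\<lambda>\<zeta>. f (z + axis i \<zeta>)"
  have h: "?g holomorphic_on cball 0 (r / 2)" by (rule slice_holomorphic[OF f z r])
  have nb: "z + axis i \<zeta> \<in> cball z0 r" if "cmod \<zeta> = r / 2" for \<zeta>
  proof -
    have "axis i \<zeta> = \<zeta> *s axis i 1" by (simp add: axis_def vec_eq_iff)
    then have "norm (axis i \<zeta>) = cmod \<zeta>" by (simp add: norm_vsmult)
    then have "dist z0 (z + axis i \<zeta>) \<le> dist z0 z + cmod \<zeta>"
      using norm_triangle_ineq4[of "z0 - z" "axis i \<zeta>"] by (simp add: dist_norm algebra_simps)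
    then show ?thesis using z that by simp
  qed
  have "norm ((deriv ^^ 1) ?g 0) \<le> fact 1 * B / (r / 2) ^ 1"
    by (rule Cauchy_inequality)
      (use h r nb B in \<open>auto intro: holomorphic_on_subset holomorphic_on_imp_continuous_on\<close>)
  moreover have "(?g has_field_derivative a $ i) (at 0)"
  proof -
    have 1: "((\<lambda>\<zeta>. z + axis i \<zeta>) has_derivative (\<lambda>h. axis i h)) (at 0)"
    proof -
      have "bounded_linear (\<lambda>h :: complex. axis i h :: complex^'a)"
      proof (rule linear_conv_bounded_linear[THEN iffD1], rule linearI)
        show "axis i (b1 + b2) = axis i b1 + (axis i b2 :: complex^'a)" for b1 b2 by (simp add: axis_def vec_eq_iff)
        show "axis i (r *\<^sub>R b) = r *\<^sub>R (axis i b :: complex^'a)" for r b by (auto simp: axis_def vec_eq_iff)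
      qed
      from has_derivative_add[OF has_derivative_const bounded_linear_imp_has_derivative[OF this]]
      show ?thesis by simp
    qed
    have ax0: "z + axis i 0 = z" by (simp add: axis_def vec_eq_iff)
    have "(?g has_derivative (\<lambda>h. \<Sum>k\<in>UNIV. a $ k * axis i h $ k)) (at 0)"
      by (rule has_derivative_compose[OF 1, of f "\<lambda>h. \<Sum>i\<in>UNIV. a $ i * h $ i", unfolded ax0, OF a])
    moreover have "(\<lambda>h. \<Sum>k\<in>UNIV. a $ k * axis i h $ k) = (*) (a $ i)"
      by (simp add: axis_def fun_eq_iff mult_delta_right)
    ultimately show ?thesis by (simp add: has_field_derivative_def)
  qed
  ultimately show ?thesis by (simp add: DERIV_imp_deriv)
qed

text \<open>Cauchy estimates on coordinate discs turn uniform convergence on a ball into uniform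
  convergence of the partial derivatives on the half ball; the limit may then be differentiated term
  by term.\<close>

theorem cholo_uniform_limit:
  fixes f :: "nat \<Rightarrow> complex^'n \<Rightarrow> complex"
  assumes f: "\<And>n. cholomorphic_on (f n) D"
    and lim: "\<And>z. z \<in> D \<Longrightarrow> \<exists>r>0. cball z r \<subseteq> D \<and> uniform_limit (cball z r) f g sequentially"
  shows "cholomorphic_on g D"
  unfolding cholomorphic_on_def
proof
  fix z0 assume z0: "z0 \<in> D"
  obtain r where r: "r > 0" "cball z0 r \<subseteq> D" "uniform_limit (cball z0 r) f g sequentially"
    using lim[OF z0] by blast
  let ?s = "ball z0 (r / 2)"
  have sD: "?s \<subseteq> D" using r by (auto intro!: subsetD[OF r(2)])
  obtain a where a: "\<And>n z. z \<in> D \<Longrightarrow> (f n has_derivative (\<lambda>h. \<Sum>i\<in>UNIV. a n z $ i * h $ i)) (at z)"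
    using f unfolding cholomorphic_on_def by metis
  have uc: "uniformly_Cauchy_on (cball z0 r) f"
    using r(3) by (intro uniformly_convergent_Cauchy) (auto simp: uniformly_convergent_on_def)
  have "uniformly_Cauchy_on ?s (\<lambda>n z. a n z $ i)" for i
    unfolding uniformly_Cauchy_on_def
  proof (intro allI impI)
    fix e :: real assume e: "e > 0"
    then have "e * r / 4 > 0" using r by simp
    then obtain N where N: "\<And>z m n. z \<in> cball z0 r \<Longrightarrow> m \<ge> N \<Longrightarrow> n \<ge> N \<Longrightarrow> dist (f m z) (f n z) < e * r / 4"
      using uc unfolding uniformly_Cauchy_on_def by metis
    have "dist (a m z $ i) (a n z $ i) < e" if z: "z \<in> ?s" and mn: "m \<ge> N" "n \<ge> N" for z m n
    proof -
      have zD: "z \<in> D" using z sD by blast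
      have "cmod ((a m z - a n z) $ i) \<le> (e * r / 4) / (r / 2)"
      proof (rule partial_bound[of "\<lambda>y. f m y + (- 1) * f n y" z0 r z])
        show "cholomorphic_on (\<lambda>y. f m y + (- 1) * f n y) (cball z0 r)"
          by (intro cholo_add cholo_mult cholo_const cholomorphic_on_subset[OF f r(2)])
        have "((\<lambda>y. f m y - f n y) has_derivative (\<lambda>h. (\<Sum>i\<in>UNIV. a m z $ i * h $ i) - (\<Sum>i\<in>UNIV. a n z $ i * h $ i))) (at z)"
          by (intro has_derivative_diff a zD)
        then show "((\<lambda>y. f m y + (- 1) * f n y) has_derivative (\<lambda>h. \<Sum>i\<in>UNIV. (a m z - a n z) $ i * h $ i)) (at z)"
          by (simp add: left_diff_distrib sum_subtractf)
        show "cmod (f m y + (- 1) * f n y) \<le> e * r / 4" if "y \<in> cball z0 r" for y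
          using N[OF that mn] by (simp add: dist_norm)
      qed (use z r in auto)
      then show ?thesis using e r by (simp add: dist_norm)
    qed
    then show "\<exists>M. \<forall>x\<in>?s. \<forall>m\<ge>M. \<forall>n\<ge>M. dist (a m x $ i) (a n x $ i) < e" by blast
  qed
  then have "\<exists>l. uniform_limit ?s (\<lambda>n z. a n z $ i) l sequentially" for i
    using Cauchy_uniformly_convergent uniformly_convergent_on_def by blast
  then obtain l where l: "\<And>i. uniform_limit ?s (\<lambda>n z. a n z $ i) (l i) sequentially" by metis
  have "\<exists>g'. \<forall>x\<in>?s. (\<lambda>n. f n x) \<longlonglongrightarrow> g' x \<and> (g' has_derivative (\<lambda>h. \<Sum>i\<in>UNIV. l i x * h $ i)) (at x within ?s)"
  proof (rule has_derivative_sequence)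
    show "convex ?s" by simp
    show "(f n has_derivative (\<lambda>h. \<Sum>i\<in>UNIV. a n x $ i * h $ i)) (at x within ?s)" if "x \<in> ?s" for n x
      using a that sD has_derivative_at_withinI by blast
    show "z0 \<in> ?s" using r by simp
    have "(\<lambda>n. f n z0) \<longlonglongrightarrow> g z0"
      by (rule tendsto_uniform_limitI[OF r(3)]) (use r in simp)
    then show "(\<lambda>n. f n z0) \<longlonglongrightarrow> g z0" .
    fix e :: real assume e: "e > 0"
    define e' where "e' = e / real CARD('n)"
    have e': "e' > 0" using e by (simp add: e'_def)
    have "\<forall>\<^sub>F n in sequentially. \<forall>i. \<forall>x\<in>?s. dist (a n x $ i) (l i x) < e'"
      using l e' by (intro eventually_all_finite) (auto simp: uniform_limit_iff)
    then show "\<forall>\<^sub>F n in sequentially. \<forall>x\<in>?s. \<forall>h. norm ((\<Sum>i\<in>UNIV. a n x $ i * h $ i) - (\<Sum>i\<in>UNIV. l i x * h $ i)) \<le> e * norm h"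
    proof eventually_elim
      case (elim n)
      show ?case
      proof (intro ballI allI)
        fix x h assume x: "x \<in> ?s"
        have "norm ((\<Sum>i\<in>UNIV. a n x $ i * h $ i) - (\<Sum>i\<in>UNIV. l i x * h $ i)) = norm (\<Sum>i\<in>UNIV. (a n x $ i - l i x) * h $ i)"
          by (simp add: left_diff_distrib sum_subtractf)
        also have "\<dots> \<le> (\<Sum>i\<in>(UNIV::'n set). e' * norm h)"
        proof (rule sum_norm_le)
          fix i
          have "dist (a n x $ i) (l i x) < e'" using elim x by blast
          then have "cmod (a n x $ i - l i x) \<le> e'" by (simp add: dist_norm)
          then show "norm ((a n x $ i - l i x) * h $ i) \<le> e' * norm h"
            unfolding norm_mult using e' by (intro mult_mono Finite_Cartesian_Product.norm_nth_le) auto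
        qed
        also have "\<dots> = e * norm h" by (simp add: e'_def)
        finally show "norm ((\<Sum>i\<in>UNIV. a n x $ i * h $ i) - (\<Sum>i\<in>UNIV. l i x * h $ i)) \<le> e * norm h" .
      qed
    qed
  qed
  then obtain g' where g': "\<And>x. x \<in> ?s \<Longrightarrow> (\<lambda>n. f n x) \<longlonglongrightarrow> g' x"
      "\<And>x. x \<in> ?s \<Longrightarrow> (g' has_derivative (\<lambda>h. \<Sum>i\<in>UNIV. l i x * h $ i)) (at x within ?s)" by blast
  have gg': "g' x = g x" if "x \<in> ?s" for x
  proof (rule LIMSEQ_unique[OF g'(1)[OF that]])
    show "(\<lambda>n. f n x) \<longlonglongrightarrow> g x"
      by (rule tendsto_uniform_limitI[OF r(3)]) (use that r in simp)
  qed
  have z0s: "z0 \<in> ?s" using r by simp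
  have "(g' has_derivative (\<lambda>h. \<Sum>i\<in>UNIV. (\<chi> i. l i z0) $ i * h $ i)) (at z0)"
    using g'(2)[OF z0s] at_within_open[OF z0s open_ball] by simp
  then have "(g has_derivative (\<lambda>h. \<Sum>i\<in>UNIV. (\<chi> i. l i z0) $ i * h $ i)) (at z0)"
    by (rule has_derivative_transform_within_open[OF _ open_ball z0s]) (rule gg')
  then show "\<exists>a. (g has_derivative (\<lambda>h. \<Sum>i\<in>UNIV. a $ i * h $ i)) (at z0)" by blast
qed

section \<open>A rapidly decreasing function on the strip\<close>

text \<open>For \<open>k = 2 * pi\<^sup>2 / m\<close> the cosine of the imaginary part of \<open>k * w\<close> stays positive on the strip, so
  \<open>gau p k w\<close> decays like \<open>exp (- c * \<bar>Re w\<bar> ^ (2 * p + 2) * exp (k * \<bar>Re w\<bar>))\<close> and beats the monomials,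
  whose exponents grow at most like \<open>\<bar>j\<bar> ^ p * exp (k * \<bar>j\<bar>)\<close>.\<close>

definition gau :: "nat \<Rightarrow> real \<Rightarrow> complex \<Rightarrow> complex"
  where "gau p k w = exp (- ((w\<^sup>2) ^ (p + 1) * ((exp (of_real k * w) + exp (- of_real k * w)) / 2)))"

lemma gau_holomorphic: "gau p k holomorphic_on S"
  unfolding gau_def by (intro holomorphic_intros) auto

lemma gau_nz: "gau p k w \<noteq> 0"
  by (simp add: gau_def)

text \<open>For large \<bar>Re w\<bar> the argument of w is near 0 or pi, so w ^ (2 p + 2) is nearly
  positive, while Re (cosh (k w)) is at least cos (k v0) cosh (k Re w). The real part of the product
  then dominates any multiple of \<bar>Re w\<bar> ^ p exp (k \<bar>Re w\<bar>).\<close>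

lemma gau_decay:
  assumes k: "k > 0" and v0: "0 \<le> v0" "k * v0 < pi / 2" and C: "C \<ge> 0"
  shows "\<exists>D\<ge>0. \<forall>w. \<bar>Im w\<bar> \<le> v0 \<longrightarrow> cmod (gau p k w) * exp (C * (1 + \<bar>Re w\<bar>) ^ p * exp (k * \<bar>Re w\<bar>)) \<le> D"
proof -
  define c where "c = cos (k * v0)"
  have c: "c > 0" unfolding c_def using k v0 by (intro cos_gt_zero_pi) (auto intro: less_le_trans[of _ 0])
  let ?N = "p + 1"
  have ct: "isCont (\<lambda>t :: real. ((1 + \<i> * of_real t)\<^sup>2) ^ ?N) 0" by (intro continuous_intros)
  have "\<exists>d>0. \<forall>t :: real. dist t 0 < d \<longrightarrow>
      dist (((1 + \<i> * of_real t)\<^sup>2) ^ ?N) (((1 + \<i> * of_real 0)\<^sup>2) ^ ?N) < c / 2"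
    using ct half_gt_zero[OF c] unfolding continuous_at_eps_delta by (elim allE impE)
  then obtain \<tau> where \<tau>: "\<tau> > 0" "\<And>t :: real. \<bar>t\<bar> < \<tau> \<Longrightarrow> cmod (((1 + \<i> * of_real t)\<^sup>2) ^ ?N - 1) < c / 2"
    by (simp only: dist_norm diff_zero real_norm_def of_real_0 mult_zero_right add_0_right power_one) blast
  \<comment> \<open>The second term keeps Im w / Re w below \<tau>, so that the normalised power of
    w stays near 1; the third lets one spare power of \<bar>Re w\<bar> absorb C 2 ^ p.\<close>
  define U where "U = 1 + v0 / \<tau> + 4 * C * 2 ^ p / c"
  have U: "U \<ge> 1" "U > v0 / \<tau>" "U \<ge> 4 * C * 2 ^ p / c"
    using \<tau> v0 C c by (auto simp: U_def intro: add_nonneg_nonneg) (simp add: add_pos_nonneg)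
  have big: "cmod (gau p k w) * exp (C * (1 + \<bar>Re w\<bar>) ^ p * exp (k * \<bar>Re w\<bar>)) \<le> 1"
    if w: "\<bar>Im w\<bar> \<le> v0" "\<bar>Re w\<bar> \<ge> U" for w
  proof -
    define u where "u = Re w"
    define v where "v = Im w"
    define a where "a = \<bar>u\<bar>"
    have a1: "a \<ge> 1" "a \<ge> U" using w U by (auto simp: a_def u_def)
    have u0: "u \<noteq> 0" using a1 by (auto simp: a_def)
    define Z where "Z = ((1 + \<i> * of_real (v / u))\<^sup>2) ^ ?N"
    have "\<bar>v / u\<bar> < \<tau>"
    proof -
      have "v0 < U * \<tau>" using U(2) \<tau>(1) by (simp add: field_simps)
      also have "\<dots> \<le> a * \<tau>" using a1 \<tau> by simp
      finally show ?thesis using w u0 by (simp add: a_def v_def divide_less_eq mult.commute)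
    qed
    then have Z: "cmod (Z - 1) < c / 2" unfolding Z_def by (rule \<tau>(2))
    have weq: "w = of_real u * (1 + \<i> * of_real (v / u))" using u0 by (simp add: complex_eq_iff u_def v_def)
    have "(w\<^sup>2) ^ ?N = ((of_real u)\<^sup>2) ^ ?N * Z"
      unfolding Z_def by (subst weq) (simp only: power_mult_distrib)
    also have "((of_real u)\<^sup>2) ^ ?N = complex_of_real (u ^ (2 * ?N))"
      by (simp only: of_real_power power_mult)
    also have "u ^ (2 * ?N) = a ^ (2 * ?N)"
      unfolding a_def by (simp only: power_mult power2_abs)
    finally have wZ: "(w\<^sup>2) ^ ?N = of_real (a ^ (2 * ?N)) * Z" .
    define H where "H = (exp (of_real k * w) + exp (- of_real k * w)) / 2"
    define ch where "ch = (exp (k * u) + exp (- (k * u))) / 2"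
    have ReH: "Re H = ch * cos (k * v)"
      by (simp add: H_def ch_def Re_exp u_def v_def algebra_simps)
    have nH: "cmod H \<le> ch"
      unfolding H_def ch_def norm_divide using norm_triangle_ineq[of "exp (of_real k * w)" "exp (- of_real k * w)"]
      by (simp add: u_def)
    have ch: "ch \<ge> exp (k * a) / 2" by (auto simp: ch_def a_def abs_if)
    have ch0: "ch > 0" using ch exp_gt_zero[of "k * a"] by linarith
    have "cos (k * v) = cos (k * \<bar>v\<bar>)" by (simp add: abs_if)
    also have "\<dots> \<ge> c"
    proof -
      have "k * v0 \<le> pi" using v0(2) pi_gt_zero by linarith
      then show ?thesis unfolding c_def using w k v0 by (intro cos_monotone_0_pi_le) (auto simp: v_def)
    qed
    finally have cv: "cos (k * v) \<ge> c" .
    have "Re (Z * H) = Re H + Re ((Z - 1) * H)" by (simp add: algebra_simps)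
    also have "\<dots> \<ge> ch * c - c / 2 * ch"
    proof -
      have "\<bar>Re ((Z - 1) * H)\<bar> \<le> cmod (Z - 1) * cmod H" using abs_Re_le_cmod[of "(Z - 1) * H"] by (simp add: norm_mult)
      also have "\<dots> \<le> c / 2 * ch" using Z nH c by (intro mult_mono) auto
      finally have "Re ((Z - 1) * H) \<ge> - (c / 2 * ch)" by linarith
      moreover have "Re H \<ge> ch * c" unfolding ReH using cv ch0 by simp
      ultimately show ?thesis by linarith
    qed
    finally have "Re (Z * H) \<ge> c / 2 * ch" by (simp add: algebra_simps)
    moreover have "c / 2 * ch \<ge> c / 2 * (exp (k * a) / 2)" using ch c by (intro mult_left_mono) auto
    ultimately have ZH: "Re (Z * H) \<ge> c / 4 * exp (k * a)" by simp
    have "cmod (gau p k w) = exp (- (a ^ (2 * ?N) * Re (Z * H)))"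
    proof -
      have "(w\<^sup>2) ^ ?N * ((exp (of_real k * w) + exp (- of_real k * w)) / 2) = of_real (a ^ (2 * ?N)) * (Z * H)"
        by (simp only: wZ H_def mult.assoc)
      moreover have "Re (- (complex_of_real x * y)) = - (x * Re y)" for x y by simp
      ultimately show ?thesis by (simp only: gau_def norm_exp_eq_Re)
    qed
    also have "\<dots> \<le> exp (- (a ^ (2 * ?N) * (c / 4 * exp (k * a))))"
      using ZH a1 by (simp add: mult_left_mono)
    finally have 1: "cmod (gau p k w) \<le> exp (- (a ^ (2 * ?N) * (c / 4 * exp (k * a))))" .
    have "C * (1 + a) ^ p \<le> C * (2 * a) ^ p"
      using a1 C by (intro mult_left_mono power_mono) auto
    also have "\<dots> = (C * 2 ^ p) * a ^ p" by (simp add: power_mult_distrib)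
    also have "\<dots> \<le> (a * (c / 4)) * a ^ p"
    proof (intro mult_right_mono)
      have "4 * C * 2 ^ p \<le> a * c" using U(3) a1 c by (simp add: divide_le_eq) (meson order_trans mult_right_mono less_imp_le)
      then show "C * 2 ^ p \<le> a * (c / 4)" by simp
    qed (use a1 in auto)
    also have "\<dots> = a ^ ?N * (c / 4)" by simp
    also have "\<dots> \<le> a ^ (2 * ?N) * (c / 4)"
      using a1 c by (intro mult_right_mono power_increasing) auto
    finally have "C * (1 + a) ^ p * exp (k * a) \<le> a ^ (2 * ?N) * (c / 4) * exp (k * a)"
      by (rule mult_right_mono) simp
    then have 2: "exp (C * (1 + a) ^ p * exp (k * a)) \<le> exp (a ^ (2 * ?N) * (c / 4 * exp (k * a)))"
      by (simp add: mult.assoc)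
    have "cmod (gau p k w) * exp (C * (1 + a) ^ p * exp (k * a))
        \<le> exp (- (a ^ (2 * ?N) * (c / 4 * exp (k * a)))) * exp (a ^ (2 * ?N) * (c / 4 * exp (k * a)))"
      by (rule mult_mono[OF 1 2]) auto
    also have "\<dots> = 1" by (simp flip: exp_add)
    finally show ?thesis by (simp add: a_def u_def)
  qed
  define R where "R = cbox (Complex (- U) (- v0)) (Complex U v0)"
  have "compact (gau p k ` R)"
    unfolding R_def by (intro compact_continuous_image holomorphic_on_imp_continuous_on gau_holomorphic) simp
  then have "\<exists>S. \<forall>w\<in>R. cmod (gau p k w) \<le> S"
    by (auto dest!: compact_imp_bounded simp: bounded_iff)
  then obtain D1 where D1: "\<And>w. w \<in> R \<Longrightarrow> cmod (gau p k w) \<le> D1" by blast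
  have D10: "D1 \<ge> 0"
    using order_trans[OF norm_ge_zero D1[of 0]] v0 U by (simp add: R_def in_cbox_complex_iff)
  show ?thesis
  proof (intro exI[of _ "max 1 (D1 * exp (C * (1 + U) ^ p * exp (k * U)))"] conjI allI impI)
    fix w assume w: "\<bar>Im w\<bar> \<le> v0"
    show "cmod (gau p k w) * exp (C * (1 + \<bar>Re w\<bar>) ^ p * exp (k * \<bar>Re w\<bar>)) \<le> max 1 (D1 * exp (C * (1 + U) ^ p * exp (k * U)))"
    proof (cases "\<bar>Re w\<bar> \<ge> U")
      case False
      then have "cmod (gau p k w) \<le> D1" using w by (intro D1) (auto simp: R_def in_cbox_complex_iff abs_le_iff)
      moreover have "C * (1 + \<bar>Re w\<bar>) ^ p * exp (k * \<bar>Re w\<bar>) \<le> C * (1 + U) ^ p * exp (k * U)"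
        using False C k U by (intro mult_mono power_mono) auto
      ultimately have "cmod (gau p k w) * exp (C * (1 + \<bar>Re w\<bar>) ^ p * exp (k * \<bar>Re w\<bar>)) \<le> D1 * exp (C * (1 + U) ^ p * exp (k * U))"
        using D10 by (intro mult_mono) auto
      then show ?thesis by simp
    qed (use big[OF w] in simp)
  qed simp
qed

text \<open>The interpolating function: entire, bounded on horizontal strips, and among the integers
  nonzero only at 0. The value at 0 fills the removable singularity.\<close>

definition intp :: "complex \<Rightarrow> complex"
  where "intp w = (if w = 0 then 2 * pi * \<i> else (exp (2 * pi * \<i> * w) - 1) / w)"

lemma intp_holomorphic: "intp holomorphic_on S"
proof -
  have "((\<lambda>w. exp (2 * pi * \<i> * w)) has_field_derivative 2 * pi * \<i>) (at 0)"
    by (auto intro!: derivative_eq_intros)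
  then have "deriv (\<lambda>w. exp (2 * pi * \<i> * w)) 0 = 2 * pi * \<i>" by (rule DERIV_imp_deriv)
  moreover have "(\<lambda>w. if w = 0 then deriv (\<lambda>w. exp (2 * pi * \<i> * w)) 0 else (exp (2 * pi * \<i> * w) - exp (2 * pi * \<i> * 0)) / (w - 0)) holomorphic_on UNIV"
    by (rule pole_lemma) (auto intro!: holomorphic_intros)
  ultimately have "intp holomorphic_on UNIV"
    by (simp only: intp_def[abs_def] mult_zero_right exp_zero diff_zero)
  then show ?thesis by (rule holomorphic_on_subset) simp
qed

lemma intp_int: "intp (of_int j) = 0 \<longleftrightarrow> j \<noteq> 0"
proof -
  have "exp (2 * pi * \<i> * of_int j) = 1" unfolding exp_eq_1 by (auto intro!: exI[of _ j])
  then show ?thesis by (simp add: intp_def)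
qed

lemma intp_bound: "\<exists>S\<ge>0. \<forall>w. \<bar>Im w\<bar> \<le> b \<longrightarrow> cmod (intp w) \<le> S"
proof -
  have "compact (intp ` cball 0 1)"
    by (intro compact_continuous_image holomorphic_on_imp_continuous_on intp_holomorphic) simp
  then have "\<exists>S. \<forall>w\<in>cball 0 1. cmod (intp w) \<le> S"
    by (auto dest!: compact_imp_bounded simp: bounded_iff)
  then obtain S1 where S1: "\<And>w. w \<in> cball 0 1 \<Longrightarrow> cmod (intp w) \<le> S1" by blast
  show ?thesis
  proof (intro exI[of _ "max S1 (exp (2 * pi * b) + 1)"] conjI allI impI)
    fix w assume w: "\<bar>Im w\<bar> \<le> b"
    show "cmod (intp w) \<le> max S1 (exp (2 * pi * b) + 1)"
    proof (cases "w \<in> cball 0 1")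
      case False
      then have w1: "cmod w > 1" by simp
      have "cmod (exp (2 * pi * \<i> * w) - 1) \<le> cmod (exp (2 * pi * \<i> * w)) + 1" using norm_triangle_ineq4[of "exp (2 * pi * \<i> * w)" 1] by simp
      also have "cmod (exp (2 * pi * \<i> * w)) \<le> exp (2 * pi * b)"
        using w mult_left_mono[of "- Im w" b pi] by simp
      finally have "cmod (exp (2 * pi * \<i> * w) - 1) \<le> exp (2 * pi * b) + 1" by simp
      moreover have "cmod (intp w) \<le> cmod (exp (2 * pi * \<i> * w) - 1)"
        using w1 by (auto simp: intp_def norm_divide divide_le_eq intro: mult_left_le order_trans[OF _ mult_left_mono[of 1 "cmod w"]])
      ultimately show ?thesis by simp
    qed (use S1 in \<open>simp add: le_max_iff_disj\<close>)
  qed (simp add: le_max_iff_disj add_nonneg_nonneg)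
qed

text \<open>Dominated convergence as t grows: without a lower bound for \<delta> uniform in j,
  finitely many indices are damped by t, and the remaining tail is small by summability.\<close>

lemma exp_weight_small:
  fixes a \<delta> :: "int \<Rightarrow> real"
  assumes a: "a summable_on UNIV" "\<And>j. a j \<ge> 0" and \<delta>: "\<And>j. \<delta> j > 0" and e: "e > 0"
  shows "\<exists>t\<ge>0. (\<Sum>\<^sub>\<infinity>j. a j * exp (- t * \<delta> j)) < e"
proof -
  obtain F where F: "finite F" "infsum a UNIV - sum a F < e / 2"
  proof -
    have "(sum a \<longlongrightarrow> infsum a UNIV) (finite_subsets_at_top UNIV)"
      using a(1) infsum_tendsto by blast
    then have "\<forall>\<^sub>F F in finite_subsets_at_top UNIV. dist (sum a F) (infsum a UNIV) < e / 2"
      using e by (intro tendstoD) auto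
    then obtain F where "finite F" "dist (sum a F) (infsum a UNIV) < e / 2"
      unfolding eventually_finite_subsets_at_top by blast
    then show ?thesis using that by (auto simp: dist_real_def abs_if split: if_splits)
  qed
  have "((\<lambda>t. \<Sum>j\<in>F. a j * exp (- t * \<delta> j)) \<longlongrightarrow> (\<Sum>j\<in>F. a j * 0)) at_top"
  proof (intro tendsto_intros)
    show "((\<lambda>t. exp (- t * \<delta> j)) \<longlongrightarrow> 0) at_top" for j using \<delta>[of j] by real_asymp
  qed
  then have "\<forall>\<^sub>F t in at_top. (\<Sum>j\<in>F. a j * exp (- t * \<delta> j)) < e / 2"
    using e by (intro order_tendstoD) auto
  then have "\<forall>\<^sub>F t in at_top. (\<Sum>j\<in>F. a j * exp (- t * \<delta> j)) < e / 2 \<and> t \<ge> 0"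
    by (intro eventually_conj eventually_ge_at_top)
  then obtain t where t: "(\<Sum>j\<in>F. a j * exp (- t * \<delta> j)) < e / 2" "t \<ge> 0"
    by (auto simp: eventually_at_top_linorder)
  define g where "g j = a j * exp (- t * \<delta> j)" for j
  have le: "g j \<le> a j" for j
    using a(2)[of j] t(2) \<delta>[of j] by (simp add: mult_left_le g_def)
  have sa: "a summable_on S" for S by (rule summable_on_subset_banach[OF a(1)]) simp
  have s: "g summable_on S" for S
    by (rule summable_on_comparison_test[OF sa]) (use a(2) le in \<open>auto simp: g_def\<close>)
  have "infsum g UNIV = infsum g F + infsum g (- F)"
    using infsum_Un_disjoint[OF s s, of F "- F"] by simp
  also have "infsum g F = sum g F" using F by simp
  also have "infsum g (- F) \<le> infsum a (- F)"
    by (rule infsum_mono[OF s sa le])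
  also have "infsum a (- F) = infsum a UNIV - sum a F"
    using infsum_Un_disjoint[OF sa sa, of F "- F"] F by simp
  finally have "infsum g UNIV \<le> sum g F + (infsum a UNIV - sum a F)" by simp
  also have "\<dots> < e" using t(1) F(2) by (simp add: g_def)
  finally show ?thesis using t(2) by (intro exI[of _ t]) (simp add: g_def[abs_def])
qed

text \<open>Converts unordered sums into sequences of partial sums, the form that
  \<open>cholo_uniform_limit\<close> takes.\<close>

lemma filterlim_symmetric_intervals:
  "filterlim (\<lambda>n. {- int n..int n}) (finite_subsets_at_top UNIV) sequentially"
  unfolding filterlim_finite_subsets_at_top
proof (intro allI impI)
  fix X :: "int set" assume X: "finite X \<and> X \<subseteq> UNIV"
  define N where "N = nat (\<Sum>x\<in>X. \<bar>x\<bar>)"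
  have "X \<subseteq> {- int n..int n}" if "n \<ge> N" for n
  proof
    fix x assume "x \<in> X"
    then have "\<bar>x\<bar> \<le> (\<Sum>x\<in>X. \<bar>x\<bar>)" using X by (intro member_le_sum) auto
    also have "\<dots> \<le> int n" using that by (simp add: N_def)
    finally show "x \<in> {- int n..int n}" by auto
  qed
  then show "\<forall>\<^sub>F n in sequentially. finite {- int n..int n} \<and> X \<subseteq> {- int n..int n} \<and> {- int n..int n} \<subseteq> UNIV"
    by (auto simp: eventually_sequentially)
qed

text \<open>Rounding t b to an integer exponent changes each coordinate by less than 1, so the error
  does not grow with t.\<close>

lemma inner_ip: "\<bar>ip (\<chi> k. \<lfloor>t * b $ k\<rfloor>) y - t * (b \<bullet> y)\<bar> \<le> real CARD('d) * norm y"
  for b y :: "real^'d"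
proof -
  have "ip (\<chi> k. \<lfloor>t * b $ k\<rfloor>) y - t * (b \<bullet> y) = (\<Sum>k\<in>UNIV. (of_int \<lfloor>t * b $ k\<rfloor> - t * b $ k) * y $ k)"
    by (simp add: ip_def inner_vec_def sum_distrib_left sum_subtractf left_diff_distrib mult.assoc)
  also have "\<bar>\<dots>\<bar> \<le> (\<Sum>k\<in>UNIV. \<bar>(of_int \<lfloor>t * b $ k\<rfloor> - t * b $ k) * y $ k\<bar>)" by (rule sum_abs)
  also have "\<dots> \<le> (\<Sum>k\<in>(UNIV::'d set). 1 * norm y)"
  proof (intro sum_mono)
    fix k
    have "\<bar>of_int \<lfloor>t * b $ k\<rfloor> - t * b $ k\<bar> \<le> 1" by linarith
    then show "\<bar>(of_int \<lfloor>t * b $ k\<rfloor> - t * b $ k) * y $ k\<bar> \<le> 1 * norm y"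
      unfolding abs_mult by (intro mult_mono component_le_norm_cart) auto
  qed
  finally show ?thesis by simp
qed

section \<open>Functions on the bundle as sums over the action\<close>

context monomial_bundle
begin

text \<open>The seed consisting of intp (w - w0), gau w and the monomial \<alpha>, evaluated at the
  image of x under j; as for a Poincare series, summing over j makes it invariant.\<close>

definition tm :: "nat \<Rightarrow> int^'d \<Rightarrow> complex \<Rightarrow> int \<Rightarrow> complex^('d option) \<Rightarrow> complex"
  where "tm p \<alpha> w0 j x = intp (fst_vec x + of_int j - w0) * gau p (2 * pi\<^sup>2 / m) (fst_vec x + of_int j)
    * lmono (\<alpha> v* zmat M j) (snd_vec x)"

definition ser :: "nat \<Rightarrow> int^'d \<Rightarrow> complex \<Rightarrow> complex^('d option) \<Rightarrow> complex"
  where "ser p \<alpha> w0 x = (\<Sum>\<^sub>\<infinity>j. tm p \<alpha> w0 j x)"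

text \<open>A representative of the class is chosen, so the value is meaningful for invariant
  \<Phi>.\<close>

definition desc :: "(complex^('d option) \<Rightarrow> complex) \<Rightarrow> (complex^('d option)) set \<Rightarrow> complex"
  where "desc \<Phi> X = \<Phi> (inv_into Om q X)"

lemma desc_q:
  assumes "\<And>x j. x \<in> Om \<Longrightarrow> \<Phi> (diagonal_action M j x) = \<Phi> x" and x: "x \<in> Om"
  shows "desc \<Phi> (q x) = \<Phi> x"
proof -
  have y: "inv_into Om q (q x) \<in> Om" "q (inv_into Om q (q x)) = q x"
    using inv_into_into[of "q x" q Om] f_inv_into_f[of "q x" q Om] x by simp_all
  then obtain j where "x = diagonal_action M j (inv_into Om q (q x))" using q_eq[OF y(1) x] by auto
  then show ?thesis using assms(1)[OF y(1), of j] by (simp add: desc_def)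
qed

lemma desc_hol:
  assumes "\<And>x j. x \<in> Om \<Longrightarrow> \<Phi> (diagonal_action M j x) = \<Phi> x" and "cholomorphic_on \<Phi> Om"
  shows "desc \<Phi> \<in> holomorphic_functions E"
  unfolding hol_iff
proof (rule cholomorphic_on_local)
  fix z assume "z \<in> Om"
  then show "\<exists>N g E. open N \<and> z \<in> N \<and> z \<in> E \<and> cholomorphic_on g E \<and> (\<forall>y\<in>N. desc \<Phi> (q y) = g y)"
    using assms open_Om desc_q by blast
qed

lemma compact_in_Om:
  assumes C: "compact C" "C \<subseteq> Om"
  shows "\<exists>R v. 0 \<le> v \<and> v < m / (4 * pi) \<and> (\<forall>x\<in>C. \<bar>Re (fst_vec x)\<bar> \<le> R \<and> \<bar>Im (fst_vec x)\<bar> \<le> v \<and> norm (lgv (snd_vec x)) \<le> R)"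
proof (cases "C = {}")
  case True
  then show ?thesis using m by (intro exI[of _ 0]) auto
next
  case False
  have cf: "continuous_on C (\<lambda>x. \<bar>Re (fst_vec x)\<bar>)" "continuous_on C (\<lambda>x. \<bar>Im (fst_vec x)\<bar>)"
    by (intro continuous_intros)+
  have cl: "continuous_on C (\<lambda>x. norm (lgv (snd_vec x)))"
    by (intro continuous_on_norm continuous_on_compose2[OF continuous_on_lgv] continuous_intros)
      (use C(2) in \<open>auto simp: Om_iff Rein_def\<close>)
  obtain a where a: "a \<in> C" "\<forall>x\<in>C. \<bar>Re (fst_vec x)\<bar> \<le> \<bar>Re (fst_vec a)\<bar>"
    using continuous_attains_sup[OF C(1) False cf(1)] by blast
  obtain b where b: "b \<in> C" "\<forall>x\<in>C. \<bar>Im (fst_vec x)\<bar> \<le> \<bar>Im (fst_vec b)\<bar>"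
    using continuous_attains_sup[OF C(1) False cf(2)] by blast
  obtain c where c: "c \<in> C" "\<forall>x\<in>C. norm (lgv (snd_vec x)) \<le> norm (lgv (snd_vec c))"
    using continuous_attains_sup[OF C(1) False cl] by blast
  have "\<bar>Im (fst_vec b)\<bar> < m / (4 * pi)" using b(1) C(2) by (auto simp: Om_iff strip_def)
  then show ?thesis using a b c
    by (intro exI[of _ "\<bar>Re (fst_vec a)\<bar> + norm (lgv (snd_vec c))"] exI[of _ "\<bar>Im (fst_vec b)\<bar>"]) (auto intro: add_increasing add_increasing2)
qed

text \<open>For c = 1 and c = - 1 these are the coordinate of the base annulus and its inverse;
  together they bound Im w on hulls.\<close>

definition ex :: "complex \<Rightarrow> complex^('d option) \<Rightarrow> complex"
  where "ex c x = exp (c * (2 * pi * \<i>) * fst_vec x)"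

lemma ex_act:
  assumes x: "x \<in> Om" and c: "c = 1 \<or> c = - 1"
  shows "ex c (diagonal_action M j x) = ex c x"
proof -
  have "exp (c * (2 * pi * \<i>) * of_int j) = 1"
    using c unfolding exp_eq_1 by (elim disjE) (auto intro: exI[of _ j] exI[of _ "- j"])
  then show ?thesis unfolding act_eq[OF x] ex_def by (simp add: distrib_left exp_add)
qed

lemma ex_hol: "cholomorphic_on (ex c) Om"
proof -
  have "cholomorphic_on (\<lambda>x. (\<lambda>w. exp (c * (2 * pi * \<i>) * w)) (x $ None)) Om"
    by (rule cholo_compose[OF cholo_nth, of _ UNIV]) (auto intro!: holomorphic_intros)
  then show ?thesis by (simp add: ex_def[abs_def] fst_vec_def)
qed

lemma hol_exp: "c = 1 \<or> c = - 1 \<Longrightarrow> desc (ex c) \<in> holomorphic_functions E"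
  by (intro desc_hol ex_act ex_hol)

lemma desc_exp: "c = 1 \<or> c = - 1 \<Longrightarrow> x \<in> Om \<Longrightarrow> desc (ex c) (q x) = ex c x"
  by (intro desc_q ex_act)

lemma tm_hol: "cholomorphic_on (tm p \<alpha> w0 j) Om"
proof -
  have 1: "cholomorphic_on (\<lambda>x. (\<lambda>w. intp (w + of_int j - w0) * gau p (2 * pi\<^sup>2 / m) (w + of_int j)) (x $ None)) Om"
  proof (rule cholo_compose[OF cholo_nth, of _ UNIV])
    have "(intp \<circ> (\<lambda>w. w + of_int j - w0)) holomorphic_on UNIV" "(gau p (2 * pi\<^sup>2 / m) \<circ> (\<lambda>w. w + of_int j)) holomorphic_on UNIV"
      by (intro holomorphic_on_compose holomorphic_intros intp_holomorphic gau_holomorphic)+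
    then show "(\<lambda>w. intp (w + of_int j - w0) * gau p (2 * pi\<^sup>2 / m) (w + of_int j)) holomorphic_on UNIV"
      unfolding o_def by (rule holomorphic_on_mult)
  qed auto
  have 2: "cholomorphic_on (\<lambda>x. \<Prod>k\<in>UNIV. (x $ Some k) powi ((\<alpha> v* zmat M j) $ k)) Om"
    by (intro cholo_prod cholo_powi cholo_nth) (auto simp: Om_nz)
  have "tm p \<alpha> w0 j = (\<lambda>x. (\<lambda>w. intp (w + of_int j - w0) * gau p (2 * pi\<^sup>2 / m) (w + of_int j)) (x $ None)
      * (\<Prod>k\<in>UNIV. (x $ Some k) powi ((\<alpha> v* zmat M j) $ k)))"
    by (simp add: tm_def fun_eq_iff fst_vec_def snd_vec_def lmono_def)
  then show ?thesis using cholo_mult[OF 1 2] by simp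
qed

lemma tm_act:
  assumes "x \<in> Om"
  shows "tm p \<alpha> w0 j (diagonal_action M i x) = tm p \<alpha> w0 (j + i) x"
proof -
  have "snd_vec x \<in> ctorus" using assms by (simp add: Om_iff Rein_def)
  then show ?thesis
    unfolding act_eq[OF assms] tm_def
    by (simp add: lmono_monomial_map vmat_assoc add_ac flip: zmat_add[OF inv])
qed

lemma ser_act:
  assumes "x \<in> Om"
  shows "ser p \<alpha> w0 (diagonal_action M i x) = ser p \<alpha> w0 x"
proof -
  have "ser p \<alpha> w0 (diagonal_action M i x) = (\<Sum>\<^sub>\<infinity>j. tm p \<alpha> w0 (j + i) x)"
    by (simp add: ser_def tm_act[OF assms])
  also have "\<dots> = ser p \<alpha> w0 x"
    unfolding ser_def by (rule infsum_reindex_bij_betw, rule bij_betwI[of _ _ _ "\<lambda>j. j - i"]) auto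
  finally show ?thesis .
qed

lemma norm_tm:
  assumes "x \<in> Om"
  shows "cmod (tm p \<alpha> w0 j x) = cmod (intp (fst_vec x + of_int j - w0)) * cmod (gau p (2 * pi\<^sup>2 / m) (fst_vec x + of_int j))
    * exp (ip \<alpha> (imat (zmat M j) *v lgv (snd_vec x)))"
proof -
  have "snd_vec x \<in> ctorus" using assms by (simp add: Om_iff Rein_def)
  then show ?thesis by (simp add: tm_def norm_mult norm_lmono ip_vmat)
qed

text \<open>At w = w0 the interpolating factor kills every term except j = 0.\<close>

lemma ser_at_base:
  assumes "x \<in> Om" "fst_vec x = w0"
  shows "ser p \<alpha> w0 x = intp 0 * gau p (2 * pi\<^sup>2 / m) w0 * lmono \<alpha> (snd_vec x)"
proof -
  have "tm p \<alpha> w0 j x = 0" if "j \<noteq> 0" for j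
    using that assms(2) intp_int[of j] by (simp add: tm_def)
  then have "ser p \<alpha> w0 x = tm p \<alpha> w0 0 x"
    unfolding ser_def using infsum_cong_neutral[of "{0}" UNIV "\<lambda>j. tm p \<alpha> w0 j x" "\<lambda>j. tm p \<alpha> w0 j x"] by auto
  then show ?thesis using assms(2) by (simp add: tm_def)
qed

end

text \<open>The exponential rate is the one built into \<open>gau\<close>, and p leaves room for
  Jordan blocks even when the spectral radius attains this rate.\<close>

locale monomial_bundle_growth = monomial_bundle M m B
  for M :: "int^'d^'d" and m :: real and B :: "(real^'d) set" +
  fixes p :: nat and C0 :: real
  assumes C0: "C0 \<ge> 0"
    and growth: "\<And>j x. norm (imat (zmat M j) *v (x :: real^'d)) \<le>
      C0 * (1 + \<bar>of_int j\<bar>) ^ p * exp (2 * pi\<^sup>2 / m * \<bar>of_int j\<bar>) * norm x"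
begin

text \<open>The constant is uniform in w0 because the hull argument centres the series at varying
  base points. The multiplier \<open>c\<close> stands for a bound on the exponent \<alpha> or on the
  error of rounding it.\<close>

lemma term_bound:
  assumes c: "c \<ge> 0" and R: "R \<ge> 0" and v: "0 \<le> v" "v < m / (4 * pi)"
  shows "\<exists>D\<ge>0. \<forall>j w w0 x. \<bar>Im w\<bar> \<le> v \<longrightarrow> \<bar>Im w0\<bar> \<le> v \<longrightarrow> \<bar>Re w\<bar> \<le> R \<longrightarrow> norm (x :: real^'d) \<le> R \<longrightarrow>
    cmod (intp (w + of_int j - w0)) * cmod (gau p (2 * pi\<^sup>2 / m) (w + of_int j)) * exp (c * norm (imat (zmat M j) *v x))
      \<le> D * exp (- \<bar>of_int j\<bar>)"
proof -
  define k where "k = 2 * pi\<^sup>2 / m"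
  have k: "k > 0" using m by (simp add: k_def)
  \<comment> \<open>The critical inequality: at the rate 2 pi^2 / m the edge of the strip is where
    cos (k Im w) reaches 0.\<close>
  have kv: "k * v < pi / 2"
  proof -
    have "k * v < k * (m / (4 * pi))" using k v by (intro mult_strict_left_mono) auto
    also have "\<dots> = pi / 2" using m by (simp add: k_def power2_eq_square)
    finally show ?thesis .
  qed
  \<comment> \<open>The summand 1 / k pays for the additional decay exp (- \<bar>j\<bar>), and the
    factors with R for replacing \<bar>j\<bar> by \<bar>Re (w + j)\<bar>.\<close>
  define C where "C = (c * C0 * R + 1 / k) * (1 + R) ^ p * exp (k * R)"
  have C: "C \<ge> 0" using c C0 R k by (simp add: C_def)
  obtain D where D: "D \<ge> 0" "\<And>w. \<bar>Im w\<bar> \<le> v \<Longrightarrow> cmod (gau p k w) * exp (C * (1 + \<bar>Re w\<bar>) ^ p * exp (k * \<bar>Re w\<bar>)) \<le> D"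
    using gau_decay[OF k v(1) kv C] by blast
  obtain S where S: "S \<ge> 0" "\<And>w. \<bar>Im w\<bar> \<le> 2 * v \<Longrightarrow> cmod (intp w) \<le> S" using intp_bound by blast
  show ?thesis
  proof (intro exI[of _ "S * D"] conjI allI impI)
    fix j and w w0 :: complex and x :: "real^'d"
    assume w: "\<bar>Im w\<bar> \<le> v" "\<bar>Im w0\<bar> \<le> v" "\<bar>Re w\<bar> \<le> R" and x: "norm x \<le> R"
    define J where "J = \<bar>of_int j :: real\<bar>"
    define U where "U = \<bar>Re (w + of_int j)\<bar>"
    have J0: "J \<ge> 0" by (simp add: J_def)
    have JU: "J \<le> U + R" using w(3) by (simp add: J_def U_def)
    have U0: "U \<ge> 0" by (simp add: U_def)
    let ?e = "(1 + J) ^ p * exp (k * J)"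
    have "c * norm (imat (zmat M j) *v x) \<le> c * (C0 * ?e * R)"
    proof (rule mult_left_mono[OF _ c])
      have "norm (imat (zmat M j) *v x) \<le> C0 * ?e * norm x"
        using growth[of j x] by (simp add: J_def k_def mult.assoc)
      also have "\<dots> \<le> C0 * ?e * R" using C0 x J0 by (intro mult_left_mono) auto
      finally show "norm (imat (zmat M j) *v x) \<le> C0 * ?e * R" .
    qed
    moreover have "J \<le> 1 / k * ?e"
    proof -
      have "k * J \<le> exp (k * J)" using exp_ge_add_one_self[of "k * J"] by linarith
      also have "\<dots> \<le> ?e" using J0 mult_right_mono[OF one_le_power[of "1 + J" p], of "exp (k * J)"] by simp
      finally show ?thesis using k by (simp add: field_simps)
    qed
    ultimately have "c * norm (imat (zmat M j) *v x) + J \<le> (c * C0 * R + 1 / k) * ?e"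
      by (simp add: algebra_simps)
    also have "?e \<le> ((1 + R) * (1 + U)) ^ p * exp (k * (R + U))"
    proof (intro mult_mono power_mono)
      have "1 + J \<le> 1 + (U + R)" using JU by simp
      also have "\<dots> \<le> (1 + R) * (1 + U)" using R U0 by (simp add: algebra_simps)
      finally show "1 + J \<le> (1 + R) * (1 + U)" .
      show "exp (k * J) \<le> exp (k * (R + U))" using JU k by simp
    qed (use J0 R U0 in auto)
    also have "(c * C0 * R + 1 / k) * (((1 + R) * (1 + U)) ^ p * exp (k * (R + U))) = C * (1 + U) ^ p * exp (k * U)"
      by (simp only: C_def power_mult_distrib distrib_left[of k R U] exp_add mult_ac)
    finally have ex: "c * norm (imat (zmat M j) *v x) + J \<le> C * (1 + U) ^ p * exp (k * U)"
      using c C0 R k by (simp add: mult_left_mono)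
    have "cmod (gau p k (w + of_int j)) * exp (c * norm (imat (zmat M j) *v x)) * exp J
        = cmod (gau p k (w + of_int j)) * exp (c * norm (imat (zmat M j) *v x) + J)"
      by (simp add: exp_add)
    also have "\<dots> \<le> cmod (gau p k (w + of_int j)) * exp (C * (1 + U) ^ p * exp (k * U))"
      using ex by (intro mult_left_mono) auto
    also have "\<dots> \<le> D" unfolding U_def using w by (intro D(2)) simp
    finally have g: "cmod (gau p k (w + of_int j)) * exp (c * norm (imat (zmat M j) *v x)) \<le> D * exp (- J)"
      by (simp add: exp_minus field_simps)
    have s: "cmod (intp (w + of_int j - w0)) \<le> S" using w by (intro S(2)) simp
    show "cmod (intp (w + of_int j - w0)) * cmod (gau p (2 * pi\<^sup>2 / m) (w + of_int j)) * exp (c * norm (imat (zmat M j) *v x))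
        \<le> S * D * exp (- \<bar>of_int j\<bar>)"
      using mult_mono[OF s g] S(1) by (simp add: J_def k_def mult.assoc)
  qed (use S D in simp)
qed

lemma summable_weights: "(\<lambda>j :: int. D * exp (- \<bar>real_of_int j\<bar>)) summable_on UNIV"
  using summable_on_cmult_right[OF summable_on_exp_int[of 1], of D] by simp

lemma tm_bound:
  assumes C: "\<And>x. x \<in> C \<Longrightarrow> x \<in> Om \<and> \<bar>Re (fst_vec x)\<bar> \<le> R \<and> \<bar>Im (fst_vec x)\<bar> \<le> v \<and> norm (lgv (snd_vec x)) \<le> R"
    and v: "0 \<le> v" "v < m / (4 * pi)" and R: "R \<ge> 0"
  shows "\<exists>D\<ge>0. \<forall>w0. \<bar>Im w0\<bar> \<le> v \<longrightarrow> (\<forall>x\<in>C. \<forall>j. cmod (tm p \<alpha> w0 j x) \<le> D * exp (- \<bar>of_int j\<bar>))"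
proof -
  obtain L where L: "L > 0" "\<And>x :: real^'d. \<bar>ip \<alpha> x\<bar> \<le> L * norm x" using ip_bound by blast
  obtain D where D: "D \<ge> 0" "\<And>j w w0 x. \<bar>Im w\<bar> \<le> v \<Longrightarrow> \<bar>Im w0\<bar> \<le> v \<Longrightarrow> \<bar>Re w\<bar> \<le> R \<Longrightarrow> norm (x :: real^'d) \<le> R \<Longrightarrow>
    cmod (intp (w + of_int j - w0)) * cmod (gau p (2 * pi\<^sup>2 / m) (w + of_int j)) * exp (L * norm (imat (zmat M j) *v x))
      \<le> D * exp (- \<bar>of_int j\<bar>)"
    using term_bound[OF less_imp_le[OF L(1)] R v] by blast
  show ?thesis
  proof (intro exI[of _ D] conjI allI impI ballI D(1))
    fix w0 x j assume w0: "\<bar>Im w0\<bar> \<le> v" and x: "x \<in> C"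
    have le: "exp (ip \<alpha> (imat (zmat M j) *v lgv (snd_vec x))) \<le> exp (L * norm (imat (zmat M j) *v lgv (snd_vec x)))"
      using L(2)[of "imat (zmat M j) *v lgv (snd_vec x)"] by simp
    have "cmod (tm p \<alpha> w0 j x) \<le> cmod (intp (fst_vec x + of_int j - w0)) * cmod (gau p (2 * pi\<^sup>2 / m) (fst_vec x + of_int j))
        * exp (L * norm (imat (zmat M j) *v lgv (snd_vec x)))"
      using C[OF x] le by (simp add: norm_tm mult_left_mono)
    also have "\<dots> \<le> D * exp (- \<bar>of_int j\<bar>)" using C[OF x] w0 by (intro D(2)) auto
    finally show "cmod (tm p \<alpha> w0 j x) \<le> D * exp (- \<bar>of_int j\<bar>)" .
  qed
qed

lemma ser_hol:
  assumes w0: "w0 \<in> strip m"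
  shows "cholomorphic_on (ser p \<alpha> w0) Om"
proof (rule cholo_uniform_limit[where f = "\<lambda>n x. \<Sum>j\<in>{- int n..int n}. tm p \<alpha> w0 j x"])
  show "cholomorphic_on (\<lambda>x. \<Sum>j\<in>{- int n..int n}. tm p \<alpha> w0 j x) Om" for n
    by (intro cholo_sum tm_hol) auto
  fix z assume z: "z \<in> Om"
  then obtain r where r: "r > 0" "cball z r \<subseteq> Om" using open_Om open_contains_cball by blast
  obtain R v where Rv: "0 \<le> v" "v < m / (4 * pi)"
      "\<And>x. x \<in> cball z r \<Longrightarrow> \<bar>Re (fst_vec x)\<bar> \<le> R \<and> \<bar>Im (fst_vec x)\<bar> \<le> v \<and> norm (lgv (snd_vec x)) \<le> R"
    using compact_in_Om[OF compact_cball r(2)] by blast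
  \<comment> \<open>Both the points of the ball and the centre w0 must lie in the substrip on which
    the terms are estimated.\<close>
  define v' where "v' = max v \<bar>Im w0\<bar>"
  have v': "0 \<le> v'" "v' < m / (4 * pi)" "v \<le> v'" "\<bar>Im w0\<bar> \<le> v'" using Rv w0 by (auto simp: v'_def strip_def)
  have R0: "R \<ge> 0" using Rv(3)[of z] r(1) by (auto intro: order_trans[OF norm_ge_zero])
  obtain D where D: "\<And>x j. x \<in> cball z r \<Longrightarrow> cmod (tm p \<alpha> w0 j x) \<le> D * exp (- \<bar>of_int j\<bar>)"
    using tm_bound[of "cball z r" R v' \<alpha>] r(2) Rv(3) v' R0 by (smt (verit, best) subsetD)
  have "uniform_limit (cball z r) (\<lambda>F x. \<Sum>j\<in>F. tm p \<alpha> w0 j x) (\<lambda>x. \<Sum>\<^sub>\<infinity>j\<in>UNIV. tm p \<alpha> w0 j x) (finite_subsets_at_top UNIV)"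
    by (rule Weierstrass_m_test_general[OF D summable_weights])
  then have "uniform_limit (cball z r) (\<lambda>n x. \<Sum>j\<in>{- int n..int n}. tm p \<alpha> w0 j x) (ser p \<alpha> w0) sequentially"
    unfolding ser_def[abs_def] by (rule filterlim_compose[OF _ filterlim_symmetric_intervals])
  then show "\<exists>r>0. cball z r \<subseteq> Om \<and> uniform_limit (cball z r) (\<lambda>n x. \<Sum>j\<in>{- int n..int n}. tm p \<alpha> w0 j x) (ser p \<alpha> w0) sequentially"
    using r by blast
qed

section \<open>Separation of points and local coordinates\<close>

lemma ser_desc: "w0 \<in> strip m \<Longrightarrow> desc (ser p \<alpha> w0) \<in> holomorphic_functions E"
  by (intro desc_hol ser_act ser_hol)

lemma ser_desc_q: "x \<in> Om \<Longrightarrow> desc (ser p \<alpha> w0) (q x) = ser p \<alpha> w0 x"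
  by (intro desc_q ser_act)

lemma ip_axis1: "lmono (axis k 1) z = z $ k"
  by (simp add: lmono_axis)

text \<open>The annulus coordinate separates points over different base points. Otherwise the action
  moves both points into one fibre, where the series with seed z_k restrict to nonzero multiples of
  the coordinates.\<close>

theorem separable: "holomorphically_separable E"
  unfolding holomorphically_separable_def fst_E topspace_Q
proof (intro ballI impI)
  fix X Y assume "X \<in> q ` Om" "Y \<in> q ` Om" and ne: "X \<noteq> Y"
  then obtain x y where x: "x \<in> Om" "X = q x" and y: "y \<in> Om" "Y = q y" by auto
  let ?e = "desc (ex 1)"
  show "\<exists>f\<in>holomorphic_functions E. f X \<noteq> f Y"
  proof (cases "?e X = ?e Y")
    case False
    then show ?thesis using hol_exp[of 1] by blast
  next
    case True
    then have "exp (2 * pi * \<i> * fst_vec x) = exp (2 * pi * \<i> * fst_vec y)"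
      using desc_exp[of 1 x] desc_exp[of 1 y] x y by (simp add: ex_def)
    then obtain n where "2 * pi * \<i> * fst_vec x = 2 * pi * \<i> * fst_vec y + of_int (2 * n) * pi * \<i>"
      unfolding exp_eq by blast
    then have "(2 * pi * \<i>) * fst_vec x = (2 * pi * \<i>) * (fst_vec y + of_int n)" by (simp add: algebra_simps)
    then have n: "fst_vec x = fst_vec y + of_int n" by (subst (asm) mult_cancel_left) auto
    define y' where "y' = diagonal_action M n y"
    have y': "y' \<in> Om" "q y' = Y" "fst_vec y' = fst_vec x"
      unfolding y'_def using act_in[OF y(1), of n] q_act[OF y(1), of n] y(2) n
      by (simp_all add: act_eq[OF y(1)])
    have "snd_vec x \<noteq> snd_vec y'"
    proof
      assume "snd_vec x = snd_vec y'"
      then have "x = y'" using y'(3) pair_fst_snd by metis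
      then show False using ne x y' by simp
    qed
    then obtain k where k: "snd_vec x $ k \<noteq> snd_vec y' $ k" by (auto simp: vec_eq_iff)
    let ?f = "desc (ser p (axis k 1) (fst_vec x))"
    have "?f X \<noteq> ?f Y"
      using k intp_int[of 0] gau_nz x y' unfolding x(2) y'(2)[symmetric]
      by (simp add: ser_desc_q ser_at_base ip_axis1)
    moreover have "?f \<in> holomorphic_functions E" using x by (intro ser_desc) (simp add: Om_iff)
    ultimately show ?thesis by blast
  qed
qed

text \<open>Injectivity of the Jacobian is tested along lines: the annulus coordinate forces the
  base component of a kernel vector to vanish, and then the line stays in the fibre over w0, where
  the series are explicit multiples of the coordinates. Their derivatives across the fibres are
  never computed.\<close>

theorem local_coordinates: "has_global_local_coordinates E"
  unfolding has_global_local_coordinates_def fst_E topspace_Q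
proof
  fix X assume "X \<in> q ` Om"
  then obtain x where x: "x \<in> Om" "X = q x" by auto
  define w0 where "w0 = fst_vec x"
  have w0: "w0 \<in> strip m" using x by (simp add: Om_iff w0_def)
  define \<Phi> where "\<Phi> i = (case i of None \<Rightarrow> ex 1 | Some k \<Rightarrow> ser p (axis k 1) w0)" for i :: "'d option"
  define g where "g i = desc (\<Phi> i)" for i
  have gh: "g i \<in> holomorphic_functions E" for i
    using hol_exp[of 1] ser_desc[OF w0] by (cases i) (simp_all add: g_def \<Phi>_def)
  have gq: "g i (q y) = \<Phi> i y" if "y \<in> Om" for i y
    using desc_exp[of 1 y] ser_desc_q that by (cases i) (simp_all add: g_def \<Phi>_def)
  let ?V = "slice x"
  have V: "open ?V" "?V \<subseteq> Om" "inj_on q ?V" "x \<in> ?V"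
    using open_slice inj_slice x by (auto simp: slice_def)
  have \<Phi>h: "cholomorphic_on (\<Phi> i) Om" for i
  proof -
    have "cholomorphic_on (\<lambda>y. g i (q y)) Om" using gh by (simp add: hol_iff)
    then show ?thesis
      by (intro cholomorphic_on_local) (metis gq open_Om)
  qed
  have "\<forall>i. \<exists>b. (\<Phi> i has_derivative (\<lambda>h. \<Sum>l\<in>UNIV. b $ l * h $ l)) (at x)"
    using \<Phi>h x(1) unfolding cholomorphic_on_def by blast
  then have "\<exists>a. \<forall>i. (\<Phi> i has_derivative (\<lambda>h. \<Sum>l\<in>UNIV. a i $ l * h $ l)) (at x)"
    by (rule choice)
  then obtain a where a: "\<And>i. (\<Phi> i has_derivative (\<lambda>h. \<Sum>l\<in>UNIV. a i $ l * h $ l)) (at x)"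
    by blast
  define L where "L h = (\<chi> i. \<Sum>l\<in>UNIV. a i $ l * h $ l)" for h
  have "((\<lambda>z. \<chi> i. \<Phi> i z) has_derivative L) (at x)"
    unfolding L_def using a
    by (subst has_derivative_componentwise_within)
      (auto simp: Basis_vec_def inner_axis intro!: has_derivative_inner_left)
  then have der: "((\<lambda>z. \<chi> i. g i (inv_into (q ` ?V) (inv_into ?V q) z)) has_derivative L) (at x)"
  proof (rule has_derivative_transform_within_open[OF _ V(1) V(4)])
    fix y assume y: "y \<in> ?V"
    then show "(\<chi> i. \<Phi> i y) = (\<chi> i. g i (inv_into (q ` ?V) (inv_into ?V q) y))"
      using V(2) by (simp add: inv_chart[OF V(3)] gq subset_iff)
  qed
  have dir: "((\<lambda>t. \<Phi> i (x + t *\<^sub>R h)) has_vector_derivative L h $ i) (at 0)" for i h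
  proof -
    have 1: "((\<lambda>t. x + t *\<^sub>R h) has_derivative (\<lambda>t. t *\<^sub>R h)) (at 0)" by (auto intro!: derivative_eq_intros)
    have "((\<lambda>t. \<Phi> i (x + t *\<^sub>R h)) has_derivative (\<lambda>t. \<Sum>l\<in>UNIV. a i $ l * (t *\<^sub>R h) $ l)) (at 0)"
      by (rule has_derivative_compose[OF 1]) (simp add: a)
    then show ?thesis
      by (simp add: has_vector_derivative_def L_def scaleR_sum_right)
  qed
  have lin: "linear L"
    by (rule linearI) (simp_all add: L_def vec_eq_iff sum.distrib distrib_left scaleR_sum_right)
  have "h = 0" if Lh: "L h = 0" for h
  proof -
    have "h $ None = 0"
    proof -
      have "((\<lambda>t. exp (2 * pi * \<i> * (x $ None + of_real t * h $ None))) has_vector_derivative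
          (2 * pi * \<i> * h $ None * exp (2 * pi * \<i> * (x $ None)))) (at 0)"
        by (rule has_vector_derivative_real_field) (auto intro!: derivative_eq_intros)
      moreover have "((\<lambda>t. exp (2 * pi * \<i> * (x $ None + of_real t * h $ None))) has_vector_derivative 0) (at 0)"
        using dir[of None h] Lh by (simp add: \<Phi>_def ex_def fst_vec_def scaleR_conv_of_real[where 'a = complex])
      ultimately have "2 * pi * \<i> * h $ None * exp (2 * pi * \<i> * (x $ None)) = 0"
        by (rule vector_derivative_unique_at)
      then show ?thesis by simp
    qed
    moreover have "h $ Some k = 0" for k
    proof -
      have "((\<lambda>t. x + t *\<^sub>R h) \<longlongrightarrow> x + 0 *\<^sub>R h) (nhds 0)"
        by (intro tendsto_add tendsto_const tendsto_scaleR filterlim_ident)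
      then have ev: "\<forall>\<^sub>F t in nhds 0. x + t *\<^sub>R h \<in> Om"
        using topological_tendstoD[OF _ open_Om] x(1) by simp
      define c where "c = intp 0 * gau p (2 * pi\<^sup>2 / m) w0"
      have c: "c \<noteq> 0" using intp_int[of 0] gau_nz by (simp add: c_def)
      have eq: "\<forall>\<^sub>F t in nhds 0. \<Phi> (Some k) (x + t *\<^sub>R h) = c * (x $ Some k + of_real t * h $ Some k)"
        using ev
      proof eventually_elim
        case (elim t)
        have "fst_vec (x + t *\<^sub>R h) = w0" using \<open>h $ None = 0\<close> by (simp add: fst_vec_def w0_def)
        then show ?case
          using ser_at_base[OF elim, of w0 p "axis k 1"]
          by (simp add: \<Phi>_def c_def ip_axis1 snd_vec_def scaleR_conv_of_real[where 'a = complex])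
      qed
      have "((\<lambda>t. c * (x $ Some k + of_real t * h $ Some k)) has_vector_derivative c * h $ Some k) (at 0)"
        by (rule has_vector_derivative_real_field) (auto intro!: derivative_eq_intros)
      then have "((\<lambda>t. \<Phi> (Some k) (x + t *\<^sub>R h)) has_vector_derivative c * h $ Some k) (at 0)"
      proof -
        obtain S where S: "open S" "0 \<in> S" "\<And>t. t \<in> S \<Longrightarrow> \<Phi> (Some k) (x + t *\<^sub>R h) = c * (x $ Some k + of_real t * h $ Some k)"
          using eq unfolding eventually_nhds by blast
        assume "((\<lambda>t. c * (x $ Some k + of_real t * h $ Some k)) has_vector_derivative c * h $ Some k) (at 0)"
        then show ?thesis
          by (rule has_vector_derivative_transform_within_open[OF _ S(1,2)]) (simp add: S(3))
      qed
      moreover have "((\<lambda>t. \<Phi> (Some k) (x + t *\<^sub>R h)) has_vector_derivative 0) (at 0)"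
        using dir[of "Some k" h] Lh by simp
      ultimately have "c * h $ Some k = 0" by (rule vector_derivative_unique_at)
      then show ?thesis using c by simp
    qed
    ultimately show "h = 0"
      unfolding vec_eq_iff by (metis option.exhaust zero_index)
  qed
  then have "inj L" using lin linear_injective_0 by blast
  then have "bij L" using linear_injective_imp_surjective[OF lin] by (simp add: bij_def)
  moreover have "(q ` ?V, inv_into ?V q) \<in> snd E" unfolding snd_E using V by blast
  moreover have "X \<in> q ` ?V" using x V by simp
  moreover have "inv_into ?V q X = x" using x V by simp
  ultimately have loc: "\<exists>(U, \<phi>)\<in>snd E. X \<in> U \<and>
      (\<exists>L. ((\<lambda>z. \<chi> i. g i (inv_into U \<phi> z)) has_derivative L) (at (\<phi> X)) \<and> bij L)"
    using der by (intro bexI[of _ "(q ` ?V, inv_into ?V q)"]) auto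
  show "\<exists>g :: 'd option \<Rightarrow> _. (\<forall>i. g i \<in> holomorphic_functions E) \<and> (\<exists>(U, \<phi>)\<in>snd E. X \<in> U \<and>
      (\<exists>L. ((\<lambda>z. \<chi> i. g i (inv_into U \<phi> z)) has_derivative L) (at (\<phi> X)) \<and> bij L))"
    by (rule exI[of _ g], rule conjI, rule allI, rule gh, rule loc)
qed

section \<open>Holomorphic convexity of the bundle\<close>

lemma ser_le:
  assumes a: "a summable_on UNIV" and le: "\<And>j. cmod (tm p \<alpha> w0 j x) \<le> a j"
  shows "cmod (ser p \<alpha> w0 x) \<le> infsum a UNIV"
proof -
  have s: "(\<lambda>j. cmod (tm p \<alpha> w0 j x)) summable_on UNIV"
    by (rule summable_on_comparison_test[OF a le]) auto
  have "cmod (ser p \<alpha> w0 x) \<le> (\<Sum>\<^sub>\<infinity>j. cmod (tm p \<alpha> w0 j x))"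
    unfolding ser_def by (rule norm_infsum_bound[OF s])
  also have "\<dots> \<le> infsum a UNIV" by (rule infsum_mono[OF s a le])
  finally show ?thesis .
qed

text \<open>Openness of \<open>B\<close> makes the inequality of a separating hyperplane
  strict.\<close>

lemma support_open:
  assumes b0: "b0 \<notin> B"
  obtains \<beta> where "\<And>y. y \<in> B \<Longrightarrow> \<beta> \<bullet> y < \<beta> \<bullet> b0"
proof -
  obtain a c where a: "a \<noteq> 0" "\<forall>x\<in>B. inner a x \<le> c" "\<forall>x\<in>{b0}. c \<le> inner a x"
    using separating_hyperplane_sets[OF B(2) convex_singleton[of b0] B(3)] b0 by auto
  have "a \<bullet> y < a \<bullet> b0" if y: "y \<in> B" for y
  proof -
    obtain e where e: "e > 0" "cball y e \<subseteq> B" using B(1) y open_contains_cball by blast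
    have "y + (e / norm a) *\<^sub>R a \<in> B" using e a(1) by (intro subsetD[OF e(2)]) (simp add: dist_norm)
    then have "a \<bullet> (y + (e / norm a) *\<^sub>R a) \<le> c" using a(2) by blast
    moreover have "a \<bullet> (y + (e / norm a) *\<^sub>R a) = a \<bullet> y + e * norm a"
      using a(1) by (simp add: inner_add_right dot_square_norm power2_eq_square)
    moreover have "e * norm a > 0" using e a(1) by simp
    ultimately show ?thesis using a(3) by simp
  qed
  then show ?thesis using that by blast
qed

text \<open>Near a boundary point \<open>b0\<close> of \<open>B\<close> with supporting functional \<open>\<beta>\<close>, the series with leading
  monomial of exponent about \<open>t \<beta>\<close> is of size about \<open>exp (t \<beta> \<bullet> b0)\<close>, whereas on a compact set each of
  its terms is smaller by a factor \<open>exp (- t \<delta>)\<close> with \<open>\<delta> > 0\<close> depending on the term.\<close>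

lemma boundary_estimate:
  assumes C: "compact C" "C \<noteq> {}" "C \<subseteq> Om"
      "\<And>x. x \<in> C \<Longrightarrow> \<bar>Re (fst_vec x)\<bar> \<le> R \<and> \<bar>Im (fst_vec x)\<bar> \<le> v \<and> norm (lgv (snd_vec x)) \<le> R"
    and v: "0 \<le> v" "v < m / (4 * pi)" and b0: "b0 \<notin> B" and c1: "c1 > 0"
  shows "\<exists>\<alpha> b. (\<forall>w0 x. \<bar>Im w0\<bar> \<le> v \<longrightarrow> x \<in> C \<longrightarrow> cmod (ser p \<alpha> w0 x) \<le> b) \<and> b < c1 * exp (ip \<alpha> b0)"
proof -
  obtain \<beta> where \<beta>: "\<And>y. y \<in> B \<Longrightarrow> \<beta> \<bullet> y < \<beta> \<bullet> b0" using support_open[OF b0] by metis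
  define s where "s = \<beta> \<bullet> b0"
  define d where "d = real CARD('d)"
  define X where "X = (\<lambda>x. lgv (snd_vec x)) ` C"
  have X: "compact X" "X \<noteq> {}" "X \<subseteq> B"
  proof -
    show "compact X" unfolding X_def
      by (intro compact_continuous_image C continuous_on_compose2[OF continuous_on_lgv] continuous_intros)
        (use C(3) in \<open>auto simp: Om_iff Rein_def\<close>)
  qed (use C in \<open>auto simp: X_def Om_iff Rein_def\<close>)
  have R: "R \<ge> 0" using C(2,4) by (metis abs_ge_zero equals0I order_trans)
  have "\<exists>x\<in>X. \<forall>y\<in>X. \<beta> \<bullet> (imat (zmat M j) *v y) \<le> \<beta> \<bullet> (imat (zmat M j) *v x)" for j
    by (rule continuous_attains_sup[OF X(1,2)])
      (intro continuous_intros linear_continuous_on bounded_linear_inner_right_comp matrix_vector_mul_bounded_linear)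
  then obtain xs where xs: "\<And>j. xs j \<in> X" "\<And>j y. y \<in> X \<Longrightarrow> \<beta> \<bullet> (imat (zmat M j) *v y) \<le> \<beta> \<bullet> (imat (zmat M j) *v xs j)"
    by metis
  \<comment> \<open>The gap to the supporting hyperplane after the j-th translation. It is positive
    because M^j keeps the compact set inside \<open>B\<close>, but no bound uniform in j is
    available.\<close>
  define \<delta> where "\<delta> j = s - \<beta> \<bullet> (imat (zmat M j) *v xs j)" for j
  have \<delta>: "\<delta> j > 0" for j
    using \<beta>[OF MB[of "xs j" j]] xs(1)[of j] X(3) by (auto simp: \<delta>_def s_def)
  have d0: "d \<ge> 0" by (simp add: d_def)
  obtain D where D: "D \<ge> 0" "\<And>j w w0 x. \<bar>Im w\<bar> \<le> v \<Longrightarrow> \<bar>Im w0\<bar> \<le> v \<Longrightarrow> \<bar>Re w\<bar> \<le> R \<Longrightarrow> norm (x :: real^'d) \<le> R \<Longrightarrow>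
    cmod (intp (w + of_int j - w0)) * cmod (gau p (2 * pi\<^sup>2 / m) (w + of_int j)) * exp (d * norm (imat (zmat M j) *v x))
      \<le> D * exp (- \<bar>of_int j\<bar>)"
    using term_bound[OF d0 R v] by blast
  define a where "a j = D * exp (- \<bar>real_of_int j\<bar>)" for j
  have a: "a summable_on UNIV" "\<And>j. a j \<ge> 0" using summable_weights D by (auto simp: a_def[abs_def])
  \<comment> \<open>The factor exp (- d norm b0) pays for rounding the exponent at b0; the rounding
    error on orbit points is already absorbed into the weights \<open>a\<close>, by the choice of d
    as multiplier above.\<close>
  obtain t where t: "t \<ge> 0" "(\<Sum>\<^sub>\<infinity>j. a j * exp (- t * \<delta> j)) < c1 * exp (- d * norm b0)"
    using exp_weight_small[where \<delta> = \<delta>, OF a \<delta>, of "c1 * exp (- d * norm b0)"] c1 by auto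
  define \<alpha> where "\<alpha> = (\<chi> k. \<lfloor>t * \<beta> $ k\<rfloor>)"
  have \<alpha>: "\<bar>ip \<alpha> y - t * (\<beta> \<bullet> y)\<bar> \<le> d * norm y" for y :: "real^'d"
    unfolding \<alpha>_def d_def by (rule inner_ip)
  have sa: "(\<lambda>j. a j * exp (- t * \<delta> j)) summable_on UNIV"
  proof (rule summable_on_comparison_test[OF a(1)])
    show "a j * exp (- t * \<delta> j) \<le> a j" for j
      using a(2)[of j] t(1) \<delta>[of j] by (simp add: mult_left_le)
  qed (simp add: a(2))
  define b where "b = exp (t * s) * (\<Sum>\<^sub>\<infinity>j. a j * exp (- t * \<delta> j))"
  have "cmod (ser p \<alpha> w0 x) \<le> b" if w0: "\<bar>Im w0\<bar> \<le> v" and x: "x \<in> C" for w0 x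
  proof -
    have "cmod (tm p \<alpha> w0 j x) \<le> exp (t * s) * (a j * exp (- t * \<delta> j))" for j
    proof -
      let ?y = "imat (zmat M j) *v lgv (snd_vec x)"
      let ?g = "cmod (intp (fst_vec x + of_int j - w0)) * cmod (gau p (2 * pi\<^sup>2 / m) (fst_vec x + of_int j))"
      have "t * (\<beta> \<bullet> ?y) \<le> t * (s - \<delta> j)"
        using xs(2)[of "lgv (snd_vec x)" j] x t(1) by (intro mult_left_mono) (auto simp: X_def \<delta>_def)
      then have "ip \<alpha> ?y \<le> d * norm ?y + (t * s - t * \<delta> j)"
        using \<alpha>[of ?y] by (simp add: abs_le_iff algebra_simps)
      then have "exp (ip \<alpha> ?y) \<le> exp (d * norm ?y) * (exp (t * s) * exp (- t * \<delta> j))"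
        by (simp flip: exp_add)
      then have "cmod (tm p \<alpha> w0 j x) \<le> ?g * (exp (d * norm ?y) * (exp (t * s) * exp (- t * \<delta> j)))"
        using C(3) x by (subst norm_tm) (auto intro!: mult_left_mono)
      also have "\<dots> = (?g * exp (d * norm ?y)) * (exp (t * s) * exp (- t * \<delta> j))" by (simp only: mult.assoc)
      also have "\<dots> \<le> a j * (exp (t * s) * exp (- t * \<delta> j))"
        unfolding a_def using C(4)[OF x] w0 by (intro mult_right_mono D(2)) auto
      finally show ?thesis by (simp add: mult_ac)
    qed
    from ser_le[OF summable_on_cmult_right[OF sa] this]
    show ?thesis by (simp add: b_def infsum_cmult_right' )
  qed
  moreover have "b < c1 * exp (ip \<alpha> b0)"
  proof -
    have "b < exp (t * s) * (c1 * exp (- d * norm b0))"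
      unfolding b_def using t(2) by (intro mult_strict_left_mono) auto
    also have "\<dots> = c1 * exp (t * s - d * norm b0)" by (simp add: exp_diff exp_minus field_simps)
    also have "\<dots> \<le> c1 * exp (ip \<alpha> b0)"
      using \<alpha>[of b0] c1 by (intro mult_left_mono) (auto simp: s_def abs_le_iff)
    finally show ?thesis .
  qed
  ultimately show ?thesis by blast
qed

text \<open>Hull points are moved to Re w between 0 and 1; the annulus coordinate and its inverse
  bound Im w, and series centred at the base point itself test only the logarithmic radius y. It
  remains to confine y to a compact subset of \<open>B\<close>.\<close>

theorem hol_convex: "holomorphically_convex E"
  unfolding holomorphically_convex_def fst_E
proof (intro allI impI, elim conjE)
  fix K assume K: "compactin Q K" "K \<noteq> {}"
  obtain C where C: "compact C" "C \<subseteq> Om" "K \<subseteq> q ` C" using compactin_cover[OF K(1)] by blast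
  have C0: "C \<noteq> {}" using C(3) K(2) by auto
  obtain R v where Rv: "0 \<le> v" "v < m / (4 * pi)"
      "\<And>x. x \<in> C \<Longrightarrow> \<bar>Re (fst_vec x)\<bar> \<le> R \<and> \<bar>Im (fst_vec x)\<bar> \<le> v \<and> norm (lgv (snd_vec x)) \<le> R"
    using compact_in_Om[OF C(1,2)] by blast
  have R: "R \<ge> 0" using C0 Rv(3) by (metis abs_ge_zero equals0I order_trans)
  have sup: "(SUP Z\<in>K. cmod (f Z)) \<le> b" if "\<And>x. x \<in> C \<Longrightarrow> cmod (f (q x)) \<le> b" for f :: "_ \<Rightarrow> complex" and b
    using that C(3) by (intro cSUP_least[OF K(2)]) auto
  define W where "W = cbox (Complex 0 (- v)) (Complex 1 v)"
  have W: "compact W" "W \<subseteq> strip m" "W \<noteq> {}"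
  proof -
    have "0 \<in> W" using Rv by (simp add: W_def in_cbox_complex_iff)
    then show "W \<noteq> {}" by blast
  qed (use Rv in \<open>auto simp: W_def in_cbox_complex_iff strip_def\<close>)
  have WIm: "\<bar>Im w\<bar> \<le> v" if "w \<in> W" for w using that by (auto simp: W_def in_cbox_complex_iff)
  let ?G = "\<lambda>w. intp 0 * gau p (2 * pi\<^sup>2 / m) w"
  \<comment> \<open>A lower bound, uniform over \<open>W\<close>, for the factor by which a series
    differs from its monomial in its own fibre.\<close>
  obtain c1 where c1: "c1 > 0" "\<And>w. w \<in> W \<Longrightarrow> c1 \<le> cmod (?G w)"
  proof -
    have "continuous_on W (\<lambda>w. cmod (?G w))"
      by (intro continuous_intros holomorphic_on_imp_continuous_on gau_holomorphic)
    from continuous_attains_inf[OF W(1,3) this]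
    obtain w where w: "w \<in> W" "\<And>w'. w' \<in> W \<Longrightarrow> cmod (?G w) \<le> cmod (?G w')" by blast
    have "cmod (?G w) > 0" using intp_int[of 0] gau_nz by simp
    then show ?thesis using that w by blast
  qed
  \<comment> \<open>The hull inequalities coming from the series, stated for every y and not only in
    \<open>B\<close>, so that they pass to limit points of \<open>Y\<close>.\<close>
  define P where "P y \<longleftrightarrow> (\<forall>\<alpha> b. (\<forall>w0\<in>W. \<forall>x\<in>C. cmod (ser p \<alpha> w0 x) \<le> b) \<longrightarrow> c1 * exp (ip \<alpha> y) \<le> b)" for y :: "real^'d"
  define Y where "Y = {y \<in> B. P y}"
  have hull: "\<exists>w\<in>W. \<exists>y\<in>Y. \<exists>u\<in>torus. Z = q (pair_vec w (rx y * u))" if Z: "Z \<in> holomorphic_hull E K" for Z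
  proof -
    have ZQ: "Z \<in> q ` Om" and Zf: "\<And>f. f \<in> holomorphic_functions E \<Longrightarrow> cmod (f Z) \<le> (SUP Z\<in>K. cmod (f Z))"
      using Z by (auto simp: holomorphic_hull_def fst_E topspace_Q)
    obtain x0 where x0: "x0 \<in> Om" "Z = q x0" using ZQ by auto
    define n where "n = - \<lfloor>Re (fst_vec x0)\<rfloor>"
    define x where "x = diagonal_action M n x0"
    have x: "x \<in> Om" "q x = Z" unfolding x_def using act_in[OF x0(1)] q_act[OF x0(1)] x0(2) by auto
    have fx: "fst_vec x = fst_vec x0 + of_int n" unfolding x_def act_eq[OF x0(1)] by simp
    have Re: "0 \<le> Re (fst_vec x)" "Re (fst_vec x) \<le> 1" unfolding fx n_def by (auto, linarith+)
    have nex: "cmod (ex c y) = exp (- (Re c * (2 * pi * Im (fst_vec y))))" if "c = 1 \<or> c = - 1" for c y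
      using that by (auto simp: ex_def)
    have "exp (- (Re c * (2 * pi * Im (fst_vec x)))) \<le> exp (2 * pi * v)" if c: "c = 1 \<or> c = - 1" for c
    proof -
      have "cmod (desc (ex c) Z) \<le> (SUP Z\<in>K. cmod (desc (ex c) Z))" by (rule Zf[OF hol_exp[OF c]])
      also have "\<dots> \<le> exp (2 * pi * v)"
      proof (rule sup)
        fix y assume y: "y \<in> C"
        have "- (Re c * (2 * pi * Im (fst_vec y))) \<le> \<bar>2 * pi * Im (fst_vec y)\<bar>" using c by (auto simp: abs_le_iff)
        also have "\<dots> \<le> 2 * pi * v" using Rv(3)[OF y] by (simp add: abs_mult)
        finally show "cmod (desc (ex c) (q y)) \<le> exp (2 * pi * v)"
          using y C(2) c by (simp add: desc_exp nex subset_iff)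
      qed
      finally show ?thesis unfolding x(2)[symmetric] using c x(1) by (simp add: desc_exp nex)
    qed
    from this[of 1] this[of "- 1"] have "2 * pi * (- Im (fst_vec x)) \<le> 2 * pi * v" "2 * pi * Im (fst_vec x) \<le> 2 * pi * v" by simp_all
    then have Im: "\<bar>Im (fst_vec x)\<bar> \<le> v" by (intro abs_leI) (simp_all only: mult_le_cancel_left_pos[of "2 * pi"] pi_gt_zero zero_less_mult_iff zero_less_numeral simp_thms)
    have wW: "fst_vec x \<in> W" using Re Im by (auto simp: W_def in_cbox_complex_iff abs_le_iff)
    define y where "y = lgv (snd_vec x)"
    have sx: "snd_vec x \<in> ctorus" "y \<in> B" using x(1) by (auto simp: Om_iff Rein_def y_def)
    obtain u where u: "u \<in> torus" "snd_vec x = rx y * u" using ctorus_polar[OF sx(1)] unfolding y_def by blast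
    have "P y"
      unfolding P_def
    proof (intro allI impI)
      fix \<alpha> b assume b: "\<forall>w0\<in>W. \<forall>x\<in>C. cmod (ser p \<alpha> w0 x) \<le> b"
      let ?f = "desc (ser p \<alpha> (fst_vec x))"
      have "c1 * exp (ip \<alpha> y) \<le> cmod (?G (fst_vec x)) * exp (ip \<alpha> y)"
        using c1(2)[OF wW] by (intro mult_right_mono) auto
      also have "\<dots> = cmod (?f Z)"
        unfolding x(2)[symmetric] ser_desc_q[OF x(1)] ser_at_base[OF x(1) refl]
        by (simp add: norm_mult norm_lmono[OF sx(1)] y_def)
      also have "\<dots> \<le> (SUP Z\<in>K. cmod (?f Z))"
        using wW W(2) by (intro Zf ser_desc) auto
      also have "\<dots> \<le> b"
      proof (rule sup)
        fix y assume y: "y \<in> C"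
        then show "cmod (?f (q y)) \<le> b" using b wW C(2) by (simp add: ser_desc_q subset_iff)
      qed
      finally show "c1 * exp (ip \<alpha> y) \<le> b" .
    qed
    then have "y \<in> Y" using sx by (simp add: Y_def)
    moreover have "Z = q (pair_vec (fst_vec x) (rx y * u))" using x(2) u(2) by (metis pair_fst_snd)
    ultimately show ?thesis using wW u(1) by blast
  qed
  \<comment> \<open>Applied below to unit vectors and their negatives, which bounds every coordinate
    of y from both sides.\<close>
  have "\<exists>b. \<forall>y\<in>Y. exp (ip \<alpha> y) \<le> b" for \<alpha> :: "int^'d"
  proof -
    obtain D where D: "\<And>w0 x j. \<bar>Im w0\<bar> \<le> v \<Longrightarrow> x \<in> C \<Longrightarrow> cmod (tm p \<alpha> w0 j x) \<le> D * exp (- \<bar>of_int j\<bar>)"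
      using tm_bound[of C R v \<alpha>] C(2) Rv R by (metis subsetD)
    define b where "b = (\<Sum>\<^sub>\<infinity>j. D * exp (- \<bar>real_of_int j\<bar>))"
    have "\<forall>w0\<in>W. \<forall>x\<in>C. cmod (ser p \<alpha> w0 x) \<le> b"
      unfolding b_def using D WIm by (intro ballI ser_le summable_weights) auto
    then have "c1 * exp (ip \<alpha> y) \<le> b" if "y \<in> Y" for y using that by (auto simp: Y_def P_def)
    then show ?thesis using c1(1) by (intro exI[of _ "b / c1"]) (simp add: field_simps)
  qed
  then obtain bb where bb: "\<And>\<alpha> y. y \<in> Y \<Longrightarrow> exp (ip \<alpha> y) \<le> bb \<alpha>" by metis
  have "bounded Y"
    unfolding bounded_iff
  proof (intro exI ballI)
    fix y assume y: "y \<in> Y"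
    have "norm y \<le> (\<Sum>k\<in>UNIV. \<bar>y $ k\<bar>)" by (rule norm_le_l1_cart)
    also have "\<dots> \<le> (\<Sum>k\<in>UNIV. bb (axis k 1) + bb (axis k (- 1)))"
    proof (intro sum_mono)
      fix k
      have 1: "exp (y $ k) \<le> bb (axis k 1)" "exp (- y $ k) \<le> bb (axis k (- 1))"
      proof -
        have "ip (axis k n) y = of_int n * y $ k" for n
        proof -
          have "ip (axis k n) y = (\<Sum>i\<in>UNIV. if i = k then of_int n * y $ k else 0)"
            unfolding ip_def by (intro sum.cong) (auto simp: axis_def)
          then show ?thesis by simp
        qed
        then show "exp (y $ k) \<le> bb (axis k 1)" "exp (- y $ k) \<le> bb (axis k (- 1))"
          using bb[OF y, of "axis k 1"] bb[OF y, of "axis k (- 1)"] by simp_all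
      qed
      have "y $ k \<le> exp (y $ k)" "- y $ k \<le> exp (- y $ k)"
        using exp_ge_add_one_self[of "y $ k"] exp_ge_add_one_self[of "- y $ k"] by linarith+
      moreover have "0 < exp (y $ k)" "0 < exp (- y $ k)" by simp_all
      ultimately show "\<bar>y $ k\<bar> \<le> bb (axis k 1) + bb (axis k (- 1))" using 1 by linarith
    qed
    finally show "norm y \<le> (\<Sum>k\<in>UNIV. bb (axis k 1) + bb (axis k (- 1)))" .
  qed
  then have cY: "compact (closure Y)" by simp
  have YB: "closure Y \<subseteq> B"
  proof
    fix b0 assume b0: "b0 \<in> closure Y"
    have Pb0: "P b0"
      unfolding P_def
    proof (intro allI impI)
      fix \<alpha> b assume b: "\<forall>w0\<in>W. \<forall>x\<in>C. cmod (ser p \<alpha> w0 x) \<le> b"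
      have "closed {y :: real^'d. c1 * exp (ip \<alpha> y) \<le> b}"
        by (intro closed_Collect_le continuous_intros)
      moreover have "Y \<subseteq> {y. c1 * exp (ip \<alpha> y) \<le> b}" using b by (auto simp: Y_def P_def)
      ultimately show "c1 * exp (ip \<alpha> b0) \<le> b" using b0 closure_minimal by blast
    qed
    \<comment> \<open>A limit point outside \<open>B\<close> would violate one of these
      inequalities, for an exponent near a multiple of a supporting functional.\<close>
    show "b0 \<in> B"
    proof (rule ccontr)
      assume "b0 \<notin> B"
      from boundary_estimate[OF C(1) C0 C(2) Rv(3) Rv(1,2) this c1(1)]
      obtain \<alpha> b where "\<forall>w0 x. \<bar>Im w0\<bar> \<le> v \<longrightarrow> x \<in> C \<longrightarrow> cmod (ser p \<alpha> w0 x) \<le> b" "b < c1 * exp (ip \<alpha> b0)"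
        by blast
      then show False using Pb0 WIm unfolding P_def by (meson not_less)
    qed
  qed
  define C' where "C' = (\<lambda>(w, y, u). pair_vec w (rx y * u)) ` (W \<times> closure Y \<times> torus)"
  have cC': "compact C'"
    unfolding C'_def by (intro compact_continuous_image compact_Times W cY compact_torus)
      (auto simp: case_prod_unfold intro!: continuous_intros)
  have C'O: "C' \<subseteq> Om" using W YB by (auto simp: C'_def)
  have "holomorphic_hull E K \<subseteq> q ` C'"
  proof
    fix Z assume "Z \<in> holomorphic_hull E K"
    then obtain w y u where "w \<in> W" "y \<in> Y" "u \<in> torus" "Z = q (pair_vec w (rx y * u))" using hull by blast
    then show "Z \<in> q ` C'" using closure_subset[of Y] by (force simp: C'_def)
  qed
  then show "compactin Q (holomorphic_hull E K)"
    by (rule closed_compactin[OF compactin_q_image[OF cC' C'O] _ closedin_hull])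
qed

theorem Stein_E: "Stein_manifold E"
  unfolding Stein_manifold_def
  by (intro conjI complex_manifold_E hol_convex separable local_coordinates)

end

section \<open>Spectra of integer matrices\<close>

lemma ann_append: "x \<in> ann A \<mu>s \<Longrightarrow> x \<in> ann A (\<mu>s @ \<nu>s)" "x \<in> ann A \<nu>s \<Longrightarrow> x \<in> ann A (\<mu>s @ \<nu>s)"
proof -
  show 1: "x \<in> ann A \<mu>s \<Longrightarrow> x \<in> ann A (\<mu>s @ \<nu>s)" for \<mu>s \<nu>s
    using ann_0[of A \<nu>s] by (simp add: ann_def)
  show "x \<in> ann A \<nu>s \<Longrightarrow> x \<in> ann A (\<mu>s @ \<nu>s)"
    using 1[of \<nu>s \<mu>s] ann_mset[of "\<nu>s @ \<mu>s" "\<mu>s @ \<nu>s" A] by simp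
qed

text \<open>One list serves the whole space and consists of exactly the eigenvalues. In particular
  the spectrum is finite and nonempty, which gives the maximum in \<open>int_spectral_radius\<close>
  its meaning.\<close>

lemma annihilating_list:
  fixes A :: "complex^'d^'d"
  obtains L where "\<And>x. x \<in> ann A L" "\<And>\<mu>. \<mu> \<in> set L \<longleftrightarrow> eigval A \<mu>" "L \<noteq> []"
proof -
  have "\<exists>L. (\<forall>k\<in>S. axis k 1 \<in> ann A L) \<and> (\<forall>\<mu>\<in>set L. eigval A \<mu>)" if "finite S" for S :: "'d set"
    using that
  proof induction
    case empty
    then show ?case by (intro exI[of _ "[]"]) auto
  next
    case (insert a S)
    then obtain L where L: "\<forall>k\<in>S. axis k 1 \<in> ann A L" "\<forall>\<mu>\<in>set L. eigval A \<mu>" by blast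
    obtain \<mu>s where "axis a 1 \<in> ann A \<mu>s" "\<forall>\<mu>\<in>set \<mu>s. eigval A \<mu>" using ann_exists by blast
    then show ?case using L by (intro exI[of _ "L @ \<mu>s"]) (auto intro: ann_append)
  qed
  from this[of UNIV] obtain L where L: "\<And>k. axis k 1 \<in> ann A L" "\<And>\<mu>. \<mu> \<in> set L \<Longrightarrow> eigval A \<mu>" by auto
  have all: "x \<in> ann A L" for x
  proof -
    have "(\<Sum>k\<in>S. x $ k *s axis k 1) \<in> ann A L" if "finite S" for S
      using that by induction (auto intro: ann_0 ann_add ann_smult L)
    moreover have "(\<Sum>k\<in>UNIV. x $ k *s axis k 1) = x" by (rule basis_expansion)
    ultimately show ?thesis by (metis finite)
  qed
  \<comment> \<open>On an eigenvector the product of shifts acts by the product of the numbers \<mu>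
    - \<nu>, which vanishes only if \<mu> is listed.\<close>
  have "\<mu> \<in> set L'" if v: "v \<noteq> 0" "A *v v = \<mu> *s v" and "v \<in> ann A L'" for \<mu> v L'
    using that(3)
  proof (induction L')
    case Nil
    then show ?case using v by simp
  next
    case (Cons \<nu> L')
    have "shiftp A \<nu> v = (\<mu> - \<nu>) *s v" by (simp add: shiftp_def v vector_sub_rdistrib)
    then have s: "(\<mu> - \<nu>) *s v \<in> ann A L'" using Cons.prems by simp
    show ?case
    proof (cases "\<mu> = \<nu>")
      case False
      have "v = (1 / (\<mu> - \<nu>)) *s ((\<mu> - \<nu>) *s v)" unfolding vector_smult_assoc using False by simp
      then have "v \<in> ann A L'" using ann_smult[OF s, of "1 / (\<mu> - \<nu>)"] by simp
      then show ?thesis using Cons.IH by simp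
    qed simp
  qed
  then have "eigval A \<mu> \<Longrightarrow> \<mu> \<in> set L" for \<mu> using all by (auto simp: eigval_def)
  moreover have "L \<noteq> []"
  proof
    assume "L = []"
    then have "axis undefined 1 = (0 :: complex^'d)" using all[of "axis undefined 1"] by simp
    then show False by simp
  qed
  ultimately show ?thesis using that all L(2) by blast
qed

lemma int_spectrum_eq: "int_spectrum N = {\<mu>. eigval (imat N) \<mu>}"
  by (simp add: int_spectrum_def eigval_def imat_def)

lemma int_spectral_radius:
  shows "eigval (imat N) \<mu> \<Longrightarrow> cmod \<mu> \<le> int_spectral_radius N"
    and "\<exists>\<mu>. eigval (imat N) \<mu> \<and> cmod \<mu> = int_spectral_radius N"
proof -
  obtain L where L: "\<And>\<mu>. \<mu> \<in> set L \<longleftrightarrow> eigval (imat N) \<mu>" "L \<noteq> []"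
    using annihilating_list[of "imat N"] by metis
  have eq: "int_spectrum N = set L" by (auto simp: int_spectrum_eq L)
  show "eigval (imat N) \<mu> \<Longrightarrow> cmod \<mu> \<le> int_spectral_radius N"
    unfolding int_spectral_radius_def eq using L by (intro Max_ge) auto
  have "Max (cmod ` set L) \<in> cmod ` set L" using L(2) by (intro Max_in) auto
  then show "\<exists>\<mu>. eigval (imat N) \<mu> \<and> cmod \<mu> = int_spectral_radius N"
    unfolding int_spectral_radius_def eq using L(1) by force
qed

text \<open>The basis vectors share one annihilating list, hence one polynomial degree, and every
  orbit is a combination of theirs.\<close>

lemma int_matrix_growth:
  fixes N :: "int^'d^'d"
  assumes \<rho>: "\<rho> > 0" "int_spectral_radius N \<le> \<rho>"
  shows "\<exists>C\<ge>0. \<exists>p. \<forall>n. \<forall>x :: real^'d. norm (imat (mpow N n) *v x) \<le> C * (1 + real n) ^ p * \<rho> ^ n * norm x"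
proof -
  let ?A = "imat N :: complex^'d^'d"
  obtain L where L: "\<And>x. x \<in> ann ?A L" "\<And>\<mu>. \<mu> \<in> set L \<longleftrightarrow> eigval ?A \<mu>" using annihilating_list by metis
  have le: "cmod \<mu> \<le> \<rho>" if "\<mu> \<in> set L" for \<mu> using int_spectral_radius(1)[of N \<mu>] that L(2) \<rho>(2) by force
  obtain C where C: "\<And>k. C k \<ge> 0" "\<And>k j. norm (((*v) ?A ^^ j) (axis k 1)) \<le> C k * (1 + real j) ^ length L * \<rho> ^ j"
  proof -
    have "\<forall>k. \<exists>C\<ge>0. \<forall>j. norm (((*v) ?A ^^ j) (axis k 1)) \<le> C * (1 + real j) ^ length L * \<rho> ^ j"
      using ann_growth[OF L(1) le \<rho>(1)] by blast
    then show ?thesis using that by metis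
  qed
  show ?thesis
  proof (intro exI[of _ "\<Sum>k\<in>UNIV. C k"] exI[of _ "length L"] conjI allI)
    show "0 \<le> (\<Sum>k\<in>UNIV. C k)" by (intro sum_nonneg C)
    fix n and x :: "real^'d"
    have sum: "((*v) ?A ^^ n) (\<Sum>k\<in>S. f k) = (\<Sum>k\<in>S. ((*v) ?A ^^ n) (f k))" if "finite S" for S and f :: "'d \<Rightarrow> complex^'d"
    proof -
      have z: "((*v) ?A ^^ n) 0 = 0" by (induction n) auto
      show ?thesis using that by induction (auto simp: iter_add z)
    qed
    have "norm (imat (mpow N n) *v x) = norm (((*v) ?A ^^ n) (cofr x))"
      by (simp add: imat_mpow cmat_imat norm_cofr flip: cofr_iter[of n "imat N", unfolded cmat_imat])
    also have "cofr x = (\<Sum>k\<in>UNIV. cofr x $ k *s axis k 1)" by (rule basis_expansion [symmetric])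
    also have "norm (((*v) ?A ^^ n) \<dots>) = norm (\<Sum>k\<in>UNIV. cofr x $ k *s ((*v) ?A ^^ n) (axis k 1))"
      by (simp add: sum iter_smult)
    also have "\<dots> \<le> (\<Sum>k\<in>UNIV. norm x * (C k * (1 + real n) ^ length L * \<rho> ^ n))"
    proof (rule sum_norm_le)
      fix k
      show "norm (cofr x $ k *s ((*v) ?A ^^ n) (axis k 1)) \<le> norm x * (C k * (1 + real n) ^ length L * \<rho> ^ n)"
        unfolding norm_vsmult using component_le_norm_cart[of x k] C by (intro mult_mono) (auto simp: cofr_def)
    qed
    also have "\<dots> = (\<Sum>k\<in>UNIV. C k) * (1 + real n) ^ length L * \<rho> ^ n * norm x"
      by (simp add: sum_distrib_left sum_distrib_right mult_ac)
    finally show "norm (imat (mpow N n) *v x) \<le> (\<Sum>k\<in>UNIV. C k) * (1 + real n) ^ length L * \<rho> ^ n * norm x" .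
  qed
qed

lemma int_spectral_radius_pos:
  fixes M :: "int^'d^'d"
  assumes "invertible M"
  shows "int_spectral_radius M > 0"
proof -
  obtain \<mu> where \<mu>: "eigval (imat M) \<mu>" "cmod \<mu> = int_spectral_radius M" using int_spectral_radius(2) by blast
  obtain v where v: "v \<noteq> 0" "(imat M :: complex^'d^'d) *v v = \<mu> *s v" using \<mu>(1) by (auto simp: eigval_def)
  have "v = imat (matrix_inv M) *v ((imat M :: complex^'d^'d) *v v)"
    by (simp add: matrix_vector_mul_assoc int_matrix_inv[OF assms] imat_one flip: imat_mult)
  then have "\<mu> \<noteq> 0" using v by auto
  then show ?thesis using \<mu>(2) by (metis zero_less_norm_iff)
qed

theorem mainTheorem1:
  fixes M :: "int^'d^'d" and m :: real and D :: "(complex^'d) set"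
  assumes "CARD('d) \<ge> 2"
    and "invertible M"
    and "m > 0"
    and "Reinhardt_domain D"
    and "invariant_under (monomial_action M) D"
    and "Stein_manifold (open_submanifold D)"
  shows "Stein_manifold (E_bundle m D M) \<longleftrightarrow> m * ln (rho M) \<le> 2 * pi\<^sup>2"
proof -
  obtain B where B: "open B" "connected B" "B \<noteq> {}" and D: "D = Rein B"
    using Reinhardt_eq_Rein[OF assms(4)] by blast
  have cB: "convex B" using Stein_Reinhardt_convex[OF B(1,2)] assms(6) D by simp
  have MB: "imat (zmat M j) *v x \<in> B" if x: "x \<in> B" for j x
  proof -
    \<comment> \<open>The point with positive real coordinates over x carries the invariance of
      \<open>D\<close> to its logarithmic image.\<close>
    have "rx x \<in> D" using x by (simp add: D Rein_def)
    then have "monomial_action M j (rx x) \<in> D" using assms(5) by (auto simp: invariant_under_def)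
    then have "monomial_map (zmat M j) (rx x) \<in> Rein B" using D by (simp add: monomial_action_eq[OF assms(2)])
    then show ?thesis by (simp add: Rein_def lgv_monomial_map)
  qed
  interpret monomial_bundle M m B
    by unfold_locales (use assms B cB MB in auto)
  have E: "E_bundle m D M = E" using E_bundle_eq D by simp
  let ?M' = "matrix_inv M"
  have z1: "zmat M (int j) = mpow M j" for j by (simp add: zmat_def)
  have z2: "zmat M (- int j) = mpow ?M' j" for j by (cases "j = 0") (simp_all add: zmat_def)
  define \<rho> where "\<rho> = rho M"
  have \<rho>0: "\<rho> > 0" using int_spectral_radius_pos[OF assms(2)] by (simp add: \<rho>_def rho_def less_max_iff_disj)
  show ?thesis
  proof
    assume st: "Stein_manifold (E_bundle m D M)"
    show "m * ln (rho M) \<le> 2 * pi\<^sup>2"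
    proof (rule ccontr)
      assume "\<not> ?thesis"
      then have gt: "m * ln \<rho> > 2 * pi\<^sup>2" by (simp add: \<rho>_def)
      then have "m * ln \<rho> > 0" using pi_gt_zero by (smt (verit) zero_less_power)
      then have "ln \<rho> > 0" using assms(3) by (simp add: zero_less_mult_iff)
      then have \<rho>1: "\<rho> > 1" using \<rho>0 by simp
      consider "\<rho> = int_spectral_radius M" | "\<rho> = int_spectral_radius ?M'"
        unfolding \<rho>_def rho_def by (meson max_def)
      then have "\<not> Stein_manifold E"
      proof cases
        case 1
        obtain \<mu>0 where \<mu>0: "eigval (imat M) \<mu>0" "cmod \<mu>0 = \<rho>" using int_spectral_radius(2)[of M] 1 by auto
        show ?thesis
          by (rule not_Stein[OF \<rho>1 gt, of 1 M \<mu>0]) (use z1 1 int_spectral_radius(1)[of M] \<mu>0 in auto)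
      next
        \<comment> \<open>Powers of the inverse matrix are negative powers of M, so the opposite end
          of the strip is used.\<close>
        case 2
        obtain \<mu>0 where \<mu>0: "eigval (imat ?M') \<mu>0" "cmod \<mu>0 = \<rho>" using int_spectral_radius(2)[of ?M'] 2 by auto
        show ?thesis
          by (rule not_Stein[OF \<rho>1 gt, of "- 1" ?M' \<mu>0]) (use z2 2 int_spectral_radius(1)[of ?M'] \<mu>0 in auto)
      qed
      then show False using st E by simp
    qed
  next
    assume le: "m * ln (rho M) \<le> 2 * pi\<^sup>2"
    define k where "k = 2 * pi\<^sup>2 / m"
    have "ln \<rho> \<le> k" using le assms(3) by (simp add: k_def \<rho>_def field_simps)
    then have \<rho>k: "\<rho> \<le> exp k" using \<rho>0 by (metis exp_le_cancel_iff exp_ln)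
    obtain C1 p1 where 1: "C1 \<ge> 0" "\<And>n x. norm (imat (mpow M n) *v (x :: real^'d)) \<le> C1 * (1 + real n) ^ p1 * \<rho> ^ n * norm x"
      using int_matrix_growth[of \<rho> M] \<rho>0 by (auto simp: \<rho>_def rho_def)
    obtain C2 p2 where 2: "C2 \<ge> 0" "\<And>n x. norm (imat (mpow ?M' n) *v (x :: real^'d)) \<le> C2 * (1 + real n) ^ p2 * \<rho> ^ n * norm x"
      using int_matrix_growth[of \<rho> ?M'] \<rho>0 by (auto simp: \<rho>_def rho_def)
    \<comment> \<open>Common constants for both directions of the action; the bound \<rho> \<le> exp
      k is where the assumption on m enters.\<close>
    have est: "C * (1 + real n) ^ p' * \<rho> ^ n * norm x \<le> (C1 + C2) * (1 + real n) ^ (p1 + p2) * exp (k * real n) * norm x"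
      if "0 \<le> C" "C \<le> C1 + C2" "p' \<le> p1 + p2" for C p' n and x :: "real^'d"
    proof -
      have "\<rho> ^ n \<le> exp k ^ n" using \<rho>k \<rho>0 by (intro power_mono) auto
      also have "\<dots> = exp (k * real n)" by (simp add: exp_of_nat2_mult)
      finally have "\<rho> ^ n \<le> exp (k * real n)" .
      moreover have "(1 + real n) ^ p' \<le> (1 + real n) ^ (p1 + p2)" using that by (intro power_increasing) auto
      ultimately show ?thesis using that \<rho>0 1(1) 2(1) by (intro mult_mono) auto
    qed
    have gr: "norm (imat (zmat M j) *v x) \<le> (C1 + C2) * (1 + \<bar>of_int j\<bar>) ^ (p1 + p2) * exp (2 * pi\<^sup>2 / m * \<bar>of_int j\<bar>) * norm x"
      for j and x :: "real^'d"
    proof (cases j rule: int_cases2)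
      case (nonneg n)
      then show ?thesis using order_trans[OF 1(2) est[of C1 p1]] 1(1) 2(1) by (simp add: z1 k_def)
    next
      case (nonpos n)
      then show ?thesis using order_trans[OF 2(2) est[of C2 p2]] 1(1) 2(1) by (simp add: z2 k_def)
    qed
    interpret monomial_bundle_growth M m B "p1 + p2" "C1 + C2"
      by unfold_locales (use 1(1) 2(1) gr in auto)
    show "Stein_manifold (E_bundle m D M)" using Stein_E E by simp
  qed
qed

end
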